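(* Let $m,n,k\ge 1$ be integers with $k\ge 1+\frac{m-1}{n}$. Then for every multicake $C$ with $m$ islands and every $n$ value-measures $V_1,\dots,V_n$ on $C$, there exists a $k$-feasible allocation $(Z_1,\dots,Z_n)$ of $C$ that is proportional, i.e. $V_i(Z_i)\ge \frac1n V_i(C)$ for all $i\in\{1,\dots,n\}$; moreover such an allocation can be computed efficiently (by an algorithm polynomial in $m,n,k$).
   Context: A multicake $C$ with $m$ islands is the union of $m$ pairwise-disjoint intervals of unit length on the real line; these $m$ intervals are the islands. A value-measure on $C$ is a function of the form $V(Z)=\int_{Z} v(x)\,dx$ for (measurable) $Z\subseteq C$, where $v:C\to\mathbb{R}_{\ge 0}$ is integrable. An allocation is a vector $(Z_1,\dots,Z_n)$ of pairwise-disjoint subsets of $C$; their union need not be all of $C$ (free disposal). An allocation is $k$-feasible if each $Z_i$ is the union of at most $k$ intervals, each contained in a single island. Algorithms access the value-measures by two kinds of queries to an agent: reporting the agent's value of a given sub-interval of an island, and marking a point of an island such that the part of the island to the left of the point has a given value for the agent; each query counts as one step. *)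

theory Defs
  imports "HOL-Analysis.Analysis"
begin

section \<open>Multicakes, value-measures and allocations\<close>

text \<open>Islands are numbered \<open>0, \<dots>, m - 1\<close> and agents \<open>0, \<dots>, n - 1\<close>. An island may be open, closed
  or half-open, and different islands may touch.\<close>

definition islands :: "nat \<Rightarrow> (nat \<Rightarrow> real set) \<Rightarrow> bool" where
  "islands m I \<longleftrightarrow>
     (\<forall>j<m. is_interval (I j) \<and> measure lborel (I j) = 1) \<and> disjoint_family_on I {..<m}"

definition multicake :: "nat \<Rightarrow> (nat \<Rightarrow> real set) \<Rightarrow> real set" where
  "multicake m I = (\<Union>j<m. I j)"

definition value_measure :: "real set \<Rightarrow> (real set \<Rightarrow> real) \<Rightarrow> bool" where
  "value_measure C V \<longleftrightarrow>
     (\<exists>v. (\<forall>x\<in>C. 0 \<le> v x) \<and> set_integrable lebesgue C v \<and>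
          (\<forall>Z\<in>sets lebesgue. Z \<subseteq> C \<longrightarrow> V Z = (LINT x:Z|lebesgue. v x)))"

definition allocation :: "real set \<Rightarrow> nat \<Rightarrow> (nat \<Rightarrow> real set) \<Rightarrow> bool" where
  "allocation C n Z \<longleftrightarrow> (\<forall>i<n. Z i \<subseteq> C) \<and> disjoint_family_on Z {..<n}"

definition feasible :: "nat \<Rightarrow> nat \<Rightarrow> (nat \<Rightarrow> real set) \<Rightarrow> nat \<Rightarrow> (nat \<Rightarrow> real set) \<Rightarrow> bool" where
  "feasible k m I n Z \<longleftrightarrow>
     (\<forall>i<n. \<exists>S. finite S \<and> card S \<le> k \<and>
        (\<forall>J\<in>S. is_interval J \<and> (\<exists>j<m. J \<subseteq> I j)) \<and> Z i = \<Union>S)"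

definition proportional ::
    "real set \<Rightarrow> nat \<Rightarrow> (nat \<Rightarrow> real set \<Rightarrow> real) \<Rightarrow> (nat \<Rightarrow> real set) \<Rightarrow> bool" where
  "proportional C n V Z \<longleftrightarrow> (\<forall>i<n. V i (Z i) \<ge> 1 / real n * V i C)"


section \<open>Algorithms: real-RAM programs with queries\<close>

text \<open>An algorithm is a single program of a small imperative language with exact real arithmetic.
  The memory consists of named two-dimensional arrays of naturals and of reals; naturals can be
  converted to reals, but not vice versa (no rounding). Naturals have neither multiplication nor
  division, so that unit-cost arithmetic on them cannot be abused.\<close>

record state =
  nats :: "string \<Rightarrow> nat \<Rightarrow> nat \<Rightarrow> nat"
  reals :: "string \<Rightarrow> nat \<Rightarrow> nat \<Rightarrow> real"

datatype nexp =
    NLit nat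
  | NCell string nexp nexp
  | NAdd nexp nexp
  | NSub nexp nexp

datatype rexp =
    ROf nexp
  | RCell string nexp nexp
  | RAdd rexp rexp
  | RSub rexp rexp
  | RMul rexp rexp
  | RDiv rexp rexp

datatype bexp =
    NLess nexp nexp
  | RLess rexp rexp
  | BNot bexp
  | BAnd bexp bexp

text \<open>In the two query commands the first three arguments are the real cell receiving the answer,
  the next two the agent and the island. The last arguments are the end-points of the sub-interval
  to be evaluated, respectively the value to the left of the requested mark.\<close>

datatype com =
    Skip
  | NAssign string nexp nexp nexp
  | RAssign string nexp nexp rexp
  | EvalQuery string nexp nexp nexp nexp rexp rexp
  | MarkQuery string nexp nexp nexp nexp rexp
  | Seq com com
  | Cond bexp com com
  | While bexp com

primrec nval :: "nexp \<Rightarrow> state \<Rightarrow> nat" where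
  "nval (NLit c) s = c"
| "nval (NCell x a b) s = nats s x (nval a s) (nval b s)"
| "nval (NAdd a b) s = nval a s + nval b s"
| "nval (NSub a b) s = nval a s - nval b s"

primrec rval :: "rexp \<Rightarrow> state \<Rightarrow> real" where
  "rval (ROf a) s = real (nval a s)"
| "rval (RCell x a b) s = reals s x (nval a s) (nval b s)"
| "rval (RAdd a b) s = rval a s + rval b s"
| "rval (RSub a b) s = rval a s - rval b s"
| "rval (RMul a b) s = rval a s * rval b s"
| "rval (RDiv a b) s = rval a s / rval b s"

primrec bval :: "bexp \<Rightarrow> state \<Rightarrow> bool" where
  "bval (NLess a b) s \<longleftrightarrow> nval a s < nval b s"
| "bval (RLess a b) s \<longleftrightarrow> rval a s < rval b s"
| "bval (BNot b) s \<longleftrightarrow> \<not> bval b s"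
| "bval (BAnd b c) s \<longleftrightarrow> bval b s \<and> bval c s"

definition put :: "(string \<Rightarrow> nat \<Rightarrow> nat \<Rightarrow> 'a) \<Rightarrow> string \<Rightarrow> nat \<Rightarrow> nat \<Rightarrow> 'a \<Rightarrow> (string \<Rightarrow> nat \<Rightarrow> nat \<Rightarrow> 'a)" where
  "put M x a b c = M(x := (M x)(a := (M x a)(b := c)))"

text \<open>\<open>exec ev mk p s t s'\<close>: started in \<open>s\<close>, program \<open>p\<close> terminates in \<open>s'\<close> after \<open>t\<close> steps, when
  queries are answered by \<open>ev agent island a b\<close> and \<open>mk agent island r\<close>. Every query, assignment
  and test is one step. Expressions need not be charged by size: the program is fixed, so this
  changes \<open>t\<close> by a constant factor only.\<close>

inductive exec ::
    "(nat \<Rightarrow> nat \<Rightarrow> real \<Rightarrow> real \<Rightarrow> real) \<Rightarrow> (nat \<Rightarrow> nat \<Rightarrow> real \<Rightarrow> real) \<Rightarrow> com \<Rightarrow> state \<Rightarrow> nat \<Rightarrow> state \<Rightarrow> bool"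
  for ev mk where
  Skip: "exec ev mk Skip s 1 s"
| NAssign: "exec ev mk (NAssign x a b e) s 1
     (s\<lparr>nats := put (nats s) x (nval a s) (nval b s) (nval e s)\<rparr>)"
| RAssign: "exec ev mk (RAssign x a b e) s 1
     (s\<lparr>reals := put (reals s) x (nval a s) (nval b s) (rval e s)\<rparr>)"
| EvalQuery: "exec ev mk (EvalQuery x a b i j l r) s 1
     (s\<lparr>reals := put (reals s) x (nval a s) (nval b s)
                   (ev (nval i s) (nval j s) (rval l s) (rval r s))\<rparr>)"
| MarkQuery: "exec ev mk (MarkQuery x a b i j r) s 1
     (s\<lparr>reals := put (reals s) x (nval a s) (nval b s) (mk (nval i s) (nval j s) (rval r s))\<rparr>)"
| Seq: "exec ev mk p s t s' \<Longrightarrow> exec ev mk q s' u s'' \<Longrightarrow> exec ev mk (Seq p q) s (t + u) s''"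
| CondTrue: "bval b s \<Longrightarrow> exec ev mk p s t s' \<Longrightarrow> exec ev mk (Cond b p q) s (Suc t) s'"
| CondFalse: "\<not> bval b s \<Longrightarrow> exec ev mk q s t s' \<Longrightarrow> exec ev mk (Cond b p q) s (Suc t) s'"
| WhileFalse: "\<not> bval b s \<Longrightarrow> exec ev mk (While b p) s 1 s"
| WhileTrue: "bval b s \<Longrightarrow> exec ev mk p s t s' \<Longrightarrow> exec ev mk (While b p) s' u s'' \<Longrightarrow>
     exec ev mk (While b p) s (Suc (t + u)) s''"

text \<open>The answers are only constrained on legal queries. A mark need not be unique where the density
  vanishes; any admissible answer is allowed. It may be an end-point of the island that
  does not belong to the island itself, since otherwise the mark of the full value of an open
  island need not exist.\<close>

definition truthful ::
    "nat \<Rightarrow> (nat \<Rightarrow> real set) \<Rightarrow> nat \<Rightarrow> (nat \<Rightarrow> real set \<Rightarrow> real) \<Rightarrow>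
     (nat \<Rightarrow> nat \<Rightarrow> real \<Rightarrow> real \<Rightarrow> real) \<Rightarrow> (nat \<Rightarrow> nat \<Rightarrow> real \<Rightarrow> real) \<Rightarrow> bool" where
  "truthful m I n V ev mk \<longleftrightarrow>
     (\<forall>i<n. \<forall>j<m.
        (\<forall>a b. a \<le> b \<longrightarrow> a \<in> closure (I j) \<longrightarrow> b \<in> closure (I j) \<longrightarrow>
            ev i j a b = V i ({a..b} \<inter> I j)) \<and>
        (\<forall>r. 0 \<le> r \<longrightarrow> r \<le> V i (I j) \<longrightarrow>
            mk i j r \<in> closure (I j) \<and> V i ({..mk i j r} \<inter> I j) = r))"

text \<open>Truthful answers always exist, since cumulative value is continuous.\<close>

lemma ex_mark:
  assumes isl: "islands m I" and V: "value_measure (multicake m I) V" and j: "j < m"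
    and r: "0 \<le> r" "r \<le> V (I j)"
  shows "\<exists>p\<in>closure (I j). V ({..p} \<inter> I j) = r"
proof -
  obtain v where vint: "set_integrable lebesgue (multicake m I) v"
    and vV: "\<And>Z. Z \<in> sets lebesgue \<Longrightarrow> Z \<subseteq> multicake m I \<Longrightarrow> V Z = (LINT x:Z|lebesgue. v x)"
    using V unfolding value_measure_def by blast
  have int: "is_interval (I j)" and len: "measure lborel (I j) = 1"
    using isl j by (auto simp: islands_def)
  have sub: "I j \<subseteq> multicake m I" using j by (auto simp: multicake_def)
  have meas: "I j \<in> sets borel"
    using int by (simp add: is_interval_convex real_interval_borel_measurable)
  have ne: "I j \<noteq> {}" using len by auto
  have bdd: "bounded (I j)"
  proof (rule ccontr)
    assume unb: "\<not> bounded (I j)"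
    obtain x y where xy: "x \<in> I j" "y \<in> I j" "y - x > 1"
    proof -
      obtain x where x: "x \<in> I j" using ne by blast
      obtain y where y: "y \<in> I j" "\<not> dist x y \<le> 2"
        using unb unfolding bounded_def by blast
      show ?thesis
      proof (cases "x \<le> y")
        case True
        then show ?thesis using that[of x y] x y by (auto simp: dist_real_def)
      next
        case False
        then show ?thesis using that[of y x] x y by (auto simp: dist_real_def)
      qed
    qed
    have cc: "{x..y} \<subseteq> I j" using mem_is_interval_1_I[OF int xy(1,2)] by (simp add: subset_iff)
    have "emeasure lborel (I j) \<noteq> \<infinity>" using len unfolding measure_def by fastforce
    then have "measure lborel {x..y} \<le> measure lborel (I j)"
      using cc meas by (intro measure_mono_fmeasurable fmeasurableI) (auto simp: top.not_eq_extremum)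
    then show False using xy len by simp
  qed
  define a where "a = Inf (I j)"
  define b where "b = Sup (I j)"
  have ab: "a \<in> closure (I j)" "b \<in> closure (I j)"
    unfolding a_def b_def using ne bdd
    by (auto intro!: closure_contains_Inf closure_contains_Sup simp: bounded_imp_bdd_above bounded_imp_bdd_below)
  have le: "I j \<subseteq> {a..b}"
    unfolding a_def b_def using bdd
    by (auto intro!: cInf_lower cSup_upper simp: bounded_imp_bdd_above bounded_imp_bdd_below)
  have leab: "a \<le> b" using le ne by fastforce
  have clos: "{a..b} \<subseteq> closure (I j)"
  proof -
    have "convex (closure (I j))" using int by (simp add: is_interval_convex convex_closure)
    then have "closed_segment a b \<subseteq> closure (I j)" using ab by (simp add: convex_contains_segment)
    then show ?thesis using leab by (simp add: closed_segment_eq_real_ivl)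
  qed
  define w where "w x = (if x \<in> I j then v x else 0)" for x
  have absI: "v absolutely_integrable_on S" if "S \<subseteq> I j" "S \<in> sets borel" for S
    by (rule set_integrable_subset[OF vint]) (use that sub in auto)
  have VI: "V S = integral S v" if "S \<subseteq> I j" "S \<in> sets borel" for S
    using vV[of S] that sub set_lebesgue_integral_eq_integral(2)[OF absI[OF that]] by auto
  have wint: "w integrable_on {a..b}"
  proof -
    have "v integrable_on I j"
      using absI[of "I j"] meas set_lebesgue_integral_eq_integral(1) by blast
    then show ?thesis unfolding w_def
      using integrable_restrict_Int[of "I j" v "{a..b}"] le by (simp add: Int_absorb2)
  qed
  have F: "V ({..p} \<inter> I j) = integral {a..p} w" if "p \<in> {a..b}" for p
  proof -
    have "integral {a..p} w = integral (I j \<inter> {a..p}) v"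
      unfolding w_def by (rule integral_restrict_Int)
    also have "I j \<inter> {a..p} = {..p} \<inter> I j" using le by auto
    finally show ?thesis using VI[of "{..p} \<inter> I j"] meas by auto
  qed
  have cont: "continuous_on {a..b} (\<lambda>p. integral {a..p} w)"
    by (rule indefinite_integral_continuous_1[OF wint])
  have "{..b} \<inter> I j = I j" using le by auto
  then have "integral {a..b} w = V (I j)" using F[of b] leab by simp
  then obtain p where "a \<le> p" "p \<le> b" "integral {a..p} w = r"
    using IVT'[OF _ _ leab cont, of r] r by auto
  then show ?thesis using F[of p] clos by auto
qed

lemma ex_truthful:
  assumes "islands m I" and "\<And>i. i < n \<Longrightarrow> value_measure (multicake m I) (V i)"
  shows "\<exists>ev mk. truthful m I n V ev mk"
proof -
  have "\<forall>i j r. \<exists>p. i < n \<longrightarrow> j < m \<longrightarrow> 0 \<le> r \<longrightarrow> r \<le> V i (I j) \<longrightarrow>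
          p \<in> closure (I j) \<and> V i ({..p} \<inter> I j) = r"
    using ex_mark[OF assms] by blast
  then obtain mk where "\<forall>i j r. i < n \<longrightarrow> j < m \<longrightarrow> 0 \<le> r \<longrightarrow> r \<le> V i (I j) \<longrightarrow>
          mk i j r \<in> closure (I j) \<and> V i ({..mk i j r} \<inter> I j) = r"
    by metis
  then have "truthful m I n V (\<lambda>i j a b. V i ({a..b} \<inter> I j)) mk"
    by (simp add: truthful_def)
  then show ?thesis by blast
qed

text \<open>The input consists of \<open>m\<close>, \<open>n\<close>, \<open>k\<close> and the left end-points of the islands; all other cells
  are 0. The value-measures are accessible through queries only.\<close>

definition initial :: "nat \<Rightarrow> nat \<Rightarrow> nat \<Rightarrow> (nat \<Rightarrow> real set) \<Rightarrow> state" where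
  "initial m n k I =
     \<lparr>nats = put (put (put (\<lambda>_ _ _. 0) ''m'' 0 0 m) ''n'' 0 0 n) ''k'' 0 0 k,
      reals = (\<lambda>x a b. if x = ''left'' \<and> a < m \<and> b = 0 then Inf (I a) else 0)\<rparr>"

text \<open>The output lists \<open>k\<close> open intervals per agent. Those with right end-point not above the left
  one are empty, so an agent may get fewer than \<open>k\<close>.\<close>

definition outcome :: "nat \<Rightarrow> state \<Rightarrow> nat \<Rightarrow> real set" where
  "outcome k s i = (\<Union>j<k. {reals s ''lo'' i j <..< reals s ''hi'' i j})"

end

theory Submission
  imports Defs
begin

text \<open>The hypothesis on \<open>k\<close> says \<open>m \<le> n (k - 1) + 1\<close>. Worthless dummy islands make this an equality;
write \<open>M = n (k - 1) + 1\<close> for the padded number of islands, and divide them into \<open>n\<close> groups of \<open>k - 1\<close>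
islands and one spare island. The share of an agent is the fraction \<open>1/n\<close> of its value of the cake.

Agents leave one after another. Whoever leaves takes a whole group, possibly together with an initial
piece of one more island: that is at most \<open>k\<close> intervals, and only \<open>k - 1\<close> islands disappear. So \<open>l\<close>
remaining agents always face \<open>l (k - 1) + 1\<close> islands in \<open>l\<close> groups and a spare one. If
what each departing agent takes is worth at most a share to each of those who stay, then they still
value the rest at \<open>l\<close> shares or more. This is the invariant \<open>plan\<close>, and there are two ways
to let somebody leave.

If every group is worth a share to somebody, a nonempty set of agents can leave with whole groups that
nobody else wants. They are found by an ascending auction. Every agent has a label, at first 0. A free group
goes to an agent of least label among those who want it; the label rises by one, and the group that the
agent held before becomes free. Hence the label of a holder exceeds the label of any agent who wants
the group by at most one. As soon as some label \<open>l\<close> is no longer in use below larger ones, the agents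
with labels above \<open>l\<close> all hold groups that nobody with a label below \<open>l\<close> wants, and they leave
(\<open>auction_bump\<close>, \<open>auction_gap\<close>, \<open>plan_match\<close>).

Otherwise some group \<open>S\<close> is worth less than a share to everybody. Fix an agent \<open>a\<close>. As long as no island
outside \<open>S\<close> can be added so that somebody reaches a share, an island of \<open>S\<close> can be exchanged for one that \<open>a\<close>
values more, and \<open>S\<close> remains below everybody's share. This cannot go on forever: once \<open>S\<close>
consists of the \<open>k - 1\<close> islands that \<open>a\<close> values most, averaging shows that the best \<open>k\<close> islands are worth a
share to \<open>a\<close> (\<open>top_group_extends\<close>). When \<open>S\<close> can be extended by an island \<open>x\<close>, all agents who would be
satisfied mark on \<open>x\<close> the point up to which they need it, and the one with the leftmost mark leaves with \<open>S\<close>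
and the part of \<open>x\<close> up to that mark (\<open>plan_cut\<close>).

This is an algorithm. Its main loop is bounded by a potential that falls with every rise of a label and
every departure, and its exchange loop by the number of inversions, that is of pairs of
an island in \<open>S\<close> and a more valuable one outside. The program is verified with a
weakest-precondition calculus in which every loop may run at most \<open>B\<close> times. For a fixed program this
gives a running time polynomial in \<open>B\<close>, and \<open>B = (m + n + k)^5\<close> suffices. The existence of an allocation
follows from the algorithm, since truthful answers to the queries always exist.\<close>

section \<open>A step-counting program logic\<close>

definition frame :: "string set \<Rightarrow> string set \<Rightarrow> state \<Rightarrow> state \<Rightarrow> bool" where
  "frame X Y s s' \<longleftrightarrow> (\<forall>x. x \<notin> X \<longrightarrow> nats s' x = nats s x) \<and> (\<forall>x. x \<notin> Y \<longrightarrow> reals s' x = reals s x)"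

lemma frame_refl: "frame X Y s s"
  by (simp add: frame_def)

lemma frame_trans: "frame X Y s s' \<Longrightarrow> frame X' Y' s' s'' \<Longrightarrow> frame (X \<union> X') (Y \<union> Y') s s''"
  by (simp add: frame_def)

lemma frame_mono: "frame X Y s s' \<Longrightarrow> X \<subseteq> X' \<Longrightarrow> Y \<subseteq> Y' \<Longrightarrow> frame X' Y' s s'"
  by (auto simp: frame_def)

lemma put_apply:
  "put M x a b c y = (if y = x then (M x)(a := (M x a)(b := c)) else M y)"
  by (simp add: put_def)

primrec nat_names :: "com \<Rightarrow> string set" where
  "nat_names Skip = {}"
| "nat_names (NAssign x a b e) = {x}"
| "nat_names (RAssign x a b e) = {}"
| "nat_names (EvalQuery x a b i j l r) = {}"
| "nat_names (MarkQuery x a b i j r) = {}"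
| "nat_names (Seq p q) = nat_names p \<union> nat_names q"
| "nat_names (Cond b p q) = nat_names p \<union> nat_names q"
| "nat_names (While b p) = nat_names p"

primrec real_names :: "com \<Rightarrow> string set" where
  "real_names Skip = {}"
| "real_names (NAssign x a b e) = {}"
| "real_names (RAssign x a b e) = {x}"
| "real_names (EvalQuery x a b i j l r) = {x}"
| "real_names (MarkQuery x a b i j r) = {x}"
| "real_names (Seq p q) = real_names p \<union> real_names q"
| "real_names (Cond b p q) = real_names p \<union> real_names q"
| "real_names (While b p) = real_names p"

text \<open>An upper bound for the number of steps that depends on the program text only, provided that no loop
makes more than \<open>B\<close> iterations each time it is entered.\<close>

primrec cost :: "nat \<Rightarrow> com \<Rightarrow> nat" where
  "cost B Skip = 1"
| "cost B (NAssign x a b e) = 1"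
| "cost B (RAssign x a b e) = 1"
| "cost B (EvalQuery x a b i j l r) = 1"
| "cost B (MarkQuery x a b i j r) = 1"
| "cost B (Seq p q) = cost B p + cost B q"
| "cost B (Cond b p q) = Suc (cost B p + cost B q)"
| "cost B (While b p) = Suc (B * Suc (cost B p))"

text \<open>Only loops multiply the cost, by a factor linear in \<open>B\<close>. This reduces the polynomial running time
of a fixed program to a polynomial bound on the iterations of its loops.\<close>

lemma cost_polynomial: "\<exists>c d. \<forall>B\<ge>1. cost B p \<le> c * B ^ d"
proof -
  have add: "\<exists>c d. \<forall>B\<ge>1. f B + g B \<le> c * B ^ d"
    if fg: "\<exists>c d. \<forall>B\<ge>1. f B \<le> c * B ^ d" "\<exists>c d. \<forall>B\<ge>1. g B \<le> c * B ^ d" for f g :: "nat \<Rightarrow> nat"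
  proof -
    obtain c d c' d' where fg: "\<forall>B\<ge>1. f B \<le> c * B ^ d" "\<forall>B\<ge>1. g B \<le> c' * B ^ d'"
      using fg by blast
    have "f B + g B \<le> (c + c') * B ^ (d + d')" if B: "B \<ge> 1" for B
    proof -
      have "c * B ^ d \<le> c * B ^ (d + d')" "c' * B ^ d' \<le> c' * B ^ (d + d')"
        using B by (auto intro!: mult_le_mono2 power_increasing)
      moreover have "f B \<le> c * B ^ d" "g B \<le> c' * B ^ d'" using fg B by auto
      ultimately show ?thesis unfolding add_mult_distrib by linarith
    qed
    then show ?thesis by blast
  qed
  have one: "\<exists>c d. \<forall>B\<ge>1. (1::nat) \<le> c * B ^ d"
    by (rule exI[of _ 1], rule exI[of _ 0]) simp
  show ?thesis
  proof (induction p)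
    case (Cond b p q)
    then show ?case using add[OF one add[OF Cond]] by simp
  next
    case (While b p)
    obtain c d where cd: "\<forall>B\<ge>1. 1 + cost B p \<le> c * B ^ d"
      using add[OF one While] by blast
    then have "\<forall>B\<ge>1. B * (1 + cost B p) \<le> c * B ^ Suc d"
      by (metis mult.left_commute mult_le_mono2 power_Suc)
    then have "\<exists>c d. \<forall>B\<ge>1. B * (1 + cost B p) \<le> c * B ^ d" by blast
    from add[OF one this] show ?case by simp
  qed (use one add in simp_all)
qed

locale answers =
  fixes ev :: "nat \<Rightarrow> nat \<Rightarrow> real \<Rightarrow> real \<Rightarrow> real" and mk :: "nat \<Rightarrow> nat \<Rightarrow> real \<Rightarrow> real" and B :: nat
begin

text \<open>The weakest precondition for terminating within \<open>B\<close> iterations of every loop. Since the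
iterations are bounded, it can be defined by recursion on the program, and it unfolds by
simplification on loop-free code.\<close>

primrec wp :: "com \<Rightarrow> (state \<Rightarrow> bool) \<Rightarrow> state \<Rightarrow> bool" where
  "wp Skip Q s = Q s"
| "wp (NAssign x a b e) Q s = Q (s\<lparr>nats := put (nats s) x (nval a s) (nval b s) (nval e s)\<rparr>)"
| "wp (RAssign x a b e) Q s = Q (s\<lparr>reals := put (reals s) x (nval a s) (nval b s) (rval e s)\<rparr>)"
| "wp (EvalQuery x a b i j l r) Q s = Q (s\<lparr>reals := put (reals s) x (nval a s) (nval b s)
                   (ev (nval i s) (nval j s) (rval l s) (rval r s))\<rparr>)"
| "wp (MarkQuery x a b i j r) Q s =
     Q (s\<lparr>reals := put (reals s) x (nval a s) (nval b s) (mk (nval i s) (nval j s) (rval r s))\<rparr>)"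
| "wp (Seq p q) Q s = wp p (wp q Q) s"
| "wp (Cond b p q) Q s = (if bval b s then wp p Q s else wp q Q s)"
| "wp (While b p) Q s =
     ((\<lambda>R s. if bval b s then wp p R s else Q s) ^^ B) (\<lambda>s. \<not> bval b s \<and> Q s) s"

lemma wp_sound: "wp p Q s \<Longrightarrow> \<exists>t s'. exec ev mk p s t s' \<and> t \<le> cost B p \<and> Q s'"
proof (induction p arbitrary: Q s)
  case (Seq p q)
  then have "wp p (wp q Q) s" by simp
  then obtain t s' where 1: "exec ev mk p s t s'" "t \<le> cost B p" "wp q Q s'" using Seq.IH(1) by blast
  obtain u s'' where 2: "exec ev mk q s' u s''" "u \<le> cost B q" "Q s''" using Seq.IH(2)[OF 1(3)] by blast
  show ?case using exec.Seq[OF 1(1) 2(1)] 1 2 by (auto intro!: exI[of _ "t + u"] exI[of _ s''])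
next
  case (Cond b p q)
  show ?case
  proof (cases "bval b s")
    case True
    then obtain t s' where "exec ev mk p s t s'" "t \<le> cost B p" "Q s'" using Cond by fastforce
    then show ?thesis using exec.CondTrue[OF True, of ev mk p t s' q]
      by (auto intro!: exI[of _ "Suc t"] exI[of _ s'])
  next
    case False
    then obtain t s' where "exec ev mk q s t s'" "t \<le> cost B q" "Q s'" using Cond by fastforce
    then show ?thesis using exec.CondFalse[OF False, of ev mk q t s' p]
      by (auto intro!: exI[of _ "Suc t"] exI[of _ s'])
  qed
next
  case (While b p)
  have "\<exists>t s'. exec ev mk (While b p) s t s' \<and> t \<le> Suc (j * Suc (cost B p)) \<and> Q s'"
    if "((\<lambda>R s. if bval b s then wp p R s else Q s) ^^ j) (\<lambda>s. \<not> bval b s \<and> Q s) s" for j s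
    using that
  proof (induction j arbitrary: s)
    case 0
    then show ?case using exec.WhileFalse by fastforce
  next
    case (Suc j)
    show ?case
    proof (cases "bval b s")
      case True
      then obtain t s' where 1: "exec ev mk p s t s'" "t \<le> cost B p"
        "((\<lambda>R s. if bval b s then wp p R s else Q s) ^^ j) (\<lambda>s. \<not> bval b s \<and> Q s) s'"
        using Suc.prems While.IH by fastforce
      obtain u s'' where 2: "exec ev mk (While b p) s' u s''" "u \<le> Suc (j * Suc (cost B p))" "Q s''"
        using Suc.IH[OF 1(3)] by blast
      show ?thesis using exec.WhileTrue[OF True 1(1) 2(1)] 1 2
        by (auto intro!: exI[of _ "Suc (t + u)"] exI[of _ s''])
    next
      case False
      then show ?thesis using Suc.prems exec.WhileFalse[OF False, of ev mk p] by fastforce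
    qed
  qed
  from this[of B s] While.prems show ?case by simp
qed (fastforce intro: exec.intros)+

lemma wp_mono: "wp p Q s \<Longrightarrow> (\<And>s'. Q s' \<Longrightarrow> Q' s') \<Longrightarrow> wp p Q' s"
proof (induction p arbitrary: Q Q' s)
  case (Seq p q)
  from Seq.prems(1) have "wp p (wp q Q) s" by simp
  then have "wp p (wp q Q') s"
    by (rule Seq.IH(1)) (rule Seq.IH(2), assumption, rule Seq.prems(2))
  then show ?case by simp
next
  case (Cond b p q)
  then show ?case by (auto split: if_splits)
next
  case (While b p)
  let ?F = "\<lambda>Q R s. if bval b s then wp p R s else Q s"
  have "(?F Q' ^^ j) (\<lambda>s. \<not> bval b s \<and> Q' s) s" if "(?F Q ^^ j) (\<lambda>s. \<not> bval b s \<and> Q s) s" for j s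
    using that
  proof (induction j arbitrary: s)
    case (Suc j)
    show ?case
    proof (cases "bval b s")
      case True
      then have "wp p ((?F Q ^^ j) (\<lambda>s. \<not> bval b s \<and> Q s)) s" using Suc.prems by simp
      then have "wp p ((?F Q' ^^ j) (\<lambda>s. \<not> bval b s \<and> Q' s)) s"
        by (rule While.IH) (rule Suc.IH)
      then show ?thesis using True by simp
    qed (use Suc.prems While.prems in simp)
  qed (use While.prems in simp)
  then show ?case using While.prems by simp
qed auto

text \<open>Any postcondition may be strengthened by the fact that only assigned arrays change. So invariants
need to speak only of what a loop does to the arrays that it writes.\<close>

lemma wp_frame: "wp p Q s \<Longrightarrow> wp p (\<lambda>s'. Q s' \<and> frame (nat_names p) (real_names p) s s') s"
proof (induction p arbitrary: Q s)
  case (Seq p q)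
  then have "wp p (wp q Q) s" by simp
  then have "wp p (\<lambda>s'. wp q Q s' \<and> frame (nat_names p) (real_names p) s s') s" by (rule Seq.IH(1))
  then have "wp p (wp q (\<lambda>s'. Q s' \<and> frame (nat_names p \<union> nat_names q) (real_names p \<union> real_names q) s s')) s"
  proof (rule wp_mono)
    fix s' assume "wp q Q s' \<and> frame (nat_names p) (real_names p) s s'"
    then have "wp q (\<lambda>s''. Q s'' \<and> frame (nat_names q) (real_names q) s' s'') s'"
      and f: "frame (nat_names p) (real_names p) s s'"
      using Seq.IH(2) by auto
    then show "wp q (\<lambda>s'. Q s' \<and> frame (nat_names p \<union> nat_names q) (real_names p \<union> real_names q) s s') s'"
      by (elim wp_mono) (auto intro: frame_trans)
  qed
  then show ?case by simp
next
  case (Cond b p q)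
  show ?case
  proof (cases "bval b s")
    case True
    then have "wp p (\<lambda>s'. Q s' \<and> frame (nat_names p) (real_names p) s s') s" using Cond by simp
    then have "wp p (\<lambda>s'. Q s' \<and> frame (nat_names (Cond b p q)) (real_names (Cond b p q)) s s') s"
      by (rule wp_mono) (auto intro: frame_mono)
    then show ?thesis using True by simp
  next
    case False
    then have "wp q (\<lambda>s'. Q s' \<and> frame (nat_names q) (real_names q) s s') s" using Cond by simp
    then have "wp q (\<lambda>s'. Q s' \<and> frame (nat_names (Cond b p q)) (real_names (Cond b p q)) s s') s"
      by (rule wp_mono) (auto intro: frame_mono)
    then show ?thesis using False by simp
  qed
next
  case (While b p)
  let ?F = "\<lambda>Q R s. if bval b s then wp p R s else Q s"
  let ?fr = "frame (nat_names p) (real_names p)"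
  have "(?F (\<lambda>s'. Q s' \<and> ?fr s0 s') ^^ j) (\<lambda>s. \<not> bval b s \<and> Q s \<and> ?fr s0 s) s"
    if "(?F Q ^^ j) (\<lambda>s. \<not> bval b s \<and> Q s) s" "?fr s0 s" for j s s0
    using that
  proof (induction j arbitrary: s)
    case (Suc j)
    show ?case
    proof (cases "bval b s")
      case True
      then have "wp p ((?F Q ^^ j) (\<lambda>s. \<not> bval b s \<and> Q s)) s" using Suc.prems by simp
      then have "wp p (\<lambda>s'. (?F Q ^^ j) (\<lambda>s. \<not> bval b s \<and> Q s) s' \<and> ?fr s s') s"
        by (rule While.IH)
      then have "wp p ((?F (\<lambda>s'. Q s' \<and> ?fr s0 s') ^^ j) (\<lambda>s. \<not> bval b s \<and> Q s \<and> ?fr s0 s)) s"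
        by (rule wp_mono) (use Suc.IH Suc.prems(2) frame_trans[of _ _ s0 s] in fastforce)
      then show ?thesis using True by simp
    qed (use Suc.prems in simp)
  qed simp
  from this[of B s s] While.prems show ?case by (simp add: frame_refl)
qed (auto simp: frame_def put_apply)

lemma wp_While:
  fixes \<mu> :: "state \<Rightarrow> nat"
  assumes "I s" and "\<mu> s \<le> B"
    and step: "\<And>s. I s \<Longrightarrow> bval b s \<Longrightarrow> wp p (\<lambda>s'. I s' \<and> \<mu> s' < \<mu> s) s"
    and exit: "\<And>s. I s \<Longrightarrow> \<not> bval b s \<Longrightarrow> Q s"
  shows "wp (While b p) Q s"
proof -
  let ?F = "\<lambda>R s. if bval b s then wp p R s else Q s"
  have "(?F ^^ j) (\<lambda>s. \<not> bval b s \<and> Q s) s" if "I s" "\<mu> s \<le> j" for j s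
    using that
  proof (induction j arbitrary: s)
    case 0
    \<comment> \<open>another iteration would end in a state of negative measure\<close>
    have "\<not> bval b s"
    proof
      assume "bval b s"
      from wp_sound[OF step[OF 0(1) this]] 0(2) show False by auto
    qed
    then show ?case using exit[OF 0(1)] by simp
  next
    case (Suc j)
    show ?case
    proof (cases "bval b s")
      case True
      have "wp p (\<lambda>s'. I s' \<and> \<mu> s' < \<mu> s) s" by (rule step[OF Suc.prems(1) True])
      then have "wp p ((?F ^^ j) (\<lambda>s. \<not> bval b s \<and> Q s)) s"
        by (rule wp_mono) (use Suc in auto)
      then show ?thesis using True by simp
    qed (use Suc.prems exit in simp)
  qed
  from this[OF assms(1,2)] show ?thesis by simp
qed

end

section \<open>Counting loops, searching and minimising\<close>

abbreviation NVar :: "string \<Rightarrow> nexp" where "NVar x \<equiv> NCell x (NLit 0) (NLit 0)"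
abbreviation NArr :: "string \<Rightarrow> nexp \<Rightarrow> nexp" where "NArr x a \<equiv> NCell x a (NLit 0)"
abbreviation RArr :: "string \<Rightarrow> nexp \<Rightarrow> rexp" where "RArr x a \<equiv> RCell x a (NLit 0)"
abbreviation SetVar :: "string \<Rightarrow> nexp \<Rightarrow> com" where "SetVar x e \<equiv> NAssign x (NLit 0) (NLit 0) e"
abbreviation SetArr :: "string \<Rightarrow> nexp \<Rightarrow> nexp \<Rightarrow> com" where "SetArr x a e \<equiv> NAssign x a (NLit 0) e"
abbreviation NEq :: "nexp \<Rightarrow> nexp \<Rightarrow> bexp" where "NEq a b \<equiv> BAnd (BNot (NLess a b)) (BNot (NLess b a))"

text \<open>The bound is a variable, so that it can be read off the state when the loop is entered.\<close>

definition For :: "string \<Rightarrow> string \<Rightarrow> com \<Rightarrow> com" where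
  "For x y p = Seq (SetVar x (NLit 0))
     (While (NLess (NVar x) (NVar y)) (Seq p (SetVar x (NAdd (NVar x) (NLit 1)))))"

text \<open>\<open>Search x y z q b\<close> leaves in \<open>x\<close> an index \<open>z < y\<close> for which the test \<open>b\<close>, prepared by the program \<open>q\<close>,
succeeds. The value \<open>y\<close> itself stands for failure.\<close>

definition Search :: "string \<Rightarrow> string \<Rightarrow> string \<Rightarrow> com \<Rightarrow> bexp \<Rightarrow> com" where
  "Search x y z q b = Seq (SetVar x (NVar y)) (For z y (Seq q (Cond b (SetVar x (NVar z)) Skip)))"

text \<open>As in a search, \<open>x = y\<close> means that no index passes the test; otherwise \<open>x\<close> is a passing index with the
least entry in the array \<open>key\<close>.\<close>

definition ArgMin :: "string \<Rightarrow> string \<Rightarrow> string \<Rightarrow> bexp \<Rightarrow> string \<Rightarrow> com" where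
  "ArgMin x y z b key = Seq (SetVar x (NVar y)) (For z y
     (Cond (BAnd b (BNot (BAnd (NLess (NVar x) (NVar y))
                               (BNot (RLess (RArr key (NVar z)) (RArr key (NVar x)))))))
       (SetVar x (NVar z)) Skip))"

lemma names_For [simp]:
  "nat_names (For x y p) = insert x (nat_names p)" "real_names (For x y p) = real_names p"
  by (auto simp: For_def)

lemma names_Search [simp]:
  "nat_names (Search x y z q b) = insert x (insert z (nat_names q))"
  "real_names (Search x y z q b) = real_names q"
  by (auto simp: Search_def)

lemma names_ArgMin [simp]:
  "nat_names (ArgMin x y z b key) = {x, z}" "real_names (ArgMin x y z b key) = {}"
  by (auto simp: ArgMin_def)

context answers
begin

text \<open>The invariant \<open>I i\<close> holds before the iteration \<open>i\<close>. The frame condition in the step and at the exit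
relates the current state to the one in which the loop was entered.\<close>

lemma wp_For:
  fixes I :: "nat \<Rightarrow> state \<Rightarrow> bool"
  assumes N: "nats s y 0 0 = N" "N \<le> B"
    and names: "x \<notin> nat_names p" "y \<notin> nat_names p" "x \<noteq> y"
    and init: "I 0 (s\<lparr>nats := put (nats s) x 0 0 0\<rparr>)"
    and step: "\<And>i s'. i < N \<Longrightarrow> nats s' x 0 0 = i \<Longrightarrow>
       frame (insert x (nat_names p)) (real_names p) s s' \<Longrightarrow> I i s' \<Longrightarrow>
       wp p (\<lambda>s''. I (Suc i) (s''\<lparr>nats := put (nats s'') x 0 0 (Suc i)\<rparr>)) s'"
    and exit: "\<And>s'. frame (insert x (nat_names p)) (real_names p) s s' \<Longrightarrow> I N s' \<Longrightarrow> Q s'"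
  shows "wp (For x y p) Q s"
proof -
  let ?s = "s\<lparr>nats := put (nats s) x 0 0 0\<rparr>"
  let ?fr = "frame (insert x (nat_names p)) (real_names p) s"
  let ?J = "\<lambda>s'. ?fr s' \<and> nats s' x 0 0 \<le> N \<and> I (nats s' x 0 0) s'"
  have fN: "nats s' y 0 0 = N" if "?fr s'" for s'
    using that names N by (auto simp: frame_def)
  have "wp (While (NLess (NVar x) (NVar y)) (Seq p (SetVar x (NAdd (NVar x) (NLit 1))))) Q ?s"
  proof (rule wp_While[where I = ?J and \<mu> = "\<lambda>s'. N - nats s' x 0 0"])
    show "?J ?s" using init by (auto simp: frame_def put_apply)
    show "N - nats ?s x 0 0 \<le> B" using N by simp
  next
    fix s' assume J: "?J s'" and "bval (NLess (NVar x) (NVar y)) s'"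
    then have lt: "nats s' x 0 0 < N" by (simp add: fN)
    let ?i = "nats s' x 0 0"
    have "wp p (\<lambda>s''. I (Suc ?i) (s''\<lparr>nats := put (nats s'') x 0 0 (Suc ?i)\<rparr>)) s'"
      using step lt J by blast
    from wp_frame[OF this]
    have "wp p (wp (SetVar x (NAdd (NVar x) (NLit 1))) (\<lambda>t. ?J t \<and> N - nats t x 0 0 < N - nats s' x 0 0)) s'"
    proof (rule wp_mono)
      fix t assume t: "I (Suc ?i) (t\<lparr>nats := put (nats t) x 0 0 (Suc ?i)\<rparr>) \<and>
          frame (nat_names p) (real_names p) s' t"
      then have "nats t x 0 0 = ?i" using names by (simp add: frame_def)
      moreover have "?fr (t\<lparr>nats := put (nats t) x 0 0 (Suc ?i)\<rparr>)"
        using t J by (auto simp: frame_def put_apply)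
      ultimately show "wp (SetVar x (NAdd (NVar x) (NLit 1))) (\<lambda>t. ?J t \<and> N - nats t x 0 0 < N - nats s' x 0 0) t"
        using t lt by (auto simp: put_apply)
    qed
    then show "wp (Seq p (SetVar x (NAdd (NVar x) (NLit 1)))) (\<lambda>t. ?J t \<and> N - nats t x 0 0 < N - nats s' x 0 0) s'"
      by simp
  next
    fix s' assume J: "?J s'" and "\<not> bval (NLess (NVar x) (NVar y)) s'"
    then have "nats s' x 0 0 = N" using fN[of s'] by simp
    then show "Q s'" using J exit[of s'] by simp
  qed
  then show ?thesis by (simp add: For_def)
qed

lemma wp_Search:
  assumes N: "nats s y 0 0 = N" "N \<le> B"
    and names: "x \<notin> nat_names q" "y \<notin> nat_names q" "z \<notin> nat_names q" "x \<noteq> y" "z \<noteq> y" "x \<noteq> z"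
    and test: "\<And>s' j. frame (insert x (insert z (nat_names q))) (real_names q) s s' \<Longrightarrow>
        nats s' z 0 0 = j \<Longrightarrow> j < N \<Longrightarrow> wp q (\<lambda>t. bval b t = P j) s'"
    and exit: "\<And>s'. frame (insert x (insert z (nat_names q))) (real_names q) s s' \<Longrightarrow>
        (if \<exists>j<N. P j then nats s' x 0 0 < N \<and> P (nats s' x 0 0) else nats s' x 0 0 = N) \<Longrightarrow> Q s'"
  shows "wp (Search x y z q b) Q s"
proof -
  let ?I = "\<lambda>i s'. if \<exists>j<i. P j then nats s' x 0 0 < N \<and> P (nats s' x 0 0) else nats s' x 0 0 = N"
  show ?thesis unfolding Search_def wp.simps
  proof (rule wp_For[where N = N and I = ?I])
    fix i s' assume i: "i < N" and z: "nats s' z 0 0 = i" and I: "?I i s'"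
      and f: "frame (insert z (nat_names (Seq q (Cond b (SetVar x (NVar z)) Skip))))
         (real_names (Seq q (Cond b (SetVar x (NVar z)) Skip)))
         (s\<lparr>nats := put (nats s) x (nval (NLit 0) s) (nval (NLit 0) s) (nval (NVar y) s)\<rparr>) s'"
    have f': "frame (insert x (insert z (nat_names q))) (real_names q) s s'"
      using f by (auto simp: frame_def put_apply)
    from wp_frame[OF test[OF f' z i]]
    have "wp q (wp (Cond b (SetVar x (NVar z)) Skip)
        (\<lambda>t. ?I (Suc i) (t\<lparr>nats := put (nats t) z 0 0 (Suc i)\<rparr>))) s'"
    proof (rule wp_mono)
      fix t assume t: "bval b t = P i \<and> frame (nat_names q) (real_names q) s' t"
      then have "nats t x = nats s' x" "nats t z 0 0 = i" using names z by (auto simp: frame_def)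
      then show "wp (Cond b (SetVar x (NVar z)) Skip)
        (\<lambda>t. ?I (Suc i) (t\<lparr>nats := put (nats t) z 0 0 (Suc i)\<rparr>)) t"
        using I t i names by (auto simp: put_apply less_Suc_eq split: if_splits)
    qed
    then show "wp (Seq q (Cond b (SetVar x (NVar z)) Skip))
        (\<lambda>t. ?I (Suc i) (t\<lparr>nats := put (nats t) z 0 0 (Suc i)\<rparr>)) s'" by simp
  next
    fix s' assume f: "frame (insert z (nat_names (Seq q (Cond b (SetVar x (NVar z)) Skip))))
         (real_names (Seq q (Cond b (SetVar x (NVar z)) Skip)))
         (s\<lparr>nats := put (nats s) x (nval (NLit 0) s) (nval (NLit 0) s) (nval (NVar y) s)\<rparr>) s'"
      and I: "?I N s'"
    have f': "frame (insert x (insert z (nat_names q))) (real_names q) s s'"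
      using f by (auto simp: frame_def put_apply)
    show "Q s'" by (rule exit[OF f' I])
  qed (use N names in \<open>auto simp: put_apply\<close>)
qed

lemma wp_ArgMin:
  assumes N: "nats s y 0 0 = N" "N \<le> B"
    and names: "x \<noteq> y" "z \<noteq> y" "x \<noteq> z"
    and test: "\<And>s' j. frame {x, z} {} s s' \<Longrightarrow> nats s' z 0 0 = j \<Longrightarrow> j < N \<Longrightarrow> bval b s' = P j"
    and exit: "\<And>s'. frame {x, z} {} s s' \<Longrightarrow>
        (if \<exists>j<N. P j
         then nats s' x 0 0 < N \<and> P (nats s' x 0 0) \<and>
              (\<forall>j<N. P j \<longrightarrow> reals s key (nats s' x 0 0) 0 \<le> reals s key j 0)
         else nats s' x 0 0 = N) \<Longrightarrow> Q s'"
  shows "wp (ArgMin x y z b key) Q s"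
proof -
  let ?I = "\<lambda>i s'. if \<exists>j<i. P j
         then nats s' x 0 0 < N \<and> P (nats s' x 0 0) \<and>
              (\<forall>j<i. P j \<longrightarrow> reals s key (nats s' x 0 0) 0 \<le> reals s key j 0)
         else nats s' x 0 0 = N"
  show ?thesis unfolding ArgMin_def wp.simps
  proof (rule wp_For[where N = N and I = ?I], goal_cases)
    case (7 i s')
    have f': "frame {x, z} {} s s'"
      using 7(3) by (auto simp: frame_def put_apply)
    have [simp]: "nats s' y 0 0 = N" "reals s' key = reals s key"
      using f' names N by (auto simp: frame_def)
    show ?case using 7 names test[OF f' 7(2,1)]
      by (fastforce simp: put_apply less_Suc_eq split: if_splits)
  next
    case (8 s')
    have f': "frame {x, z} {} s s'"
      using 8(1) by (auto simp: frame_def put_apply)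
    show ?case by (rule exit[OF f' 8(2)])
  qed (use N names in \<open>auto simp: put_apply\<close>)
qed

end

section \<open>Partial divisions of a padded multicake\<close>

text \<open>What the division needs to know about queries and islands. The island \<open>j < m\<close> occupies
\<open>L j\<close> to \<open>L j + 1\<close>. The answers are constrained on these islands only; for the dummy islands
\<open>m, \<dots>, M - 1\<close>, plans prescribe the value 0.\<close>

locale padded_cake =
  fixes ev :: "nat \<Rightarrow> nat \<Rightarrow> real \<Rightarrow> real \<Rightarrow> real" and mk :: "nat \<Rightarrow> nat \<Rightarrow> real \<Rightarrow> real"
    and m n k :: nat and L :: "nat \<Rightarrow> real"
  assumes n_pos: "n \<ge> 1" and k_pos: "k \<ge> 1" and few_islands: "m \<le> n * (k - 1) + 1"
    and ev_nonneg: "\<And>i j a b. i < n \<Longrightarrow> j < m \<Longrightarrow> L j \<le> a \<Longrightarrow> a \<le> b \<Longrightarrow> b \<le> L j + 1 \<Longrightarrow> 0 \<le> ev i j a b"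
    and ev_add: "\<And>i j a b c. i < n \<Longrightarrow> j < m \<Longrightarrow> L j \<le> a \<Longrightarrow> a \<le> b \<Longrightarrow> b \<le> c \<Longrightarrow> c \<le> L j + 1 \<Longrightarrow>
      ev i j a c = ev i j a b + ev i j b c"
    and mark: "\<And>i j r. i < n \<Longrightarrow> j < m \<Longrightarrow> 0 \<le> r \<Longrightarrow> r \<le> ev i j (L j) (L j + 1) \<Longrightarrow>
      L j \<le> mk i j r \<and> mk i j r \<le> L j + 1 \<and> ev i j (L j) (mk i j r) = r"
    and apart: "\<And>j j'. j < m \<Longrightarrow> j' < m \<Longrightarrow> j \<noteq> j' \<Longrightarrow> L j + 1 \<le> L j' \<or> L j' + 1 \<le> L j"
begin

definition M :: nat where "M = n * (k - 1) + 1"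

definition share :: "nat \<Rightarrow> real" where
  "share i = (\<Sum>j<m. ev i j (L j) (L j + 1)) / real n"

text \<open>In all that follows \<open>grp j\<close> is the number of the group of island \<open>j\<close>, where the spare island has number \<open>n\<close>,
and \<open>v i j\<close> is the value for agent \<open>i\<close> of what is left of island \<open>j\<close>.\<close>

definition group_value :: "(nat \<Rightarrow> nat) \<Rightarrow> (nat \<Rightarrow> nat \<Rightarrow> real) \<Rightarrow> nat \<Rightarrow> nat \<Rightarrow> real" where
  "group_value grp v i r = (\<Sum>j | j < M \<and> grp j = r. v i j)"

definition rest_value :: "(nat \<Rightarrow> nat) \<Rightarrow> (nat \<Rightarrow> nat \<Rightarrow> real) \<Rightarrow> nat set \<Rightarrow> nat \<Rightarrow> real" where
  "rest_value grp v H i = (\<Sum>j | j < M \<and> grp j \<notin> H. v i j)"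

text \<open>The invariant of the whole division. The agents in \<open>G\<close> have left, agent \<open>i\<close> with the group \<open>mt i\<close> and
the interval from \<open>lo i\<close> to \<open>hi i\<close>, which is empty for those who took whole islands only. Cuts
proceed from left to right: what is left of island \<open>j\<close> begins at \<open>pos j\<close>, and earlier cuts lie
below it. A dummy island has \<open>pos j = L j + 1\<close>, so that its remainder is empty. The decisive clause is the one
with \<open>rest_value\<close>: an agent who has not left values the rest at one share for each remaining agent.\<close>

definition plan ::
    "(nat \<Rightarrow> nat) \<Rightarrow> (nat \<Rightarrow> real) \<Rightarrow> (nat \<Rightarrow> nat \<Rightarrow> real) \<Rightarrow> nat set \<Rightarrow> (nat \<Rightarrow> nat) \<Rightarrow>
     (nat \<Rightarrow> real) \<Rightarrow> (nat \<Rightarrow> real) \<Rightarrow> bool" where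
  "plan grp pos v G mt lo hi \<longleftrightarrow>
     G \<subseteq> {..<n} \<and> inj_on mt G \<and> mt ` G \<subseteq> {..<n} \<and>
     (\<forall>r<n. card {j. j < M \<and> grp j = r} = k - 1) \<and>
     (\<forall>j<m. L j \<le> pos j \<and> pos j \<le> L j + 1) \<and> (\<forall>j<M. m \<le> j \<longrightarrow> pos j = L j + 1) \<and>
     (\<forall>i<n. \<forall>j<M. v i j = (if j < m then ev i j (pos j) (L j + 1) else 0)) \<and>
     (\<forall>i<n. i \<notin> G \<longrightarrow> real (n - card G) * share i \<le> rest_value grp v (mt ` G) i) \<and>
     (\<forall>i<n. i \<notin> G \<longrightarrow> hi i \<le> lo i) \<and>
     (\<forall>i\<in>G. (\<exists>x<m. L x \<le> lo i \<and> lo i \<le> hi i \<and> hi i \<le> pos x \<and>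
                  share i \<le> group_value grp v i (mt i) + ev i x (lo i) (hi i)) \<or>
             hi i \<le> lo i \<and> share i \<le> group_value grp v i (mt i)) \<and>
     (\<forall>i<n. \<forall>i'<n. i \<noteq> i' \<longrightarrow> {lo i<..<hi i} \<inter> {lo i'<..<hi i'} = {})"

lemma m_le_M: "m \<le> M"
  using few_islands by (simp add: M_def)

lemma rest_value_insert:
  assumes "r \<notin> H"
  shows "rest_value grp v (insert r H) i = rest_value grp v H i - group_value grp v i r"
proof -
  have "{j. j < M \<and> grp j \<notin> H} = {j. j < M \<and> grp j \<notin> insert r H} \<union> {j. j < M \<and> grp j = r}"
    using assms by auto
  then have "rest_value grp v H i = rest_value grp v (insert r H) i + group_value grp v i r"
    unfolding rest_value_def group_value_def
    by (simp only:) (rule sum.union_disjoint, auto)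
  then show ?thesis by simp
qed

lemma rest_value_Un:
  assumes "finite R" "R \<inter> H = {}"
  shows "rest_value grp v (H \<union> R) i = rest_value grp v H i - (\<Sum>r\<in>R. group_value grp v i r)"
  using assms
proof (induction R)
  case (insert r R)
  then have "r \<notin> H \<union> R" by auto
  from rest_value_insert[OF this] show ?case using insert by simp
qed simp

text \<open>Every departure removes one group, that is \<open>k - 1\<close> islands.\<close>

lemma card_rest:
  assumes "\<forall>r<n. card {j. j < M \<and> grp j = r} = k - 1" "H \<subseteq> {..<n}"
  shows "card {j. j < M \<and> grp j \<notin> H} = (n - card H) * (k - 1) + 1"
proof -
  have fin: "finite H" using assms(2) finite_subset by blast
  have c: "card H \<le> n" using card_mono[OF _ assms(2)] by simp
  have "card (\<Union>r\<in>H. {j. j < M \<and> grp j = r}) = (\<Sum>r\<in>H. card {j. j < M \<and> grp j = r})"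
    using fin by (intro card_UN_disjoint) auto
  also have "\<dots> = card H * (k - 1)" using assms by (subst sum.cong[OF refl, of H _ "\<lambda>_. k - 1"]) auto
  finally have H: "card (\<Union>r\<in>H. {j. j < M \<and> grp j = r}) = card H * (k - 1)" .
  have "{j. j < M \<and> grp j \<notin> H} = {..<M} - (\<Union>r\<in>H. {j. j < M \<and> grp j = r})" by auto
  then have "card {j. j < M \<and> grp j \<notin> H} = M - card H * (k - 1)"
    by (simp only:) (subst card_Diff_subset, auto simp: H fin)
  also have "\<dots> = (n - card H) * (k - 1) + 1"
    using mult_le_mono1[OF c, of "k - 1"] by (simp add: M_def diff_mult_distrib Suc_diff_le)
  finally show ?thesis .
qed

lemma planD:
  assumes "plan grp pos v G mt lo hi"
  shows "G \<subseteq> {..<n}" "inj_on mt G" "mt ` G \<subseteq> {..<n}"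
    "\<And>r. r < n \<Longrightarrow> card {j. j < M \<and> grp j = r} = k - 1"
    "\<And>j. j < m \<Longrightarrow> L j \<le> pos j" "\<And>j. j < m \<Longrightarrow> pos j \<le> L j + 1"
    "\<And>j. j < M \<Longrightarrow> m \<le> j \<Longrightarrow> pos j = L j + 1"
    "\<And>i j. i < n \<Longrightarrow> j < M \<Longrightarrow> v i j = (if j < m then ev i j (pos j) (L j + 1) else 0)"
    "\<And>i. i < n \<Longrightarrow> i \<notin> G \<Longrightarrow> real (n - card G) * share i \<le> rest_value grp v (mt ` G) i"
    "\<And>i. i < n \<Longrightarrow> i \<notin> G \<Longrightarrow> hi i \<le> lo i"
    "\<And>i. i \<in> G \<Longrightarrow> (\<exists>x<m. L x \<le> lo i \<and> lo i \<le> hi i \<and> hi i \<le> pos x \<and>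
                  share i \<le> group_value grp v i (mt i) + ev i x (lo i) (hi i)) \<or>
             hi i \<le> lo i \<and> share i \<le> group_value grp v i (mt i)"
    "\<And>i i'. i < n \<Longrightarrow> i' < n \<Longrightarrow> i \<noteq> i' \<Longrightarrow> {lo i<..<hi i} \<inter> {lo i'<..<hi i'} = {}"
  using assms[unfolded plan_def] by - (elim conjE, simp)+

lemma plan_mt_cong:
  assumes "plan grp pos v G mt lo hi" "\<And>i. i \<in> G \<Longrightarrow> mt' i = mt i"
  shows "plan grp pos v G mt' lo hi"
proof -
  have "inj_on mt' G = inj_on mt G" "mt' ` G = mt ` G"
    using assms(2) by (simp_all cong: inj_on_cong image_cong)
  then show ?thesis using assms by (simp add: plan_def)
qed

lemma v_nonneg: "plan grp pos v G mt lo hi \<Longrightarrow> i < n \<Longrightarrow> j < M \<Longrightarrow> 0 \<le> v i j"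
  by (auto simp: plan_def intro!: ev_nonneg)

text \<open>Agents may leave with whole groups that nobody else wants: those who stay value each of these groups at no
more than a share, so their rest shrinks by at most one share per departing agent.\<close>

lemma plan_match:
  assumes p: "plan grp pos v G mt lo hi"
    and A: "A \<subseteq> {..<n}" "A \<inter> G = {}" and inj: "inj_on mt (G \<union> A)" and groups: "mt ` A \<subseteq> {..<n}"
    and want: "\<And>i. i \<in> A \<Longrightarrow> share i \<le> group_value grp v i (mt i)"
    and free: "\<And>i a. i < n \<Longrightarrow> i \<notin> G \<union> A \<Longrightarrow> a \<in> A \<Longrightarrow> group_value grp v i (mt a) \<le> share i"
  shows "plan grp pos v (G \<union> A) mt lo hi"
proof -
  have G: "G \<subseteq> {..<n}" and finG: "finite G" using p finite_subset[of G "{..<n}"] by (auto simp: plan_def)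
  have finA: "finite A" using A finite_subset by blast
  have card: "card (G \<union> A) = card G + card A" using finG finA A by (intro card_Un_disjoint) auto
  have le: "card (G \<union> A) \<le> n" using card_mono[of "{..<n}" "G \<union> A"] G A by simp
  have rest: "real (n - card (G \<union> A)) * share i \<le> rest_value grp v (mt ` (G \<union> A)) i"
    if i: "i < n" "i \<notin> G \<union> A" for i
  proof -
    have disj: "mt ` A \<inter> mt ` G = {}" using inj A(2) by (auto simp: inj_on_def)
    have "rest_value grp v (mt ` (G \<union> A)) i = rest_value grp v (mt ` G) i - (\<Sum>r\<in>mt ` A. group_value grp v i r)"
      using rest_value_Un[of "mt ` A" "mt ` G"] finA disj by (simp add: image_Un)
    moreover have "(\<Sum>r\<in>mt ` A. group_value grp v i r) \<le> (\<Sum>r\<in>mt ` A. share i)"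
      using free[OF i] by (intro sum_mono) auto
    moreover have "card (mt ` A) = card A" using inj by (intro card_image) (auto simp: inj_on_def)
    moreover have "real (n - card G) * share i \<le> rest_value grp v (mt ` G) i"
      using p i by (auto simp: plan_def)
    moreover have "real (n - card G) = real (n - card (G \<union> A)) + real (card A)" using card le by simp
    ultimately show ?thesis by (simp add: algebra_simps)
  qed
  have "(\<exists>x<m. L x \<le> lo i \<and> lo i \<le> hi i \<and> hi i \<le> pos x \<and>
                  share i \<le> group_value grp v i (mt i) + ev i x (lo i) (hi i)) \<or>
             hi i \<le> lo i \<and> share i \<le> group_value grp v i (mt i)" if "i \<in> G \<union> A" for i
  proof (cases "i \<in> G")
    case True
    then show ?thesis using p by (simp add: plan_def)
  next
    case False
    then show ?thesis using that p want[of i] A by (auto simp: plan_def)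
  qed
  then show ?thesis using p rest A inj groups unfolding plan_def by (simp add: image_Un)
qed

section \<open>Exchanging islands between groups\<close>

definition exchange :: "(nat \<Rightarrow> nat) \<Rightarrow> nat \<Rightarrow> nat \<Rightarrow> nat \<Rightarrow> nat" where
  "exchange grp y z = grp(y := grp z, z := grp y)"

lemma exchange_transpose: "exchange grp y z j = grp (Transposition.transpose y z j)"
  by (auto simp: exchange_def Transposition.transpose_def)

lemma exchanged_group:
  assumes "y < M" "z < M"
  shows "{j. j < M \<and> exchange grp y z j = r} = Transposition.transpose y z ` {j. j < M \<and> grp j = r}"
proof -
  have "Transposition.transpose y z j < M \<longleftrightarrow> j < M" for j using assms by (auto simp: Transposition.transpose_def)
  then show ?thesis
    by (intro set_eqI) (simp add: in_transpose_image_iff exchange_transpose)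
qed

text \<open>Exchanges among groups that are still there affect neither what remains nor what
the departed agents received.\<close>

lemma plan_exchange:
  assumes p: "plan grp pos v G mt lo hi" and yz: "y < M" "z < M"
    and groups: "grp y \<notin> mt ` G" "grp z \<notin> mt ` G"
  shows "plan (exchange grp y z) pos v G mt lo hi"
proof -
  let ?grp = "exchange grp y z"
  have c: "card {j. j < M \<and> ?grp j = r} = card {j. j < M \<and> grp j = r}" for r
    unfolding exchanged_group[OF yz] by (simp add: card_image)
  have gone: "?grp j \<in> mt ` G \<longleftrightarrow> grp j \<in> mt ` G" for j using groups by (auto simp: exchange_def)
  have "?grp j = mt i \<longleftrightarrow> grp j = mt i" if "i \<in> G" for i j using groups that by (auto simp: exchange_def)
  then have "group_value ?grp v i' (mt i) = group_value grp v i' (mt i)" if "i \<in> G" for i i'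
    using that by (simp add: group_value_def)
  moreover have "rest_value ?grp v (mt ` G) i = rest_value grp v (mt ` G) i" for i
    by (simp add: rest_value_def gone)
  ultimately show ?thesis using p unfolding plan_def by (simp add: c)
qed

lemma group_value_exchange:
  assumes "y < M" "z < M" "grp y = r" "grp z \<noteq> r"
  shows "group_value (exchange grp y z) v i r = group_value grp v i r + v i z - v i y"
proof -
  let ?S = "{j. j < M \<and> grp j = r}"
  have "{j. j < M \<and> exchange grp y z j = r} = insert z (?S - {y})"
    using assms by (auto simp: exchange_def)
  then have "group_value (exchange grp y z) v i r = v i z + sum (v i) (?S - {y})"
    using assms by (simp add: group_value_def)
  also have "sum (v i) (?S - {y}) = group_value grp v i r - v i y"
    using assms by (simp add: group_value_def sum_diff1)
  finally show ?thesis by simp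
qed

text \<open>The inversions of the group \<open>r\<close> with respect to the values \<open>u\<close> are the exchanges that improve it. The groups in
\<open>H\<close> are gone and do not take part.\<close>

definition inversions :: "(nat \<Rightarrow> nat) \<Rightarrow> (nat \<Rightarrow> real) \<Rightarrow> nat set \<Rightarrow> nat \<Rightarrow> (nat \<times> nat) set" where
  "inversions grp u H r = {(y, z). y < M \<and> z < M \<and> grp y = r \<and> grp z \<noteq> r \<and> grp z \<notin> H \<and> u y < u z}"

lemma finite_inversions: "finite (inversions grp u H r)"
  by (rule finite_subset[of _ "{..<M} \<times> {..<M}"]) (auto simp: inversions_def)

lemma card_inversions: "card (inversions grp u H r) \<le> M * M"
proof -
  have "card (inversions grp u H r) \<le> card ({..<M} \<times> {..<M})"
    by (rule card_mono) (auto simp: inversions_def)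
  then show ?thesis by simp
qed

text \<open>The transposition of \<open>y\<close> and \<open>z\<close> maps the inversions after the exchange injectively to inversions before it, and
misses the inversion \<open>(y, z)\<close>.\<close>

lemma exchange_fewer_inversions:
  assumes yz: "(y, z) \<in> inversions grp u H r" and r: "r \<notin> H"
  shows "card (inversions (exchange grp y z) u H r) < card (inversions grp u H r)"
proof -
  let ?f = "map_prod (Transposition.transpose y z) (Transposition.transpose y z)"
  have inj: "inj_on ?f A" for A
    using map_prod_inj_on[OF inj_on_transpose[of y z UNIV] inj_on_transpose[of y z UNIV]]
    by (auto intro: inj_on_subset)
  have "?f ` inversions (exchange grp y z) u H r \<subset> inversions grp u H r"
  proof
    show "?f ` inversions (exchange grp y z) u H r \<subseteq> inversions grp u H r"
      using assms by (auto simp: inversions_def exchange_def Transposition.transpose_def split: if_splits)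
    have "(y, z) \<notin> ?f ` inversions (exchange grp y z) u H r"
      using yz by (auto simp: inversions_def exchange_def Transposition.transpose_def split: if_splits)
    then show "?f ` inversions (exchange grp y z) u H r \<noteq> inversions grp u H r" using yz by blast
  qed
  then have "card (?f ` inversions (exchange grp y z) u H r) < card (inversions grp u H r)"
    by (intro psubset_card_mono finite_inversions)
  then show ?thesis by (simp add: card_image[OF inj])
qed

text \<open>Let \<open>l\<close> agents remain. Outside the group there are \<open>(l - 1) (k - 1) + 1\<close> islands, all worth at most the best
one \<open>z\<close>, while each of the \<open>k - 1\<close> islands of the group is worth at least \<open>z\<close>. So the rest is worth at most
\<open>l\<close> times the group together with \<open>z\<close>, yet it is worth at least \<open>l\<close> shares.\<close>

lemma top_group_extends:
  assumes p: "plan grp pos v G mt lo hi" and a: "a < n" "a \<notin> G" and r: "r < n" "r \<notin> mt ` G"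
    and top: "inversions grp (v a) (mt ` G) r = {}"
  shows "\<exists>z<M. grp z \<noteq> r \<and> grp z \<notin> mt ` G \<and> share a \<le> group_value grp v a r + v a z"
proof (rule ccontr)
  assume neg: "\<not> ?thesis"
  have groups: "\<forall>r<n. card {j. j < M \<and> grp j = r} = k - 1" and H: "mt ` G \<subseteq> {..<n}"
    and G: "G \<subseteq> {..<n}" and inj: "inj_on mt G"
    and rest: "real (n - card G) * share a \<le> rest_value grp v (mt ` G) a"
    using p a by (auto simp: plan_def)
  let ?O = "{j. j < M \<and> grp j \<notin> insert r (mt ` G)}" and ?S = "{j. j < M \<and> grp j = r}"
  have finG: "finite G" using G finite_subset by blast
  have "G \<subseteq> {..<n} - {a}" using G a by auto
  then have lt: "card G < n" using card_mono[of "{..<n} - {a}" G] a by simp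
  define q where "q = n - card G - 1"
  have q: "n - card G = Suc q" using lt by (simp add: q_def)
  have "card (insert r (mt ` G)) = Suc (card G)" using r(2) finG inj by (simp add: card_image)
  then have cO: "card ?O = q * (k - 1) + 1"
    using card_rest[OF groups, of "insert r (mt ` G)"] H r(1) by (simp add: q_def)
  have cS: "card ?S = k - 1" using groups r by simp
  \<comment> \<open>the islands outside the group are never exhausted, because of the spare one\<close>
  have "0 < card ?O" unfolding cO by simp
  then have finO: "finite ?O" and neO: "?O \<noteq> {}" unfolding card_gt_0_iff by blast+
  define \<mu> where "\<mu> = Max (v a ` ?O)"
  have "\<mu> \<in> v a ` ?O" unfolding \<mu>_def using finO neO by (intro Max_in) auto
  then obtain z where z: "z \<in> ?O" "v a z = \<mu>" by auto
  have O: "v a j \<le> \<mu>" if "j \<in> ?O" for j unfolding \<mu>_def using that finO by (intro Max_ge) auto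
  have S: "\<mu> \<le> v a j" if "j \<in> ?S" for j using top that z by (force simp: inversions_def)
  have \<mu>0: "0 \<le> \<mu>" using v_nonneg[OF p a(1)] z by auto
  let ?s = "group_value grp v a r"
  have hit: "?s + \<mu> < share a" using neg z by auto
  define K where "K = real (k - 1)"
  have cO': "real (card ?O) = real q * K + 1" unfolding cO K_def by simp
  have "K * \<mu> \<le> ?s"
    using sum_bounded_below[of ?S \<mu> "v a"] S cS by (simp add: group_value_def K_def)
  then have "real q * (K * \<mu>) \<le> real q * ?s" by (intro mult_left_mono) auto
  moreover have "rest_value grp v (insert r (mt ` G)) a \<le> real (card ?O) * \<mu>"
    unfolding rest_value_def using O by (intro sum_bounded_above) auto
  moreover have "rest_value grp v (insert r (mt ` G)) a = rest_value grp v (mt ` G) a - ?s"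
    using r by (intro rest_value_insert) auto
  ultimately have "rest_value grp v (mt ` G) a \<le> real (Suc q) * ?s + \<mu>"
    unfolding cO' by (simp add: algebra_simps)
  also have "\<dots> \<le> real (Suc q) * (?s + \<mu>)" using \<mu>0 by (simp add: algebra_simps)
  also have "\<dots> < real (Suc q) * share a" using hit by (intro mult_strict_left_mono) auto
  finally show False using rest q by simp
qed

text \<open>The agent \<open>w\<close> whose mark comes first leaves with the group \<open>r\<close> and the part of \<open>x\<close> before the mark, which
together are worth exactly a share to \<open>w\<close>. To another agent they are worth at most a share: either that agent's
mark comes later, or even the whole of \<open>x\<close> would not have been enough.\<close>

lemma plan_cut:
  assumes p: "plan grp pos v G mt lo hi"
    and w: "w < n" "w \<notin> G" and r: "r < n" "r \<notin> mt ` G"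
    and x: "x < M" "grp x \<noteq> r" "grp x \<notin> mt ` G"
    and poor: "\<And>i. i < n \<Longrightarrow> i \<notin> G \<Longrightarrow> group_value grp v i r < share i"
    and hit: "share w \<le> group_value grp v w r + v w x"
    and key: "\<And>i. i < n \<Longrightarrow> key i = mk i x (ev i x (L x) (pos x) + (share i - group_value grp v i r))"
    and first: "\<And>i. i < n \<Longrightarrow> i \<notin> G \<Longrightarrow> share i \<le> group_value grp v i r + v i x \<Longrightarrow> key w \<le> key i"
    and v': "\<And>i j. i < n \<Longrightarrow> j < M \<Longrightarrow> v' i j = (if j = x then ev i x (key w) (L x + 1) else v i j)"
  shows "plan grp (pos(x := key w)) v' (insert w G) (mt(w := r)) (lo(w := pos x)) (hi(w := key w))"
proof -
  note P = planD[OF p]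
  have xm: "x < m" using P(8)[OF w(1) x(1)] hit poor[OF w] by (cases "x < m") auto
  note pos = P(5,6)[OF xm]
  have finG: "finite G" using P(1) finite_subset by blast
  have mark_key: "pos x \<le> key i" "key i \<le> L x + 1" "ev i x (pos x) (key i) = share i - group_value grp v i r"
    if i: "i < n" "i \<notin> G" and h: "share i \<le> group_value grp v i r + v i x" for i
  proof -
    \<comment> \<open>marks are counted from the left end of the island, so the part cut off earlier is added\<close>
    let ?t = "ev i x (L x) (pos x) + (share i - group_value grp v i r)"
    have "0 \<le> ev i x (L x) (pos x)" using i xm pos by (intro ev_nonneg) auto
    moreover have "ev i x (L x) (L x + 1) = ev i x (L x) (pos x) + v i x"
      using i xm pos P(8)[OF i(1) x(1)] ev_add[of i x "L x" "pos x" "L x + 1"] by auto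
    ultimately have "0 \<le> ?t" "?t \<le> ev i x (L x) (L x + 1)" using poor[OF i] h by auto
    from mark[OF i(1) xm this] have k: "L x \<le> key i" "key i \<le> L x + 1" "ev i x (L x) (key i) = ?t"
      using key[OF i(1)] by auto
    show 1: "pos x \<le> key i"
    proof (rule ccontr)
      assume "\<not> ?thesis"
      then have le: "key i \<le> pos x" by simp
      have "ev i x (L x) (pos x) = ev i x (L x) (key i) + ev i x (key i) (pos x)"
        by (rule ev_add) (use i xm pos k le in auto)
      moreover have "0 \<le> ev i x (key i) (pos x)" by (rule ev_nonneg) (use i xm pos k le in auto)
      ultimately show False using k(3) poor[OF i] by simp
    qed
    show "key i \<le> L x + 1" by (rule k)
    have "ev i x (L x) (key i) = ev i x (L x) (pos x) + ev i x (pos x) (key i)"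
      using i xm pos k 1 by (intro ev_add) auto
    then show "ev i x (pos x) (key i) = share i - group_value grp v i r" using k(3) by simp
  qed
  note kw = mark_key[OF w hit]
  have split_x: "v i x = ev i x (pos x) (key w) + ev i x (key w) (L x + 1)" if i: "i < n" for i
  proof -
    have "ev i x (pos x) (L x + 1) = ev i x (pos x) (key w) + ev i x (key w) (L x + 1)"
      by (rule ev_add) (use i xm pos kw(1,2) in auto)
    then show ?thesis using P(8)[OF i x(1)] xm by simp
  qed
  have loss: "group_value grp v i r + ev i x (pos x) (key w) \<le> share i" if i: "i < n" "i \<notin> G" for i
  proof (cases "share i \<le> group_value grp v i r + v i x")
    case True
    note le = first[OF i True] and ki = mark_key[OF i True]
    have "ev i x (pos x) (key i) = ev i x (pos x) (key w) + ev i x (key w) (key i)"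
      by (rule ev_add) (use i xm pos kw(1,2) ki(1,2) le in auto)
    moreover have "0 \<le> ev i x (key w) (key i)"
      by (rule ev_nonneg) (use i xm pos kw(1,2) ki(1,2) le in auto)
    ultimately show ?thesis using ki(3) by simp
  next
    case False
    have "0 \<le> ev i x (key w) (L x + 1)" by (rule ev_nonneg) (use i xm pos kw(1,2) in auto)
    then show ?thesis using False split_x[OF i(1)] by simp
  qed
  have row_v': "group_value grp v' i q = group_value grp v i q" if "i < n" "grp x \<noteq> q" for i q
    using that v' unfolding group_value_def by (intro sum.cong) auto
  let ?mt = "mt(w := r)" and ?G = "insert w G" and ?lo = "lo(w := pos x)" and ?hi = "hi(w := key w)"
  let ?pos = "pos(x := key w)"
  have im: "?mt ` ?G = insert r (mt ` G)" using w by auto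
  have inj: "inj_on ?mt ?G" using P(2) r(2) w by (auto simp: inj_on_def)
  have rest: "real (n - card ?G) * share i \<le> rest_value grp v' (?mt ` ?G) i" if i: "i < n" "i \<notin> ?G" for i
  proof -
    let ?R = "{j. j < M \<and> grp j \<notin> insert r (mt ` G)}"
    have R: "finite ?R" "x \<in> ?R" using x by auto
    have "sum (v' i) (?R - {x}) = sum (v i) (?R - {x})" using v'[OF i(1)] by (intro sum.cong) auto
    then have "rest_value grp v' (insert r (mt ` G)) i =
        rest_value grp v (insert r (mt ` G)) i - ev i x (pos x) (key w)"
      unfolding rest_value_def sum.remove[OF R] using v'[OF i(1) x(1)] split_x[OF i(1)] by simp
    moreover have "rest_value grp v (insert r (mt ` G)) i = rest_value grp v (mt ` G) i - group_value grp v i r"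
      using r by (intro rest_value_insert) auto
    moreover have "G \<subseteq> {..<n} - {i}" using P(1) i by auto
    then have "card G < n" using card_mono[of "{..<n} - {i}" G] i by simp
    then have "real (n - card G) = real (n - card ?G) + 1" using w finG by simp
    ultimately show ?thesis using P(9)[of i] loss[of i] i im by (simp add: algebra_simps)
  qed
  have gone: "(\<exists>x'<m. L x' \<le> ?lo i \<and> ?lo i \<le> ?hi i \<and> ?hi i \<le> ?pos x' \<and>
                  share i \<le> group_value grp v' i (?mt i) + ev i x' (?lo i) (?hi i)) \<or>
             ?hi i \<le> ?lo i \<and> share i \<le> group_value grp v' i (?mt i)" if i: "i \<in> ?G" for i
  proof (cases "i = w")
    case True
    then show ?thesis using xm pos kw row_v'[of w r] w x by (auto intro!: exI[of _ x])
  next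
    case False
    then have iG: "i \<in> G" "i < n" using i P(1) by auto
    then have "grp x \<noteq> mt i" using x by auto
    then have rv: "group_value grp v' i (mt i) = group_value grp v i (mt i)" using iG row_v' by simp
    from P(11)[OF iG(1)] show ?thesis
    proof (elim disjE exE conjE, goal_cases)
      case (1 x')
      then have "hi i \<le> ?pos x'" using kw(1) by auto
      then show ?thesis using 1 False rv by auto
    qed (use False rv in auto)
  qed
  have old: "{lo i<..<hi i} \<inter> {pos x<..<key w} = {}" if i: "i < n" for i
  proof (cases "i \<in> G")
    case True
    from P(11)[OF True] show ?thesis
    proof (elim disjE exE conjE, goal_cases)
      case (1 x')
      show ?thesis
      proof (cases "x' = x")
        case False
        then show ?thesis using apart[OF \<open>x' < m\<close> xm] 1 P(5,6)[OF \<open>x' < m\<close>] pos kw by auto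
      qed (use 1 in auto)
    qed auto
  qed (use P(10)[OF i] in auto)
  have "{?lo i<..<?hi i} \<inter> {?lo i'<..<?hi i'} = {}" if "i < n" "i' < n" "i \<noteq> i'" for i i'
    using that old[of i] old[of i'] P(12)[of i i'] by (auto simp: Int_commute)
  then show ?thesis unfolding plan_def
    using P(1,3,4,5,6,7,8,10) w r im inj rest gone xm order_trans[OF pos(1) kw(1)] kw(2) m_le_M
    by (auto simp: v')
qed

lemma plan_initial:
  assumes groups: "\<And>r. r < n \<Longrightarrow> card {j. j < M \<and> grp j = r} = k - 1"
    and pos: "\<And>j. j < M \<Longrightarrow> pos j = (if j < m then L j else L j + 1)"
    and v: "\<And>i j. i < n \<Longrightarrow> j < M \<Longrightarrow> v i j = (if j < m then ev i j (L j) (L j + 1) else 0)"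
    and lohi: "\<And>i. hi i = lo i"
  shows "plan grp pos v {} mt lo hi"
proof -
  have "real n * share i \<le> rest_value grp v {} i" if i: "i < n" for i
  proof -
    have "rest_value grp v {} i = (\<Sum>j<M. if j < m then ev i j (L j) (L j + 1) else 0)"
      unfolding rest_value_def using v[OF i] by (intro sum.cong) auto
    also have "\<dots> = (\<Sum>j<m. ev i j (L j) (L j + 1))"
      using m_le_M by (intro sum.mono_neutral_cong_right) auto
    finally show ?thesis using n_pos by (simp add: share_def)
  qed
  then show ?thesis using assms m_le_M by (auto simp: plan_def)
qed

section \<open>Matching groups to agents by ascending labels\<close>

text \<open>An agent holds the group \<open>mt i\<close> once its label \<open>d i\<close> is positive; agents in \<open>G\<close> have left and keep
their groups. The labels of the others use all values from 0 up to the largest one. The inequality between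
labels makes a gap in the labels a gap in the wants: who wants the group of an agent with label \<open>d i\<close>
has at least the label \<open>d i - 1\<close>.\<close>

definition auction ::
    "(nat \<Rightarrow> nat) \<Rightarrow> (nat \<Rightarrow> nat \<Rightarrow> real) \<Rightarrow> nat set \<Rightarrow> (nat \<Rightarrow> nat) \<Rightarrow> (nat \<Rightarrow> nat) \<Rightarrow> bool" where
  "auction grp v G mt d \<longleftrightarrow>
     inj_on mt {i. i < n \<and> 0 < d i} \<and> (\<forall>i<n. 0 < d i \<longrightarrow> mt i < n) \<and> (\<forall>i\<in>G. i < n \<and> 0 < d i) \<and>
     (\<forall>i<n. i \<notin> G \<longrightarrow> 0 < d i \<longrightarrow> share i \<le> group_value grp v i (mt i) \<and>
        (\<forall>i'<n. i' \<notin> G \<longrightarrow> share i' \<le> group_value grp v i' (mt i) \<longrightarrow> d i \<le> Suc (d i'))) \<and>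
     (\<forall>i<n. i \<notin> G \<longrightarrow> (\<forall>l<d i. \<exists>i'<n. i' \<notin> G \<and> d i' = l))"

lemma auctionD:
  assumes "auction grp v G mt d"
  shows "\<And>i. i < n \<Longrightarrow> 0 < d i \<Longrightarrow> mt i < n" "\<And>i. i \<in> G \<Longrightarrow> i < n \<and> 0 < d i"
    "\<And>i. i < n \<Longrightarrow> i \<notin> G \<Longrightarrow> 0 < d i \<Longrightarrow> share i \<le> group_value grp v i (mt i)"
    "\<And>i i'. i < n \<Longrightarrow> i \<notin> G \<Longrightarrow> 0 < d i \<Longrightarrow> i' < n \<Longrightarrow> i' \<notin> G \<Longrightarrow>
       share i' \<le> group_value grp v i' (mt i) \<Longrightarrow> d i \<le> Suc (d i')"
    "\<And>i l. i < n \<Longrightarrow> i \<notin> G \<Longrightarrow> l < d i \<Longrightarrow> \<exists>i'<n. i' \<notin> G \<and> d i' = l"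
  using assms unfolding auction_def by simp_all

lemma auction_bound:
  assumes "auction grp v G mt d" "i < n" "i \<notin> G"
  shows "d i < n"
proof -
  have "{..d i} \<subseteq> d ` {..<n}"
  proof
    fix l assume "l \<in> {..d i}"
    then consider "l = d i" | "l < d i" by fastforce
    then show "l \<in> d ` {..<n}" using assms(2) auctionD(5)[OF assms] by cases fastforce+
  qed
  then have "card {..d i} \<le> card {..<n}"
    by (metis card_image_le card_mono finite_imageI finite_lessThan le_trans)
  then show ?thesis by simp
qed

text \<open>Somebody has label 0 and holds nothing, so \<open>n\<close> groups have fewer than \<open>n\<close> holders.\<close>

lemma free_group:
  assumes a: "auction grp v G mt d" and i: "i < n" "i \<notin> G"
  shows "\<exists>r<n. \<forall>i<n. \<not> (0 < d i \<and> mt i = r)"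
proof -
  obtain z where z: "z < n" "d z = 0"
    using auctionD(5)[OF a i, of 0] i by (cases "d i") auto
  let ?D = "{i. i < n \<and> 0 < d i}"
  have "?D \<subseteq> {..<n} - {z}" using z by auto
  then have "card ?D < n" using card_mono[of "{..<n} - {z}" ?D] z by simp
  then have "card (mt ` ?D) < card {..<n}" using card_image_le[of ?D mt] by simp
  then have "\<not> {..<n} \<subseteq> mt ` ?D" using card_mono[of "mt ` ?D" "{..<n}"] by fastforce
  then show ?thesis by auto
qed

lemma auction_reset:
  assumes p: "plan grp pos v G mt lo hi"
    and gone: "\<And>i. i \<in> G \<Longrightarrow> 0 < d i" and left: "\<And>i. i < n \<Longrightarrow> i \<notin> G \<Longrightarrow> d i = 0"
  shows "auction grp v G mt d"
proof -
  have eq: "i \<in> G" if "i < n" "0 < d i" for i using left that by fastforce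
  have "{i. i < n \<and> 0 < d i} = G" using planD(1)[OF p] gone eq by auto
  then have "inj_on mt {i. i < n \<and> 0 < d i}" using planD(2)[OF p] by simp
  moreover have "\<forall>i<n. 0 < d i \<longrightarrow> mt i < n"
  proof (intro allI impI)
    fix i assume "i < n" "0 < d i"
    then have "mt i \<in> mt ` G" by (intro imageI eq)
    then show "mt i < n" using planD(3)[OF p] by blast
  qed
  moreover have "\<forall>i\<in>G. i < n \<and> 0 < d i" using planD(1)[OF p] gone by auto
  ultimately show ?thesis unfolding auction_def by (simp add: left)
qed

text \<open>Giving a free group to a wanting agent of least label preserves the stability of the labels. Only the
absence of gaps may fail.\<close>

lemma auction_raise:
  assumes a: "auction grp v G mt d" and r: "r < n" "\<And>i. i < n \<Longrightarrow> \<not> (0 < d i \<and> mt i = r)"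
    and w: "w < n" "w \<notin> G" "share w \<le> group_value grp v w r"
    and least: "\<And>i. i < n \<Longrightarrow> i \<notin> G \<Longrightarrow> share i \<le> group_value grp v i r \<Longrightarrow> d w \<le> d i"
    and d': "d' = d(w := Suc (d w))" and mt': "mt' = mt(w := r)"
  shows "inj_on mt' {i. i < n \<and> 0 < d' i}" "\<And>i. i < n \<Longrightarrow> 0 < d' i \<Longrightarrow> mt' i < n"
    "\<And>i. i < n \<Longrightarrow> i \<notin> G \<Longrightarrow> 0 < d' i \<Longrightarrow> share i \<le> group_value grp v i (mt' i)"
    "\<And>i i'. i < n \<Longrightarrow> i \<notin> G \<Longrightarrow> 0 < d' i \<Longrightarrow> i' < n \<Longrightarrow> i' \<notin> G \<Longrightarrow>
       share i' \<le> group_value grp v i' (mt' i) \<Longrightarrow> d' i \<le> Suc (d' i')"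
proof -
  note A = auctionD[OF a]
  have "inj_on mt {i. i < n \<and> 0 < d i}" using a by (simp add: auction_def)
  then have "mt i = mt j \<Longrightarrow> i = j" if "i < n" "0 < d i" "j < n" "0 < d j" for i j
    using that by (auto simp: inj_on_def)
  moreover have "mt i \<noteq> r" if "i < n" "0 < d i" for i using r(2) that by blast
  ultimately show "inj_on mt' {i. i < n \<and> 0 < d' i}"
    unfolding inj_on_def d' mt' by (auto split: if_splits)
  show "mt' i < n" if "i < n" "0 < d' i" for i
    using that A(1)[of i] r(1) by (auto simp: d' mt' split: if_splits)
  show "share i \<le> group_value grp v i (mt' i)" if "i < n" "i \<notin> G" "0 < d' i" for i
    using that A(3)[of i] w by (cases "i = w") (auto simp: d' mt')
  show "d' i \<le> Suc (d' i')"
    if i: "i < n" "i \<notin> G" "0 < d' i" "i' < n" "i' \<notin> G" "share i' \<le> group_value grp v i' (mt' i)" for i i'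
  proof (cases "i = w")
    case True
    then have "d w \<le> d i'" using i least by (auto simp: mt')
    then show ?thesis using True by (auto simp: d')
  next
    case False
    then have "d i \<le> Suc (d i')" using i A(4)[of i i'] by (auto simp: d' mt')
    then show ?thesis using False by (auto simp: d')
  qed
qed

lemma auction_bump:
  assumes a: "auction grp v G mt d" and r: "r < n" "\<And>i. i < n \<Longrightarrow> \<not> (0 < d i \<and> mt i = r)"
    and w: "w < n" "w \<notin> G" "share w \<le> group_value grp v w r"
    and least: "\<And>i. i < n \<Longrightarrow> i \<notin> G \<Longrightarrow> share i \<le> group_value grp v i r \<Longrightarrow> d w \<le> d i"
    and d': "d' = d(w := Suc (d w))" and mt': "mt' = mt(w := r)"
    and occupied: "i0 < n" "i0 \<notin> G" "d' i0 = d w"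
  shows "auction grp v G mt' d'"
proof -
  note raise = auction_raise[OF a r w least d' mt']
  have low: "\<exists>i'<n. i' \<notin> G \<and> d' i' = l" if i: "i < n" "i \<notin> G" "l < d' i" for i l
  proof (cases "l = d w")
    case False
    then have "l < d i" using i by (auto simp: d' split: if_splits)
    then obtain i' where "i' < n" "i' \<notin> G" "d i' = l" using auctionD(5)[OF a] i by blast
    then show ?thesis using False by (auto simp: d' intro!: exI[of _ i'])
  qed (use occupied in blast)
  have "\<forall>i\<in>G. i < n \<and> 0 < d' i" using auctionD(2)[OF a] by (auto simp: d')
  then show ?thesis unfolding auction_def using raise low by simp
qed

text \<open>If nobody keeps the old label of \<open>w\<close>, then the agents with larger labels hold groups that no agent with a
smaller label wants, since the labels would have to differ by at most one. They leave, and the labels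
of the others have no gap again.\<close>

lemma auction_gap:
  assumes p: "plan grp pos v G mt lo hi"
    and a: "auction grp v G mt d" and r: "r < n" "\<And>i. i < n \<Longrightarrow> \<not> (0 < d i \<and> mt i = r)"
    and w: "w < n" "w \<notin> G" "share w \<le> group_value grp v w r"
    and least: "\<And>i. i < n \<Longrightarrow> i \<notin> G \<Longrightarrow> share i \<le> group_value grp v i r \<Longrightarrow> d w \<le> d i"
    and d': "d' = d(w := Suc (d w))" and mt': "mt' = mt(w := r)"
    and gap: "\<And>i. i < n \<Longrightarrow> i \<notin> G \<Longrightarrow> d' i \<noteq> d w"
    and G': "G' = G \<union> {i. i < n \<and> i \<notin> G \<and> d w < d' i}"
  shows "auction grp v G' mt' d'" "plan grp pos v G' mt' lo hi"
proof -
  let ?A = "{i. i < n \<and> i \<notin> G \<and> d w < d' i}"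
  note raise = auction_raise[OF a r w least d' mt']
  have wA: "w \<in> ?A" using w by (simp add: d')
  have left: "d i < d w" "d' i = d i" "i \<notin> G" if "i < n" "i \<notin> G'" for i
    using that gap[of i] wA by (auto simp: G' d' split: if_splits)
  have low: "\<exists>i'<n. i' \<notin> G' \<and> d' i' = l" if i: "i < n" "i \<notin> G'" "l < d' i" for i l
  proof -
    have l: "i \<notin> G" "l < d i" "d i < d w" using i left[of i] by auto
    then obtain i' where i': "i' < n" "i' \<notin> G" "d i' = l" using auctionD(5)[OF a] i by blast
    moreover from this have "d' i' = l" using l by (auto simp: d')
    ultimately show ?thesis using l by (auto simp: G' intro!: exI[of _ i'])
  qed
  have pos': "\<forall>i\<in>G'. i < n \<and> 0 < d' i" using auctionD(2)[OF a] by (auto simp: d' G')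
  have "i \<notin> G" if "i \<notin> G'" for i using that by (simp add: G')
  then show "auction grp v G' mt' d'" unfolding auction_def using raise low pos' by simp
  have "plan grp pos v (G \<union> ?A) mt' lo hi"
  proof (rule plan_match)
    show "plan grp pos v G mt' lo hi"
      by (rule plan_mt_cong[OF p]) (use w in \<open>auto simp: mt'\<close>)
    have "G \<union> ?A \<subseteq> {i. i < n \<and> 0 < d' i}"
    proof
      fix i assume "i \<in> G \<union> ?A"
      then have "i \<in> G'" unfolding G' .
      then show "i \<in> {i. i < n \<and> 0 < d' i}" using pos' by simp
    qed
    from inj_on_subset[OF raise(1) this] show "inj_on mt' (G \<union> ?A)" .
  next
    fix i b assume i: "i < n" "i \<notin> G \<union> ?A" and b: "b \<in> ?A"
    have "i \<notin> G'" unfolding G' by (rule i(2))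
    note left = left[OF i(1) this]
    have "\<not> d' b \<le> Suc (d' i)" using left b by simp
    then have "\<not> share i \<le> group_value grp v i (mt' b)"
      using raise(4)[of b i] b i(1) left(3) by auto
    then show "group_value grp v i (mt' b) \<le> share i" by simp
  next
    show "?A \<subseteq> {..<n}" "?A \<inter> G = {}" by auto
    show "mt' ` ?A \<subseteq> {..<n}" using raise(2) by auto
    show "share i \<le> group_value grp v i (mt' i)" if "i \<in> ?A" for i using raise(3)[of i] that by auto
  qed
  then show "plan grp pos v G' mt' lo hi" by (simp add: G')
qed

text \<open>Labels of remaining agents are below \<open>n\<close>. The summand \<open>n\<^sup>2 + 1\<close> makes a departure outweigh even
a reset of all labels to 0.\<close>

definition potential :: "nat set \<Rightarrow> (nat \<Rightarrow> nat) \<Rightarrow> nat" where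
  "potential G d = (\<Sum>i | i < n \<and> i \<notin> G. n * n + 1 - d i)"

lemma potential_bound: "potential G d \<le> n * (n * n + 1)"
proof -
  have "potential G d \<le> (\<Sum>i | i < n \<and> i \<notin> G. n * n + 1)"
    unfolding potential_def by (intro sum_mono) auto
  also have "\<dots> \<le> (\<Sum>i<n. n * n + 1)" by (intro sum_mono2) auto
  finally show ?thesis by simp
qed

lemma n_square: "d < n \<Longrightarrow> d < n * n + 1"
  using n_pos by (cases n) auto

lemma potential_bump:
  assumes "auction grp v G mt d" "w < n" "w \<notin> G" "G \<subseteq> G'" "d' = d(w := Suc (d w))"
  shows "potential G' d' < potential G d"
proof -
  have "potential G' d' \<le> potential G d'"
    unfolding potential_def using assms by (intro sum_mono2) auto
  also have "\<dots> < potential G d"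
    unfolding potential_def using assms n_square[OF auction_bound[OF assms(1-3)]]
    by (intro sum_strict_mono_ex1) (auto intro!: bexI[of _ w])
  finally show ?thesis .
qed

text \<open>The labels \<open>d'\<close> afterwards are arbitrary: the others gain at most \<open>(n - 1)\<^sup>2\<close> in total, and the term of
the departing agent was larger.\<close>

lemma potential_cut:
  assumes a: "auction grp v G mt d" and w: "w < n" "w \<notin> G"
  shows "potential (insert w G) d' < potential G d"
proof -
  let ?A = "{i. i < n \<and> i \<notin> insert w G}"
  let ?b = "n * n + 1"
  have "card ?A \<le> card ({..<n} - {w})" by (rule card_mono) auto
  then have cA: "card ?A \<le> n - 1" using w by simp
  have 1: "potential (insert w G) d' \<le> (\<Sum>i\<in>?A. ?b)"
    unfolding potential_def by (rule sum_mono) simp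
  have "(\<Sum>i\<in>?A. ?b) \<le> (\<Sum>i\<in>?A. (?b - d i) + (n - 1))"
    using auction_bound[OF a] by (intro sum_mono) fastforce
  also have "\<dots> = (\<Sum>i\<in>?A. ?b - d i) + card ?A * (n - 1)"
    by (simp only: sum.distrib sum_constant) simp
  also have "\<dots> \<le> (\<Sum>i\<in>?A. ?b - d i) + (n - 1) * (n - 1)" using cA by simp
  also have "(n - 1) * (n - 1) < ?b - d w"
  proof -
    obtain q where q: "n = Suc q" using n_pos by (cases n) auto
    then show ?thesis using auction_bound[OF a w] by simp
  qed
  also have "(\<Sum>i\<in>?A. ?b - d i) + (?b - d w) = potential G d"
  proof -
    have "{i. i < n \<and> i \<notin> G} = insert w ?A" using w by auto
    then show ?thesis unfolding potential_def by simp
  qed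
  finally show ?thesis using 1 by simp
qed

end

section \<open>The program\<close>

text \<open>The arrays of the program are named as in the preceding sections. In addition \<open>gone\<close> and \<open>rg\<close> flag the
agents and the groups that have left, \<open>s\<close> holds the values of the group \<open>r\<close> under consideration, and \<open>W\<close> the
shares.\<close>

abbreviation alive :: "nexp \<Rightarrow> bexp" where "alive i \<equiv> BNot (NLess (NLit 0) (NArr ''gone'' i))"

definition find_alive :: com where
  "find_alive = Search ''a'' ''n'' ''i'' Skip (alive (NVar ''i''))"

definition find_group :: com where
  "find_group = Search ''r'' ''n'' ''g''
     (Search ''u'' ''n'' ''i'' Skip
        (BAnd (NLess (NLit 0) (NArr ''d'' (NVar ''i''))) (NEq (NArr ''mt'' (NVar ''i'')) (NVar ''g''))))
     (BNot (NLess (NVar ''u'') (NVar ''n'')))"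

definition sum_group :: com where
  "sum_group = For ''i'' ''n''
     (Seq (RAssign ''s'' (NVar ''i'') (NLit 0) (ROf (NLit 0)))
          (For ''j'' ''M''
             (Cond (NEq (NArr ''grp'' (NVar ''j'')) (NVar ''r''))
                (RAssign ''s'' (NVar ''i'') (NLit 0)
                   (RAdd (RArr ''s'' (NVar ''i'')) (RCell ''v'' (NVar ''i'') (NVar ''j''))))
                Skip)))"

text \<open>The labels are copied to real cells because the minimum is taken over a real array.\<close>

definition choose_buyer :: com where
  "choose_buyer = Seq
     (For ''i'' ''n'' (RAssign ''key'' (NVar ''i'') (NLit 0) (ROf (NArr ''d'' (NVar ''i'')))))
     (ArgMin ''w'' ''n'' ''i''
        (BAnd (alive (NVar ''i'')) (BNot (RLess (RArr ''s'' (NVar ''i'')) (RArr ''W'' (NVar ''i'')))))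
        ''key'')"

definition bump :: com where
  "bump =
     Seq (SetArr ''mt'' (NVar ''w'') (NVar ''r''))
    (Seq (SetVar ''l'' (NArr ''d'' (NVar ''w'')))
    (Seq (SetArr ''d'' (NVar ''w'') (NAdd (NVar ''l'') (NLit 1)))
    (Seq (Search ''u'' ''n'' ''i'' Skip
            (BAnd (alive (NVar ''i'')) (NEq (NArr ''d'' (NVar ''i'')) (NVar ''l''))))
         (Cond (NLess (NVar ''u'') (NVar ''n'')) Skip
            (For ''i'' ''n''
               (Cond (BAnd (alive (NVar ''i'')) (NLess (NVar ''l'') (NArr ''d'' (NVar ''i''))))
                  (Seq (SetArr ''gone'' (NVar ''i'') (NLit 1))
                       (SetArr ''rg'' (NArr ''mt'' (NVar ''i'')) (NLit 1)))
                  Skip))))))"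

definition reset_labels :: com where
  "reset_labels = For ''i'' ''n'' (Cond (alive (NVar ''i'')) (SetArr ''d'' (NVar ''i'') (NLit 0)) Skip)"

abbreviation outside :: "nexp \<Rightarrow> bexp" where
  "outside z \<equiv> BAnd (BNot (NEq (NArr ''grp'' z) (NVar ''r''))) (BNot (NLess (NLit 0) (NArr ''rg'' (NArr ''grp'' z))))"

abbreviation satisfied_with :: "nexp \<Rightarrow> nexp \<Rightarrow> bexp" where
  "satisfied_with i z \<equiv> BAnd (alive i) (BNot (RLess (RAdd (RArr ''s'' i) (RCell ''v'' i z)) (RArr ''W'' i)))"

definition find_extension :: com where
  "find_extension = Search ''x'' ''M'' ''z''
     (Search ''u'' ''n'' ''i'' Skip (satisfied_with (NVar ''i'') (NVar ''z'')))
     (BAnd (outside (NVar ''z'')) (NLess (NVar ''u'') (NVar ''n'')))"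

abbreviation inversion :: "nexp \<Rightarrow> nexp \<Rightarrow> bexp" where
  "inversion y z \<equiv> BAnd (NEq (NArr ''grp'' y) (NVar ''r''))
     (BAnd (outside z) (RLess (RCell ''v'' (NVar ''a'') y) (RCell ''v'' (NVar ''a'') z)))"

definition improve_group :: com where
  "improve_group =
     Seq (Search ''y'' ''M'' ''j'' (Search ''z'' ''M'' ''t'' Skip (inversion (NVar ''j'') (NVar ''t'')))
            (NLess (NVar ''z'') (NVar ''M'')))
    (Seq (Search ''z'' ''M'' ''t'' Skip (inversion (NVar ''y'') (NVar ''t'')))
    (Seq (SetArr ''grp'' (NVar ''y'') (NArr ''grp'' (NVar ''z'')))
    (Seq (SetArr ''grp'' (NVar ''z'') (NVar ''r''))
         (For ''i'' ''n'' (RAssign ''s'' (NVar ''i'') (NLit 0)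
            (RSub (RAdd (RArr ''s'' (NVar ''i'')) (RCell ''v'' (NVar ''i'') (NVar ''z'')))
                  (RCell ''v'' (NVar ''i'') (NVar ''y''))))))))"

text \<open>Every agent is asked for a mark, also those for whom the requested value exceeds what the island
contains. Such answers are arbitrary, but only the marks of satisfied agents are compared. The cut piece is
written to the last output slot, \<open>k - 1\<close>, because a group fills the slots before it.\<close>

definition cut_extension :: com where
  "cut_extension =
     Seq (For ''i'' ''n''
           (Seq (EvalQuery ''e'' (NVar ''i'') (NLit 0) (NVar ''i'') (NVar ''x'')
                   (RArr ''left'' (NVar ''x'')) (RArr ''pos'' (NVar ''x'')))
                (MarkQuery ''key'' (NVar ''i'') (NLit 0) (NVar ''i'') (NVar ''x'')
                   (RAdd (RArr ''e'' (NVar ''i'')) (RSub (RArr ''W'' (NVar ''i'')) (RArr ''s'' (NVar ''i'')))))))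
    (Seq (ArgMin ''w'' ''n'' ''i'' (satisfied_with (NVar ''i'') (NVar ''x'')) ''key'')
    (Seq (RAssign ''lo'' (NVar ''w'') (NSub (NVar ''k'') (NLit 1)) (RArr ''pos'' (NVar ''x'')))
    (Seq (RAssign ''hi'' (NVar ''w'') (NSub (NVar ''k'') (NLit 1)) (RArr ''key'' (NVar ''w'')))
    (Seq (RAssign ''pos'' (NVar ''x'') (NLit 0) (RArr ''key'' (NVar ''w'')))
    (Seq (For ''i'' ''n''
           (EvalQuery ''v'' (NVar ''i'') (NVar ''x'') (NVar ''i'') (NVar ''x'')
              (RArr ''pos'' (NVar ''x'')) (RAdd (RArr ''left'' (NVar ''x'')) (ROf (NLit 1)))))
    (Seq (SetArr ''mt'' (NVar ''w'') (NVar ''r''))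
    (Seq (SetArr ''d'' (NVar ''w'') (NLit 1))
    (Seq (SetArr ''gone'' (NVar ''w'') (NLit 1))
         (SetArr ''rg'' (NVar ''r'') (NLit 1))))))))))"

definition cut :: com where
  "cut = Seq reset_labels (Seq find_extension
     (Seq (While (BNot (NLess (NVar ''x'') (NVar ''M''))) (Seq improve_group find_extension)) cut_extension))"

text \<open>The variable \<open>a\<close> holds an agent who has not left; it doubles as the test for termination and as the agent whose
values guide the exchanges.\<close>

definition main_loop :: com where
  "main_loop = Seq find_alive (While (NLess (NVar ''a'') (NVar ''n''))
     (Seq find_group (Seq sum_group (Seq choose_buyer
       (Seq (Cond (NLess (NVar ''w'') (NVar ''n'')) bump cut) find_alive)))))"

text \<open>The variable \<open>M\<close> counts islands while consecutive blocks of \<open>k - 1\<close> of them become groups. The last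
one is the spare island.\<close>

definition form_groups :: com where
  "form_groups =
     Seq (SetVar ''K'' (NSub (NVar ''k'') (NLit 1)))
    (Seq (SetVar ''M'' (NLit 0))
    (Seq (For ''r'' ''n'' (For ''c'' ''K''
            (Seq (SetArr ''grp'' (NVar ''M'') (NVar ''r'')) (SetVar ''M'' (NAdd (NVar ''M'') (NLit 1))))))
    (Seq (SetArr ''grp'' (NVar ''M'') (NVar ''n'')) (SetVar ''M'' (NAdd (NVar ''M'') (NLit 1))))))"

definition read_islands :: com where
  "read_islands =
     Seq (For ''j'' ''M'' (Cond (NLess (NVar ''j'') (NVar ''m''))
            (RAssign ''pos'' (NVar ''j'') (NLit 0) (RArr ''left'' (NVar ''j'')))
            (RAssign ''pos'' (NVar ''j'') (NLit 0) (RAdd (RArr ''left'' (NVar ''j'')) (ROf (NLit 1))))))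
         (For ''i'' ''n''
            (Seq (RAssign ''W'' (NVar ''i'') (NLit 0) (ROf (NLit 0)))
            (Seq (For ''j'' ''m''
                    (Seq (EvalQuery ''v'' (NVar ''i'') (NVar ''j'') (NVar ''i'') (NVar ''j'')
                            (RArr ''left'' (NVar ''j'')) (RAdd (RArr ''left'' (NVar ''j'')) (ROf (NLit 1))))
                         (RAssign ''W'' (NVar ''i'') (NLit 0)
                            (RAdd (RArr ''W'' (NVar ''i'')) (RCell ''v'' (NVar ''i'') (NVar ''j''))))))
                 (RAssign ''W'' (NVar ''i'') (NLit 0) (RDiv (RArr ''W'' (NVar ''i'')) (ROf (NVar ''n'')))))))"

definition write_output :: com where
  "write_output = For ''i'' ''n''
     (Seq (SetVar ''c'' (NLit 0))
          (For ''j'' ''M'' (Cond (NEq (NArr ''grp'' (NVar ''j'')) (NArr ''mt'' (NVar ''i'')))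
             (Seq (RAssign ''lo'' (NVar ''i'') (NVar ''c'') (RArr ''pos'' (NVar ''j'')))
             (Seq (RAssign ''hi'' (NVar ''i'') (NVar ''c'') (RAdd (RArr ''left'' (NVar ''j'')) (ROf (NLit 1))))
                  (SetVar ''c'' (NAdd (NVar ''c'') (NLit 1)))))
             Skip)))"

definition division_program :: com where
  "division_program = Seq form_groups (Seq read_islands (Seq main_loop write_output))"

section \<open>Correctness of the program\<close>

lemma frame_nats: "frame X Y s s' \<Longrightarrow> x \<notin> X \<Longrightarrow> nats s' x = nats s x"
  and frame_reals: "frame X Y s s' \<Longrightarrow> y \<notin> Y \<Longrightarrow> reals s' y = reals s y"
  by (simp_all add: frame_def)

lemma sum_below_Suc:
  fixes f :: "nat \<Rightarrow> real"
  shows "(\<Sum>j | j < Suc i \<and> P j. f j) = (\<Sum>j | j < i \<and> P j. f j) + (if P i then f i else 0)"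
proof -
  have "{j. j < Suc i \<and> P j} = (if P i then insert i {j. j < i \<and> P j} else {j. j < i \<and> P j})"
    by (auto simp: less_Suc_eq)
  then show ?thesis by simp
qed

text \<open>The three bounds are for the main loop, for the exchange loop and for the loop over the islands of a
group. They imply bounds for the loops over agents, islands and groups.\<close>

locale cake_program = padded_cake + answers ev mk B for B +
  assumes B: "n * (n * n + 1) \<le> B" "M * M + 1 \<le> B" "k \<le> B"
begin

lemma n_le_B: "n \<le> B" using B(1) by (rule order_trans[rotated]) simp
lemma M_le_B: "M \<le> B" using B(2) by (rule order_trans[rotated]) (simp add: M_def)
lemma m_le_B: "m \<le> B" using m_le_M M_le_B by simp

text \<open>The part of the state that is never written once the islands have been read.\<close>

definition env :: "state \<Rightarrow> bool" where
  "env s \<longleftrightarrow> nats s ''m'' 0 0 = m \<and> nats s ''n'' 0 0 = n \<and> nats s ''k'' 0 0 = k \<and> nats s ''M'' 0 0 = M \<and>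
     (\<forall>j. reals s ''left'' j 0 = L j) \<and> (\<forall>i<n. reals s ''W'' i 0 = share i)"

abbreviation var :: "string \<Rightarrow> state \<Rightarrow> nat" where "var x s \<equiv> nats s x 0 0"
abbreviation grp :: "state \<Rightarrow> nat \<Rightarrow> nat" where "grp s \<equiv> \<lambda>j. nats s ''grp'' j 0"
abbreviation mt :: "state \<Rightarrow> nat \<Rightarrow> nat" where "mt s \<equiv> \<lambda>i. nats s ''mt'' i 0"
abbreviation d :: "state \<Rightarrow> nat \<Rightarrow> nat" where "d s \<equiv> \<lambda>i. nats s ''d'' i 0"
abbreviation gone :: "state \<Rightarrow> nat set" where "gone s \<equiv> {i. i < n \<and> 0 < nats s ''gone'' i 0}"

abbreviation value_of_group :: "state \<Rightarrow> nat \<Rightarrow> nat \<Rightarrow> real" where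
  "value_of_group s i r \<equiv> group_value (grp s) (reals s ''v'') i r"

definition plan_state :: "state \<Rightarrow> bool" where
  "plan_state s \<longleftrightarrow> env s \<and>
     plan (grp s) (\<lambda>j. reals s ''pos'' j 0) (reals s ''v'') (gone s) (mt s)
       (\<lambda>i. reals s ''lo'' i (k - 1)) (\<lambda>i. reals s ''hi'' i (k - 1)) \<and>
     (\<forall>g. 0 < nats s ''rg'' g 0 \<longleftrightarrow> g \<in> mt s ` gone s)"

definition main_state :: "state \<Rightarrow> bool" where
  "main_state s \<longleftrightarrow> plan_state s \<and> auction (grp s) (reals s ''v'') (gone s) (mt s) (d s)"

lemma env_frame: "env s \<Longrightarrow> frame X Y s s' \<Longrightarrow> X \<inter> {''m'', ''n'', ''k'', ''M''} = {} \<Longrightarrow>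
    Y \<inter> {''left'', ''W''} = {} \<Longrightarrow> env s'"
  by (auto simp: env_def frame_def)

lemma plan_state_frame: "plan_state s \<Longrightarrow> frame X Y s s' \<Longrightarrow>
    X \<inter> {''m'', ''n'', ''k'', ''M'', ''grp'', ''gone'', ''mt'', ''rg''} = {} \<Longrightarrow>
    Y \<inter> {''left'', ''W'', ''pos'', ''v'', ''lo'', ''hi''} = {} \<Longrightarrow> plan_state s'"
  using env_frame[of s X Y s'] by (simp add: plan_state_def frame_nats frame_reals)

lemma main_state_frame: "main_state s \<Longrightarrow> frame X Y s s' \<Longrightarrow>
    X \<inter> {''m'', ''n'', ''k'', ''M'', ''grp'', ''gone'', ''mt'', ''rg'', ''d''} = {} \<Longrightarrow>
    Y \<inter> {''left'', ''W'', ''pos'', ''v'', ''lo'', ''hi''} = {} \<Longrightarrow> main_state s'"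
  using plan_state_frame[of s X Y s'] by (simp add: main_state_def frame_nats frame_reals)

lemma wp_find_alive:
  assumes e: "env s"
    and exit: "\<And>s'. frame {''a'', ''i''} {} s s' \<Longrightarrow>
      (if \<exists>i<n. i \<notin> gone s then var ''a'' s' < n \<and> var ''a'' s' \<notin> gone s else var ''a'' s' = n) \<Longrightarrow> Q s'"
  shows "wp find_alive Q s"
  unfolding find_alive_def
proof (rule wp_Search[where N = n and P = "\<lambda>i. i \<notin> gone s"])
  show "var ''n'' s = n" using e by (simp add: env_def)
next
  fix s' j assume f: "frame (insert ''a'' (insert ''i'' (nat_names Skip))) (real_names Skip) s s'"
    and "var ''i'' s' = j" "j < n"
  then show "wp Skip (\<lambda>t. bval (alive (NVar ''i'')) t = (j \<notin> gone s)) s'"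
    by (simp add: frame_nats[OF f])
next
  fix s' assume f: "frame (insert ''a'' (insert ''i'' (nat_names Skip))) (real_names Skip) s s'"
    and "if \<exists>j<n. j \<notin> gone s then var ''a'' s' < n \<and> var ''a'' s' \<notin> gone s else var ''a'' s' = n"
  then show "Q s'" by (intro exit) simp_all
qed (simp_all add: n_le_B)

lemma wp_find_group:
  assumes e: "env s"
    and exit: "\<And>s'. frame {''r'', ''g'', ''u'', ''i''} {} s s' \<Longrightarrow>
      (if \<exists>g<n. \<forall>i<n. \<not> (0 < d s i \<and> mt s i = g)
       then var ''r'' s' < n \<and> (\<forall>i<n. \<not> (0 < d s i \<and> mt s i = var ''r'' s')) else var ''r'' s' = n) \<Longrightarrow> Q s'"
  shows "wp find_group Q s"
  unfolding find_group_def
proof (rule wp_Search[where N = n and P = "\<lambda>g. \<forall>i<n. \<not> (0 < d s i \<and> mt s i = g)"], goal_cases)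
  case (9 s' g)
  note f = frame_nats[OF 9(1)]
  show ?case
  proof (rule wp_Search[where N = n and P = "\<lambda>i. 0 < d s i \<and> mt s i = g"], goal_cases)
    case 1 then show ?case using e by (simp add: env_def f)
  next
    case (9 t j)
    then show ?case using \<open>var ''g'' s' = g\<close> by (auto simp: frame_nats[OF 9(1)] f)
  next
    case (10 t)
    then show ?case using e by (auto simp: env_def frame_nats[OF 10(1)] f split: if_splits)
  qed (simp_all add: n_le_B)
next
  case (10 s')
  show ?case by (rule exit[OF _ 10(2)]) (use 10(1) in \<open>simp add: insert_commute\<close>)
qed (use e in \<open>simp_all add: env_def n_le_B\<close>)

lemma wp_sum_group:
  assumes e: "env s"
    and exit: "\<And>s'. frame {''i'', ''j''} {''s''} s s' \<Longrightarrow>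
      (\<forall>i<n. reals s' ''s'' i 0 = value_of_group s i (var ''r'' s)) \<Longrightarrow> Q s'"
  shows "wp sum_group Q s"
  unfolding sum_group_def
proof (rule wp_For[where N = n and
      I = "\<lambda>i t. \<forall>i'<i. reals t ''s'' i' 0 = value_of_group s i' (var ''r'' s)"], goal_cases)
  case (7 i s')
  note f = frame_nats[OF 7(3)] frame_reals[OF 7(3)]
  let ?s = "s'\<lparr>reals := put (reals s') ''s'' i 0 0\<rparr>"
  have "wp (For ''j'' ''M''
             (Cond (NEq (NArr ''grp'' (NVar ''j'')) (NVar ''r''))
                (RAssign ''s'' (NVar ''i'') (NLit 0)
                   (RAdd (RArr ''s'' (NVar ''i'')) (RCell ''v'' (NVar ''i'') (NVar ''j''))))
                Skip))
      (\<lambda>t. \<forall>i'<Suc i. reals (t\<lparr>nats := put (nats t) ''i'' 0 0 (Suc i)\<rparr>) ''s'' i' 0 = value_of_group s i' (var ''r'' s)) ?s"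
  proof (rule wp_For[where N = M and I = "\<lambda>j t. (\<forall>i'<i. reals t ''s'' i' 0 = value_of_group s i' (var ''r'' s)) \<and>
        reals t ''s'' i 0 = (\<Sum>j' | j' < j \<and> grp s j' = var ''r'' s. reals s ''v'' i j')"], goal_cases)
    case (7 j t)
    note f' = frame_nats[OF 7(3)] frame_reals[OF 7(3)]
    show ?case using 7(1,2,4) \<open>var ''i'' s' = i\<close> \<open>i < n\<close>
      by (auto simp: f f' put_apply sum_below_Suc)
  next
    case (8 t)
    then show ?case by (auto simp: less_Suc_eq group_value_def)
  qed (use e \<open>\<forall>i'<i. _\<close> in \<open>auto simp: env_def M_le_B f put_apply\<close>)
  then show ?case using 7(2) by simp
next
  case (8 s')
  show ?case by (rule exit[OF _ 8(2)]) (use 8(1) in simp)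
qed (use e in \<open>simp_all add: env_def n_le_B\<close>)

lemma wp_choose_buyer:
  assumes e: "env s"
    and exit: "\<And>s'. frame {''w'', ''i''} {''key''} s s' \<Longrightarrow>
      (if \<exists>i<n. i \<notin> gone s \<and> share i \<le> reals s ''s'' i 0
       then var ''w'' s' < n \<and> var ''w'' s' \<notin> gone s \<and> share (var ''w'' s') \<le> reals s ''s'' (var ''w'' s') 0 \<and>
            (\<forall>i<n. i \<notin> gone s \<longrightarrow> share i \<le> reals s ''s'' i 0 \<longrightarrow> d s (var ''w'' s') \<le> d s i)
       else var ''w'' s' = n) \<Longrightarrow> Q s'"
  shows "wp choose_buyer Q s"
  unfolding choose_buyer_def wp.simps
proof (rule wp_For[where N = n and I = "\<lambda>i t. \<forall>i'<i. reals t ''key'' i' 0 = real (d s i')"], goal_cases)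
  case (7 i s')
  note f = frame_nats[OF 7(3)] frame_reals[OF 7(3)]
  show ?case using 7 by (auto simp: f put_apply less_Suc_eq)
next
  case (8 s')
  note f = frame_nats[OF 8(1)] frame_reals[OF 8(1)]
  have e': "env s'" by (rule env_frame[OF e 8(1)]) auto
  show ?case
  proof (rule wp_ArgMin[where N = n and P = "\<lambda>i. i \<notin> gone s \<and> share i \<le> reals s ''s'' i 0"], goal_cases)
    case (6 t j)
    note f' = frame_nats[OF 6(1)] frame_reals[OF 6(1)]
    show ?case using e 6 by (auto simp: env_def f f')
  next
    case (7 t)
    have fr: "frame {''w'', ''i''} {''key''} s t"
      using frame_trans[OF 8(1) 7(1)] by (rule frame_mono) auto
    show ?case by (rule exit[OF fr]) (use 7(2) 8(2) in \<open>auto split: if_splits\<close>)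
  qed (use e' in \<open>simp_all add: env_def n_le_B\<close>)
qed (use e in \<open>simp_all add: env_def n_le_B\<close>)

text \<open>After the new label is written, somebody still has the old label and the auction continues, or
nobody has and all agents with larger labels leave.\<close>

lemma wp_bump:
  assumes ms: "main_state s"
    and r: "var ''r'' s < n" "\<forall>i<n. \<not> (0 < d s i \<and> mt s i = var ''r'' s)"
    and w: "var ''w'' s < n" "var ''w'' s \<notin> gone s" "share (var ''w'' s) \<le> value_of_group s (var ''w'' s) (var ''r'' s)"
    and least: "\<forall>i<n. i \<notin> gone s \<longrightarrow> share i \<le> value_of_group s i (var ''r'' s) \<longrightarrow> d s (var ''w'' s) \<le> d s i"
  shows "wp bump (\<lambda>s'. main_state s' \<and> potential (gone s') (d s') < potential (gone s) (d s)) s"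
proof -
  let ?r = "var ''r'' s" and ?w = "var ''w'' s"
  let ?l = "d s ?w" and ?d = "(d s)(?w := Suc (d s ?w))" and ?mt = "(mt s)(?w := ?r)"
  have e: "env s" and a: "auction (grp s) (reals s ''v'') (gone s) (mt s) (d s)"
    and p: "plan (grp s) (\<lambda>j. reals s ''pos'' j 0) (reals s ''v'') (gone s) (mt s)
       (\<lambda>i. reals s ''lo'' i (k - 1)) (\<lambda>i. reals s ''hi'' i (k - 1))"
    and rg: "\<And>g. 0 < nats s ''rg'' g 0 \<longleftrightarrow> g \<in> mt s ` gone s"
    using ms unfolding main_state_def plan_state_def by blast+
  have r': "\<not> (0 < d s i \<and> mt s i = ?r)" if "i < n" for i using r(2) that by blast
  have least': "?l \<le> d s i" if "i < n" "i \<notin> gone s" "share i \<le> value_of_group s i ?r" for i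
    using least that by blast
  let ?s = "s\<lparr>nats := put (put (put (nats s) ''mt'' ?w 0 ?r) ''l'' 0 0 ?l) ''d'' ?w 0 (Suc ?l)\<rparr>"
  have s1: "grp ?s = grp s" "gone ?s = gone s" "mt ?s = ?mt" "d ?s = ?d" "var ''l'' ?s = ?l"
    "nats ?s ''rg'' = nats s ''rg''"
    by (auto simp: put_apply)
  have e1: "env ?s" using e by (simp add: env_def put_apply)
  have mt_gone: "?mt ` gone s = mt s ` gone s" using w(2) by (intro image_cong) auto
  have pot: "potential G ?d < potential (gone s) (d s)" if "gone s \<subseteq> G" for G
    by (rule potential_bump[OF a w(1,2) that refl])
  have "wp (Search ''u'' ''n'' ''i'' Skip
            (BAnd (alive (NVar ''i'')) (NEq (NArr ''d'' (NVar ''i'')) (NVar ''l''))))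
         (wp (Cond (NLess (NVar ''u'') (NVar ''n'')) Skip
            (For ''i'' ''n''
               (Cond (BAnd (alive (NVar ''i'')) (NLess (NVar ''l'') (NArr ''d'' (NVar ''i''))))
                  (Seq (SetArr ''gone'' (NVar ''i'') (NLit 1))
                       (SetArr ''rg'' (NArr ''mt'' (NVar ''i'')) (NLit 1)))
                  Skip))) (\<lambda>s'. main_state s' \<and> potential (gone s') (d s') < potential (gone s) (d s))) ?s"
  proof (rule wp_Search[where N = n and P = "\<lambda>i. i \<notin> gone s \<and> ?d i = ?l"], goal_cases)
    case (9 t j)
    note f = frame_nats[OF 9(1)]
    have "nats t ''gone'' j 0 = nats s ''gone'' j 0" "d t j = ?d j" "var ''l'' t = ?l"
      by (simp_all add: f put_apply)
    then show ?case using 9 by (auto simp del: fun_upd_apply)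
  next
    case (10 t)
    note f = frame_nats[OF 10(1)] frame_reals[OF 10(1)]
    have t: "grp t = grp s" "gone t = gone s" "mt t = ?mt" "d t = ?d" "var ''l'' t = ?l"
      "nats t ''rg'' = nats s ''rg''" "reals t = reals s"
      using s1 by (auto simp: f fun_eq_iff)
    have tg: "nats t ''gone'' = nats s ''gone''" by (simp add: f put_apply)
    have et: "env t" by (rule env_frame[OF e1 10(1)]) auto
    show ?case
    proof (cases "var ''u'' t < n")
      case True
      then have "\<exists>j<n. j \<notin> gone s \<and> ?d j = ?l" using 10(2) by (auto split: if_splits)
      then obtain i0 where i0: "i0 < n" "i0 \<notin> gone s" "?d i0 = ?l" by blast
      have "auction (grp s) (reals s ''v'') (gone s) ?mt ?d"
        by (rule auction_bump[OF a r(1) r' w least' refl refl i0])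
      moreover have "plan (grp s) (\<lambda>j. reals s ''pos'' j 0) (reals s ''v'') (gone s) ?mt
         (\<lambda>i. reals s ''lo'' i (k - 1)) (\<lambda>i. reals s ''hi'' i (k - 1))"
        by (rule plan_mt_cong[OF p]) (use w(2) in auto)
      ultimately have "main_state t"
        unfolding main_state_def plan_state_def t mt_gone using et rg by blast
      then show ?thesis using True et pot[of "gone s"] t by (simp add: env_def del: fun_upd_apply)
    next
      case False
      then have none: "?d i \<noteq> ?l" if "i < n" "i \<notin> gone s" for i
        using 10(2) that by (auto split: if_splits simp del: fun_upd_apply)
      let ?G = "gone s \<union> {i. i < n \<and> i \<notin> gone s \<and> ?l < ?d i}"
      note gap = auction_gap[OF p a r(1) r' w least' refl refl none refl]
      have "wp (For ''i'' ''n''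
               (Cond (BAnd (alive (NVar ''i'')) (NLess (NVar ''l'') (NArr ''d'' (NVar ''i''))))
                  (Seq (SetArr ''gone'' (NVar ''i'') (NLit 1))
                       (SetArr ''rg'' (NArr ''mt'' (NVar ''i'')) (NLit 1)))
                  Skip)) (\<lambda>s'. main_state s' \<and> potential (gone s') (d s') < potential (gone s) (d s)) t"
      proof (rule wp_For[where N = n and I = "\<lambda>i q.
          (\<forall>j. 0 < nats q ''gone'' j 0 \<longleftrightarrow> 0 < nats s ''gone'' j 0 \<or> j < i \<and> ?l < ?d j) \<and>
          (\<forall>g. 0 < nats q ''rg'' g 0 \<longleftrightarrow> 0 < nats s ''rg'' g 0 \<or> (\<exists>j<i. j \<notin> gone s \<and> ?l < ?d j \<and> ?mt j = g))"],
          goal_cases)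
        case (7 i q)
        note f' = frame_nats[OF 7(3)]
        have q: "mt q = ?mt" "d q = ?d" "var ''l'' q = ?l" using t by (auto simp: f' fun_eq_iff)
        have "nats q ''mt'' i 0 = ?mt i" "nats q ''d'' i 0 = ?d i" using q by metis+
        moreover have "0 < nats q ''gone'' i 0 \<longleftrightarrow> 0 < nats s ''gone'' i 0" using 7(4) by auto
        ultimately show ?case using 7(1,2,4) q(3)
          by (auto simp: put_apply less_Suc_eq simp del: fun_upd_apply simp add: fun_upd_apply[of "nats q _"] fun_upd_apply[of "nats q _ _"])
      next
        case (8 q)
        note f' = frame_nats[OF 8(1)] frame_reals[OF 8(1)]
        have G: "gone q = ?G" using 8(2) by auto
        have q: "grp q = grp s" "mt q = ?mt" "d q = ?d" "reals q = reals s" using t by (auto simp: f' fun_eq_iff)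
        have "?mt ` ?G = mt s ` gone s \<union> ?mt ` {i. i < n \<and> i \<notin> gone s \<and> ?l < ?d i}"
          using mt_gone by (simp only: image_Un)
        then have "0 < nats q ''rg'' g 0 \<longleftrightarrow> g \<in> ?mt ` ?G" for g
          using 8(2) rg by (auto simp: image_iff simp del: fun_upd_apply)
        moreover have "env q" by (rule env_frame[OF et 8(1)]) auto
        ultimately have "main_state q"
          unfolding main_state_def plan_state_def G q using gap by blast
        then show ?case unfolding G q using pot[of ?G] by blast
      qed (use et t(6) tg in \<open>simp_all add: env_def n_le_B put_apply\<close>)
      then show ?thesis using False et by (simp add: env_def)
    qed
  qed (use e in \<open>simp_all add: env_def n_le_B put_apply\<close>)
  then show ?thesis by (simp add: bump_def put_apply)
qed

lemma wp_reset_labels: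
  assumes e: "env s"
    and exit: "\<And>s'. frame {''i'', ''d''} {} s s' \<Longrightarrow>
      (\<And>j. d s' j = (if j < n \<and> j \<notin> gone s then 0 else d s j)) \<Longrightarrow> Q s'"
  shows "wp reset_labels Q s"
  unfolding reset_labels_def
proof (rule wp_For[where N = n and I = "\<lambda>i t. \<forall>j. d t j = (if j < i \<and> j \<notin> gone s then 0 else d s j)"], goal_cases)
  case (7 i t)
  note f = frame_nats[OF 7(3)]
  show ?case using 7(1,2,4) by (auto simp: f put_apply less_Suc_eq)
next
  case (8 t)
  show ?case by (rule exit) (use 8 in auto)
qed (use e in \<open>simp_all add: env_def n_le_B put_apply\<close>)

text \<open>The invariant of the exchange loop: the labels are reset, and the group \<open>r\<close> is worth less than a
share to everybody who has not left.\<close>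

definition cut_state :: "state \<Rightarrow> bool" where
  "cut_state s \<longleftrightarrow> plan_state s \<and> var ''a'' s < n \<and> var ''a'' s \<notin> gone s \<and>
     var ''r'' s < n \<and> var ''r'' s \<notin> mt s ` gone s \<and>
     (\<forall>i<n. reals s ''s'' i 0 = value_of_group s i (var ''r'' s)) \<and>
     (\<forall>i<n. i \<notin> gone s \<longrightarrow> reals s ''s'' i 0 < share i) \<and>
     (\<forall>i. i \<in> gone s \<longrightarrow> 0 < d s i) \<and> (\<forall>i<n. i \<notin> gone s \<longrightarrow> d s i = 0)"

definition extension :: "state \<Rightarrow> nat \<Rightarrow> bool" where
  "extension s z \<longleftrightarrow> grp s z \<noteq> var ''r'' s \<and> grp s z \<notin> mt s ` gone s \<and>
     (\<exists>i<n. i \<notin> gone s \<and> share i \<le> reals s ''s'' i 0 + reals s ''v'' i z)"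

definition searched :: "state \<Rightarrow> bool" where
  "searched s \<longleftrightarrow> (if \<exists>z<M. extension s z then var ''x'' s < M \<and> extension s (var ''x'' s) else var ''x'' s = M)"

definition active_inversions :: "state \<Rightarrow> (nat \<times> nat) set" where
  "active_inversions s = inversions (grp s) (reals s ''v'' (var ''a'' s)) (mt s ` gone s) (var ''r'' s)"

lemma cut_state_frame:
  assumes "cut_state s" "frame X Y s s'"
    "X \<inter> {''m'', ''n'', ''k'', ''M'', ''grp'', ''gone'', ''mt'', ''rg'', ''a'', ''r'', ''d''} = {}"
    "Y \<inter> {''left'', ''W'', ''pos'', ''v'', ''lo'', ''hi'', ''s''} = {}"
  shows "cut_state s'"
proof -
  note f = frame_nats[OF assms(2)] frame_reals[OF assms(2)]
  have eqs: "nats s' ''gone'' = nats s ''gone''" "nats s' ''a'' = nats s ''a''" "nats s' ''r'' = nats s ''r''"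
    "nats s' ''mt'' = nats s ''mt''" "nats s' ''grp'' = nats s ''grp''" "nats s' ''d'' = nats s ''d''"
    "reals s' ''s'' = reals s ''s''" "reals s' ''v'' = reals s ''v''"
    using assms(3,4) by (simp_all add: f)
  have "plan_state s \<Longrightarrow> plan_state s'" using assms(3,4) by (elim plan_state_frame[OF _ assms(2)]) simp_all
  with assms(1) show ?thesis unfolding cut_state_def eqs by (elim conjE) (intro conjI; assumption?; simp)
qed

lemma wp_find_extension:
  assumes c: "cut_state s"
  shows "wp find_extension (\<lambda>s'. cut_state s' \<and> searched s' \<and> frame {''x'', ''z'', ''u'', ''i''} {} s s') s"
  unfolding find_extension_def
proof (rule wp_Search[where N = M and P = "extension s"], goal_cases)
  case (9 s' z)
  note f = frame_nats[OF 9(1)] frame_reals[OF 9(1)]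
  have e: "env s'" "plan_state s" using c 9(1) by (auto simp: cut_state_def plan_state_def intro!: env_frame[OF _ 9(1)])
  show ?case
  proof (rule wp_Search[where N = n and P = "\<lambda>i. i \<notin> gone s \<and> share i \<le> reals s ''s'' i 0 + reals s ''v'' i z"], goal_cases)
    case (9 t j)
    note f' = frame_nats[OF 9(1)] frame_reals[OF 9(1)]
    show ?case using 9 e \<open>var ''z'' s' = z\<close> by (auto simp: env_def f f')
  next
    case (10 t)
    note f' = frame_nats[OF 10(1)] frame_reals[OF 10(1)]
    have rg: "0 < nats s ''rg'' g 0 \<longleftrightarrow> g \<in> mt s ` gone s" for g using e(2) by (simp add: plan_state_def)
    have "var ''u'' t < n \<longleftrightarrow> (\<exists>i<n. i \<notin> gone s \<and> share i \<le> reals s ''s'' i 0 + reals s ''v'' i z)"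
      using 10(2) by (auto split: if_splits)
    moreover have "var ''n'' t = n" using e(1) by (simp add: env_def f')
    ultimately show ?case using \<open>var ''z'' s' = z\<close> rg[of "nats s ''grp'' z 0"]
      by (auto simp: extension_def f f')
  qed (use e in \<open>simp_all add: env_def n_le_B\<close>)
next
  case (10 s')
  have fr: "frame {''x'', ''z'', ''u'', ''i''} {} s s'" using 10(1) by (simp add: insert_commute)
  have "cut_state s'" by (rule cut_state_frame[OF c fr]) auto
  moreover have "extension s' z = extension s z" for z
    by (simp add: extension_def frame_nats[OF fr] frame_reals[OF fr])
  ultimately show ?case using 10(2) fr by (simp add: searched_def)
qed (use c in \<open>simp_all add: cut_state_def plan_state_def env_def M_le_B\<close>)

text \<open>As no extension satisfies anybody, no exchange can lift the group to anybody's share: the exchanged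
group is contained in an extension. An improving exchange exists since otherwise \<open>top_group_extends\<close> would
give an extension.\<close>

lemma wp_improve_group:
  assumes c: "cut_state s" and se: "searched s" and x: "\<not> var ''x'' s < M"
  shows "wp improve_group (\<lambda>s'. cut_state s' \<and> gone s' = gone s \<and> card (active_inversions s') < card (active_inversions s)) s"
proof -
  let ?a = "var ''a'' s" and ?r = "var ''r'' s"
  have ps: "plan_state s" and a: "?a < n" "?a \<notin> gone s" and r: "?r < n" "?r \<notin> mt s ` gone s"
    and sums: "\<And>i. i < n \<Longrightarrow> reals s ''s'' i 0 = value_of_group s i ?r"
    and poor: "\<And>i. i < n \<Longrightarrow> i \<notin> gone s \<Longrightarrow> reals s ''s'' i 0 < share i"
    using c by (auto simp: cut_state_def)
  have e: "env s" and rg: "\<And>g. 0 < nats s ''rg'' g 0 \<longleftrightarrow> g \<in> mt s ` gone s"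
    and p: "plan (grp s) (\<lambda>j. reals s ''pos'' j 0) (reals s ''v'') (gone s) (mt s)
       (\<lambda>i. reals s ''lo'' i (k - 1)) (\<lambda>i. reals s ''hi'' i (k - 1))"
    using ps unfolding plan_state_def by blast+
  have noext: "\<not> extension s z" if "z < M" for z using se x that by (auto simp: searched_def split: if_splits)
  have ne: "active_inversions s \<noteq> {}"
    using top_group_extends[OF p a r] noext a sums unfolding active_inversions_def extension_def by fastforce
  let ?inv = "\<lambda>y z. grp s y = ?r \<and> grp s z \<noteq> ?r \<and> grp s z \<notin> mt s ` gone s \<and> reals s ''v'' ?a y < reals s ''v'' ?a z"
  have inv: "(y, z) \<in> active_inversions s \<longleftrightarrow> y < M \<and> z < M \<and> ?inv y z" for y z
    by (auto simp: active_inversions_def inversions_def)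
  have wp_z: "wp (Search ''z'' ''M'' ''t'' Skip (inversion (NVar q) (NVar ''t''))) Q t"
    if q: "q \<in> {''j'', ''y''}" "var q t = y" and f: "frame X {} s t" "X \<inter> {''M'', ''grp'', ''r'', ''rg'', ''a''} = {}"
      and exit: "\<And>t'. frame {''z'', ''t''} {} t t' \<Longrightarrow>
         (if \<exists>z<M. ?inv y z then var ''z'' t' < M \<and> ?inv y (var ''z'' t') else var ''z'' t' = M) \<Longrightarrow> Q t'"
    for q Q t y X
  proof (rule wp_Search[where N = M and P = "?inv y"], goal_cases)
    case 1 then show ?case using e f by (simp add: env_def frame_nats)
  next
    case (9 t' z)
    note f' = frame_nats[OF 9(1)] frame_reals[OF 9(1)]
    have q': "nats t' q 0 0 = y" using q by (auto simp: f')
    have "X \<inter> {''M'', ''grp'', ''r'', ''rg'', ''a''} = {}" by (rule f)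
    then have g: "nats t ''grp'' = nats s ''grp''" "nats t ''r'' = nats s ''r''" "nats t ''rg'' = nats s ''rg''"
      "nats t ''a'' = nats s ''a''" "reals t = reals s"
      using f(1) by (auto simp: frame_def)
    show ?case using 9(2,3) q' rg[of "nats s ''grp'' z 0"] by (auto simp: f' g)
  next
    case (10 t')
    then show ?case by (intro exit) auto
  qed (simp_all add: M_le_B)
  let ?rest = "Seq (Search ''z'' ''M'' ''t'' Skip (inversion (NVar ''y'') (NVar ''t'')))
    (Seq (SetArr ''grp'' (NVar ''y'') (NArr ''grp'' (NVar ''z'')))
    (Seq (SetArr ''grp'' (NVar ''z'') (NVar ''r''))
         (For ''i'' ''n'' (RAssign ''s'' (NVar ''i'') (NLit 0)
            (RSub (RAdd (RArr ''s'' (NVar ''i'')) (RCell ''v'' (NVar ''i'') (NVar ''z'')))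
                  (RCell ''v'' (NVar ''i'') (NVar ''y'')))))))"
  let ?Q = "\<lambda>s'. cut_state s' \<and> gone s' = gone s \<and> card (active_inversions s') < card (active_inversions s)"
  have "wp (Search ''y'' ''M'' ''j'' (Search ''z'' ''M'' ''t'' Skip (inversion (NVar ''j'') (NVar ''t'')))
            (NLess (NVar ''z'') (NVar ''M''))) (wp ?rest ?Q) s"
  proof (rule wp_Search[where N = M and P = "\<lambda>y. \<exists>z<M. ?inv y z"], goal_cases)
    case (9 t y)
    show ?case
    proof (rule wp_z[where X = "{''y'', ''j'', ''z'', ''t''}" and y = y], goal_cases)
      case (5 t')
      have "var ''M'' t' = M" using e by (simp add: env_def frame_nats[OF 5(1)] frame_nats[OF 9(1)])
      then show ?case using 5(2) by (auto split: if_splits)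
    qed (use 9 in auto)
  next
    case (10 t)
    let ?y = "var ''y'' t"
    obtain y0 z0 where "(y0, z0) \<in> active_inversions s" using ne by auto
    then have "\<exists>y<M. \<exists>z<M. ?inv y z" using inv by blast
    then have y: "?y < M" "\<exists>z<M. ?inv ?y z" using 10(2) by auto
    have "wp (Search ''z'' ''M'' ''t'' Skip (inversion (NVar ''y'') (NVar ''t'')))
      (wp (Seq (SetArr ''grp'' (NVar ''y'') (NArr ''grp'' (NVar ''z'')))
    (Seq (SetArr ''grp'' (NVar ''z'') (NVar ''r''))
         (For ''i'' ''n'' (RAssign ''s'' (NVar ''i'') (NLit 0)
            (RSub (RAdd (RArr ''s'' (NVar ''i'')) (RCell ''v'' (NVar ''i'') (NVar ''z'')))
                  (RCell ''v'' (NVar ''i'') (NVar ''y''))))))) ?Q) t"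
    proof (rule wp_z[where X = "{''y'', ''j'', ''z'', ''t''}" and y = ?y], goal_cases)
      case (5 t')
      let ?z = "var ''z'' t'"
      have z: "?z < M" "?inv ?y ?z" using 5(2) y(2) by (auto split: if_splits)
      then have yz: "(?y, ?z) \<in> active_inversions s" using inv y by blast
      have fr: "frame {''y'', ''j'', ''z'', ''t''} {} s t'"
        using frame_trans[OF 10(1) 5(1)] by (rule frame_mono) auto
      note f = frame_nats[OF fr] frame_reals[OF fr]
      let ?t = "t'\<lparr>nats := put (put (nats t') ''grp'' ?y 0 (nats s ''grp'' ?z 0)) ''grp'' ?z 0 ?r\<rparr>"
      have y': "var ''y'' t' = ?y" by (simp add: frame_nats[OF 5(1)])
      have "wp (For ''i'' ''n'' (RAssign ''s'' (NVar ''i'') (NLit 0)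
            (RSub (RAdd (RArr ''s'' (NVar ''i'')) (RCell ''v'' (NVar ''i'') (NVar ''z'')))
                  (RCell ''v'' (NVar ''i'') (NVar ''y''))))) ?Q ?t"
      proof (rule wp_For[where N = n and I = "\<lambda>i q. \<forall>i'. reals q ''s'' i' 0 =
            reals s ''s'' i' 0 + (if i' < i then reals s ''v'' i' ?z - reals s ''v'' i' ?y else 0)"], goal_cases)
        case (7 i q)
        note f' = frame_nats[OF 7(3)] frame_reals[OF 7(3)]
        show ?case using 7(1,2,4) y' by (auto simp: f' f put_apply)
      next
        case (8 q)
        note f' = frame_nats[OF 8(1)] frame_reals[OF 8(1)]
        have yz': "grp s ?y = ?r" "?y \<noteq> ?z" using z(2) by auto
        have q: "grp q = exchange (grp s) ?y ?z" "gone q = gone s" "mt q = mt s" "nats q ''d'' = nats s ''d''" "var ''r'' q = ?r"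
          "var ''a'' q = ?a" "nats q ''rg'' = nats s ''rg''" "reals q ''v'' = reals s ''v''"
          "reals q ''pos'' = reals s ''pos''" "reals q ''lo'' = reals s ''lo''" "reals q ''hi'' = reals s ''hi''"
          using yz' by (auto simp: exchange_def f' f put_apply fun_eq_iff)
        have eq: "env q" using e by (auto simp: env_def f' f put_apply)
        have "plan (exchange (grp s) ?y ?z) (\<lambda>j. reals s ''pos'' j 0) (reals s ''v'') (gone s) (mt s)
          (\<lambda>i. reals s ''lo'' i (k - 1)) (\<lambda>i. reals s ''hi'' i (k - 1))"
          by (rule plan_exchange[OF p y(1) z(1)]) (use z(2) r(2) in auto)
        then have ps': "plan_state q" unfolding plan_state_def q using eq rg by blast
        have sum': "reals q ''s'' i 0 = value_of_group q i ?r" if "i < n" for i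
          using group_value_exchange[OF y(1) z(1), of "grp s" ?r "reals s ''v''" i] 8(2) that z(2) sums[OF that]
          unfolding q by simp
        have poor': "reals q ''s'' i 0 < share i" if i: "i < n" "i \<notin> gone s" for i
        proof -
          have "\<not> share i \<le> reals s ''s'' i 0 + reals s ''v'' i ?z"
            using noext[OF z(1)] z(2) i unfolding extension_def by blast
          moreover have "0 \<le> reals s ''v'' i ?y" by (rule v_nonneg[OF p i(1) y(1)])
          ultimately show ?thesis using 8(2) i by simp
        qed
        have sum'': "\<forall>i<n. reals q ''s'' i 0 = group_value (exchange (grp s) ?y ?z) (reals s ''v'') i ?r"
          using sum' unfolding q by blast
        have poor'': "\<forall>i<n. i \<notin> gone s \<longrightarrow> reals q ''s'' i 0 < share i" using poor' by blast
        have labels: "\<forall>i. i \<in> gone s \<longrightarrow> 0 < d s i" "\<forall>i<n. i \<notin> gone s \<longrightarrow> d s i = 0"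
          using c unfolding cut_state_def by - (elim conjE, assumption)+
        have "cut_state q"
          unfolding cut_state_def q by (intro conjI ps' a r sum'' poor'' labels)
        moreover have "card (active_inversions q) < card (active_inversions s)"
          using exchange_fewer_inversions[OF yz[unfolded active_inversions_def] r(2)] unfolding active_inversions_def q .
        ultimately show ?case using q(2) by blast
      qed (use e in \<open>simp_all add: env_def n_le_B f put_apply\<close>)
      then show ?case using y' by (simp add: f put_apply)
    qed (use 10 in auto)
    then show ?case by simp
  qed (use e in \<open>simp_all add: env_def M_le_B\<close>)
  then show ?thesis by (simp add: improve_group_def)
qed

text \<open>Once the first agent has been found, \<open>plan_cut\<close> applies, and the auction starts afresh with all labels
of the remaining agents at 0.\<close>

lemma wp_cut_extension:
  assumes c: "cut_state s" and se: "searched s" and x: "var ''x'' s < M"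
  shows "wp cut_extension (\<lambda>s'. main_state s' \<and> (\<exists>w. w < n \<and> w \<notin> gone s \<and> gone s' = insert w (gone s))) s"
proof -
  let ?x = "var ''x'' s" and ?r = "var ''r'' s"
  define Q where "Q = (\<lambda>s'. main_state s' \<and> (\<exists>w. w < n \<and> w \<notin> gone s \<and> gone s' = insert w (gone s)))"
  let ?pos = "\<lambda>j. reals s ''pos'' j 0"
  have ps: "plan_state s" and r: "?r < n" "?r \<notin> mt s ` gone s"
    and sums: "\<And>i. i < n \<Longrightarrow> reals s ''s'' i 0 = value_of_group s i ?r"
    and poor: "\<And>i. i < n \<Longrightarrow> i \<notin> gone s \<Longrightarrow> reals s ''s'' i 0 < share i"
    and labels: "\<And>i. i \<in> gone s \<Longrightarrow> 0 < d s i" "\<And>i. i < n \<Longrightarrow> i \<notin> gone s \<Longrightarrow> d s i = 0"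
    using c by (auto simp: cut_state_def)
  have e: "env s" and rg: "\<And>g. 0 < nats s ''rg'' g 0 \<longleftrightarrow> g \<in> mt s ` gone s"
    and p: "plan (grp s) ?pos (reals s ''v'') (gone s) (mt s)
       (\<lambda>i. reals s ''lo'' i (k - 1)) (\<lambda>i. reals s ''hi'' i (k - 1))"
    using ps unfolding plan_state_def by blast+
  have ext: "extension s ?x" using se x by (auto simp: searched_def split: if_splits)
  let ?key = "\<lambda>i. mk i ?x (ev i ?x (L ?x) (?pos ?x) + (share i - reals s ''s'' i 0))"
  let ?sat = "\<lambda>i. i \<notin> gone s \<and> share i \<le> reals s ''s'' i 0 + reals s ''v'' i ?x"
  have "wp cut_extension Q s" unfolding cut_extension_def
  proof (subst wp.simps(6), rule wp_For[where N = n and I = "\<lambda>i t. \<forall>i'<i. reals t ''key'' i' 0 = ?key i'"], goal_cases)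
    case (7 i t)
    note f = frame_nats[OF 7(3)] frame_reals[OF 7(3)]
    show ?case using 7(1,2,4) e by (auto simp: env_def f put_apply less_Suc_eq)
  next
    case (8 t)
    note f = frame_nats[OF 8(1)] frame_reals[OF 8(1)]
    have et: "env t" by (rule env_frame[OF e 8(1)]) auto
    show ?case
    proof (subst wp.simps(6), rule wp_ArgMin[where N = n and P = ?sat], goal_cases)
      case (6 t' i)
      note f' = frame_nats[OF 6(1)] frame_reals[OF 6(1)]
      show ?case using 6 e by (auto simp: env_def f f')
    next
      case (7 t')
      note f' = frame_nats[OF 7(1)] frame_reals[OF 7(1)]
      let ?w = "var ''w'' t'"
      have "\<exists>i<n. ?sat i" using ext by (auto simp: extension_def)
      then have w: "?w < n" "?w \<notin> gone s" "share ?w \<le> reals s ''s'' ?w 0 + reals s ''v'' ?w ?x"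
        and first: "\<And>i. i < n \<Longrightarrow> ?sat i \<Longrightarrow> reals t ''key'' ?w 0 \<le> reals t ''key'' i 0"
        using 7(2) by auto
      have key: "reals t' ''key'' i 0 = ?key i" if "i < n" for i
        using 8(2) that by (simp add: f')
      let ?c = "reals t' ''key'' ?w 0"
      let ?t = "t'\<lparr>reals := put (put (put (reals t') ''lo'' ?w (k - 1) (?pos ?x)) ''hi'' ?w (k - 1) ?c) ''pos'' ?x 0 ?c\<rparr>"
      let ?end = "Seq (SetArr ''mt'' (NVar ''w'') (NVar ''r''))
          (Seq (SetArr ''d'' (NVar ''w'') (NLit 1))
          (Seq (SetArr ''gone'' (NVar ''w'') (NLit 1))
               (SetArr ''rg'' (NVar ''r'') (NLit 1))))"
      have "wp (For ''i'' ''n''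
           (EvalQuery ''v'' (NVar ''i'') (NVar ''x'') (NVar ''i'') (NVar ''x'')
              (RArr ''pos'' (NVar ''x'')) (RAdd (RArr ''left'' (NVar ''x'')) (ROf (NLit 1))))) (wp ?end Q) ?t"
      proof (rule wp_For[where N = n and I = "\<lambda>i q. \<forall>i' j. reals q ''v'' i' j =
            (if i' < i \<and> j = ?x then ev i' ?x ?c (L ?x + 1) else reals s ''v'' i' j)"], goal_cases)
        case (7 i q)
        note f'' = frame_nats[OF 7(3)] frame_reals[OF 7(3)]
        show ?case using 7(1,2,4) e by (auto simp: env_def f'' f' f put_apply less_Suc_eq)
      next
        case (8 q)
        note f'' = frame_nats[OF 8(1)] frame_reals[OF 8(1)]
        have qw: "var ''w'' q = ?w" "var ''r'' q = ?r" by (simp_all add: f'' f' f)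
        let ?q = "q\<lparr>nats := put (put (put (put (nats q) ''mt'' ?w 0 ?r) ''d'' ?w 0 1) ''gone'' ?w 0 1) ''rg'' ?r 0 1\<rparr>"
        have q: "grp ?q = grp s" "mt ?q = (mt s)(?w := ?r)" "gone ?q = insert ?w (gone s)"
          "(\<lambda>j. reals ?q ''pos'' j 0) = ?pos(?x := ?c)"
          "(\<lambda>i. reals ?q ''lo'' i (k - 1)) = (\<lambda>i. reals s ''lo'' i (k - 1))(?w := ?pos ?x)"
          "(\<lambda>i. reals ?q ''hi'' i (k - 1)) = (\<lambda>i. reals s ''hi'' i (k - 1))(?w := ?c)"
          using w(1) by (auto simp: f'' f' f put_apply)
        have eq: "env ?q" using e by (auto simp: env_def f'' f' f put_apply)
        have "plan (grp s) (?pos(?x := ?c)) (reals ?q ''v'') (insert ?w (gone s)) ((mt s)(?w := ?r))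
            ((\<lambda>i. reals s ''lo'' i (k - 1))(?w := ?pos ?x)) ((\<lambda>i. reals s ''hi'' i (k - 1))(?w := ?c))"
        proof (rule plan_cut[OF p w(1,2) r x, where key = "\<lambda>i. reals t' ''key'' i 0"], goal_cases)
          case (3 i) then show ?case using poor sums by simp
        next
          case 4 then show ?case using w(1,3) sums by simp
        next
          case (5 i) then show ?case using key sums by simp
        next
          case (6 i) then show ?case using first[of i] sums by (simp add: f')
        next
          case (7 i j) then show ?case using 8(2) by (simp add: put_apply)
        qed (use ext in \<open>auto simp: extension_def\<close>)
        then have plan': "plan (grp ?q) (\<lambda>j. reals ?q ''pos'' j 0) (reals ?q ''v'') (gone ?q) (mt ?q)
            (\<lambda>i. reals ?q ''lo'' i (k - 1)) (\<lambda>i. reals ?q ''hi'' i (k - 1))"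
          unfolding q .
        have "((mt s)(?w := ?r)) ` insert ?w (gone s) = insert ?r (mt s ` gone s)" using w(2) by auto
        moreover have "0 < nats ?q ''rg'' g 0 \<longleftrightarrow> g = ?r \<or> 0 < nats s ''rg'' g 0" for g
          by (simp add: f'' f' f put_apply)
        ultimately have "0 < nats ?q ''rg'' g 0 \<longleftrightarrow> g \<in> mt ?q ` gone ?q" for g
          unfolding q using rg[of g] by simp
        then have "plan_state ?q" using eq plan' unfolding plan_state_def by blast
        moreover have "auction (grp ?q) (reals ?q ''v'') (gone ?q) (mt ?q) (d ?q)"
        proof (rule auction_reset[OF plan'])
          have dq: "d ?q i = (if i = ?w then 1 else d s i)" for i by (simp add: f'' f' f put_apply)
          show "0 < d ?q i" if "i \<in> gone ?q" for i
            using that labels(1)[of i] unfolding q dq by auto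
          show "d ?q i = 0" if "i < n" "i \<notin> gone ?q" for i
            using that labels(2)[of i] unfolding q dq by auto
        qed
        ultimately have "main_state ?q" unfolding main_state_def by blast
        then have "Q ?q" using w(1,2) q(3) unfolding Q_def by blast
        then show ?case using qw by (simp add: put_apply)
      qed (use e in \<open>simp_all add: env_def n_le_B f' f put_apply\<close>)
      moreover have "var ''k'' t' = k" "reals t' ''pos'' ?x 0 = ?pos ?x" "var ''x'' t' = ?x"
        using e by (simp_all add: env_def f' f)
      ultimately show ?case by (simp add: put_apply)
    qed (use et in \<open>simp_all add: env_def n_le_B\<close>)
  qed (use e in \<open>simp_all add: env_def n_le_B put_apply\<close>)
  then show ?thesis unfolding Q_def .
qed

lemma wp_cut:
  assumes ms: "main_state s" and a: "var ''a'' s < n" "var ''a'' s \<notin> gone s"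
    and r: "var ''r'' s < n" "\<forall>i<n. \<not> (0 < d s i \<and> mt s i = var ''r'' s)"
    and sums: "\<forall>i<n. reals s ''s'' i 0 = value_of_group s i (var ''r'' s)"
    and poor: "\<forall>i<n. i \<notin> gone s \<longrightarrow> reals s ''s'' i 0 < share i"
  shows "wp cut (\<lambda>s'. main_state s' \<and> potential (gone s') (d s') < potential (gone s) (d s)) s"
    (is "wp _ ?Q _")
proof -
  have ps: "plan_state s" and e: "env s" and au: "auction (grp s) (reals s ''v'') (gone s) (mt s) (d s)"
    using ms unfolding main_state_def plan_state_def by blast+
  show ?thesis unfolding cut_def
  proof (subst wp.simps(6), rule wp_reset_labels[OF e], goal_cases)
    case (1 s1)
    note f = frame_nats[OF 1(1)] frame_reals[OF 1(1)]
    have eqs: "nats s1 ''gone'' = nats s ''gone''" "nats s1 ''a'' = nats s ''a''" "nats s1 ''r'' = nats s ''r''"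
      "nats s1 ''mt'' = nats s ''mt''" "nats s1 ''grp'' = nats s ''grp''"
      "reals s1 = reals s" by (simp_all add: f fun_eq_iff)
    have ps1: "plan_state s1" by (rule plan_state_frame[OF ps 1(1)]) auto
    have dpos: "0 < d s i" if "i \<in> gone s" for i using auctionD(2)[OF au that] by simp
    have r': "var ''r'' s \<notin> mt s ` gone s"
    proof
      assume "var ''r'' s \<in> mt s ` gone s"
      then obtain i where "i \<in> gone s" "mt s i = var ''r'' s" by auto
      then show False using r(2) dpos[of i] by auto
    qed
    have l1: "\<forall>i. i \<in> gone s \<longrightarrow> 0 < d s1 i" using dpos 1(2) by simp
    have l2: "\<forall>i<n. i \<notin> gone s \<longrightarrow> d s1 i = 0" using 1(2) by simp
    have c1: "cut_state s1" unfolding cut_state_def eqs by (intro conjI ps1 a r(1) r' sums poor l1 l2)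
    have "wp find_extension (\<lambda>t. cut_state t \<and> searched t \<and> gone t = gone s) s1"
      using wp_find_extension[OF c1]
    proof (rule wp_mono)
      fix t assume t: "cut_state t \<and> searched t \<and> frame {''x'', ''z'', ''u'', ''i''} {} s1 t"
      then have "nats t ''gone'' = nats s1 ''gone''" by (simp add: frame_def)
      then show "cut_state t \<and> searched t \<and> gone t = gone s" using t eqs(1) by simp
    qed
    then show ?case
    proof (subst wp.simps(6), rule wp_mono)
      fix t assume t: "cut_state t \<and> searched t \<and> gone t = gone s"
      show "wp (Seq (While (BNot (NLess (NVar ''x'') (NVar ''M''))) (Seq improve_group find_extension)) cut_extension) ?Q t"
      proof (subst wp.simps(6), rule wp_While[where I = "\<lambda>t. cut_state t \<and> searched t \<and> gone t = gone s"
            and \<mu> = "\<lambda>t. if var ''x'' t < M then 0 else Suc (card (active_inversions t))"], goal_cases)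
        case 1 show ?case by (rule t)
      next
        case 2
        then show ?case using card_inversions[of "grp t" "reals t ''v'' (var ''a'' t)" "mt t ` gone t" "var ''r'' t"] B(2)
          by (simp add: active_inversions_def)
      next
        case (3 q)
        have eq: "var ''M'' q = M" using 3(1) by (simp add: cut_state_def plan_state_def env_def)
        then have nx: "\<not> var ''x'' q < M" using 3(2) by simp
        note old = 3(1)
        have "wp improve_group (wp find_extension (\<lambda>s'. (cut_state s' \<and> searched s' \<and> gone s' = gone s) \<and>
            (if var ''x'' s' < M then 0 else Suc (card (active_inversions s'))) < Suc (card (active_inversions q)))) q"
        proof (rule wp_mono[OF wp_improve_group[OF _ _ nx]], goal_cases)
          case (3 q')
          have c': "cut_state q'" "gone q' = gone q" "card (active_inversions q') < card (active_inversions q)" using 3 by auto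
          show ?case using wp_find_extension[OF c'(1)]
          proof (rule wp_mono)
            fix z assume z: "cut_state z \<and> searched z \<and> frame {''x'', ''z'', ''u'', ''i''} {} q' z"
            then have fz: "nats z ''gone'' = nats q' ''gone''" "active_inversions z = active_inversions q'"
              by (simp_all add: frame_def active_inversions_def)
            have "gone z = gone s" using fz(1) c'(2) old by simp
            then show "(cut_state z \<and> searched z \<and> gone z = gone s) \<and>
              (if var ''x'' z < M then 0 else Suc (card (active_inversions z))) < Suc (card (active_inversions q))"
              using z fz(2) c'(3) by simp
          qed
        qed (use old in auto)
        then show ?case using nx by simp
      next
        case (4 q)
        have eq: "var ''M'' q = M" using 4(1) by (simp add: cut_state_def plan_state_def env_def)
        then have x: "var ''x'' q < M" using 4(2) by simp
        have "wp cut_extension (\<lambda>s'. main_state s' \<and> (\<exists>w. w < n \<and> w \<notin> gone q \<and> gone s' = insert w (gone q))) q"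
          using 4(1) x by (intro wp_cut_extension) auto
        then show ?case
        proof (rule wp_mono)
          fix z assume z: "main_state z \<and> (\<exists>w. w < n \<and> w \<notin> gone q \<and> gone z = insert w (gone q))"
          then obtain w where w: "w < n" "w \<notin> gone s" "gone z = insert w (gone s)" using 4(1) by auto
          show "?Q z" using z potential_cut[OF au w(1,2)] w(3) by simp
        qed
      qed
    qed
  qed
qed

text \<open>The search for a buyer decides between the two ways to let somebody leave: if there is none, then the free
group is worth less than a share to everybody who has not left.\<close>

lemma wp_main_loop:
  assumes ms: "main_state s"
  shows "wp main_loop (\<lambda>s'. main_state s' \<and> gone s' = {..<n}) s"
  unfolding main_loop_def
proof (subst wp.simps(6))
  let ?Q = "\<lambda>s'. main_state s' \<and> gone s' = {..<n}"
  let ?picked = "\<lambda>s'. if \<exists>i<n. i \<notin> gone s' then var ''a'' s' < n \<and> var ''a'' s' \<notin> gone s' else var ''a'' s' = n"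
  let ?I = "\<lambda>s'. main_state s' \<and> ?picked s'"
  have env: "env t" if "main_state t" for t using that by (simp add: main_state_def plan_state_def)
  have pick: "wp find_alive (\<lambda>t'. ?I t' \<and> potential (gone t') (d t') = potential (gone t) (d t)) t" if t: "main_state t" for t
  proof (rule wp_find_alive[OF env[OF t]], goal_cases)
    case (1 t')
    have eqs: "nats t' ''gone'' = nats t ''gone''" "nats t' ''d'' = nats t ''d''"
      by (simp_all add: frame_nats[OF 1(1)])
    have "main_state t'" by (rule main_state_frame[OF t 1(1)]) auto
    then show ?case unfolding eqs using 1(2) by blast
  qed
  have loop: "wp (While (NLess (NVar ''a'') (NVar ''n''))
     (Seq find_group (Seq sum_group (Seq choose_buyer
       (Seq (Cond (NLess (NVar ''w'') (NVar ''n'')) bump cut) find_alive))))) ?Q t" if t: "?I t" for t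
  proof (rule wp_While[where I = ?I and \<mu> = "\<lambda>t. potential (gone t) (d t)"], goal_cases)
    case 1 show ?case by (rule t)
  next
    case 2 show ?case using potential_bound B(1) by (rule order_trans)
  next
    case (3 t)
    let ?Goal = "\<lambda>t'. ?I t' \<and> potential (gone t') (d t') < potential (gone t) (d t)"
    have m: "main_state t" and e: "env t" using 3 env by auto
    have a: "var ''a'' t < n" "var ''a'' t \<notin> gone t" using 3 e by (auto simp: env_def split: if_splits)
    have au: "auction (grp t) (reals t ''v'') (gone t) (mt t) (d t)" using m unfolding main_state_def by blast
    show ?case
    proof (subst wp.simps(6), rule wp_find_group[OF e], goal_cases)
      case (1 t1)
      have r: "var ''r'' t1 < n" "\<forall>i<n. \<not> (0 < d t i \<and> mt t i = var ''r'' t1)"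
        using 1(2) free_group[OF au a] by auto
      have m1: "main_state t1" by (rule main_state_frame[OF m 1(1)]) auto
      show ?case
      proof (subst wp.simps(6), rule wp_sum_group[OF env[OF m1]], goal_cases)
        case (1 t2)
        have m2: "main_state t2" by (rule main_state_frame[OF m1 1(1)]) auto
        note sums = 1(2) and f1 = \<open>frame {''r'', ''g'', ''u'', ''i''} {} t t1\<close> and f2 = 1(1)
        show ?case
        proof (subst wp.simps(6), rule wp_choose_buyer[OF env[OF m2]], goal_cases)
          case (1 t3)
          note f3 = 1(1)
          have m3: "main_state t3" by (rule main_state_frame[OF m2 f3]) auto
          have eqs: "nats t3 ''gone'' = nats t ''gone''" "nats t3 ''d'' = nats t ''d''"
            "nats t3 ''mt'' = nats t ''mt''" "nats t3 ''grp'' = nats t ''grp''" "nats t3 ''a'' = nats t ''a''"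
            "reals t3 ''v'' = reals t ''v''" "nats t3 ''r'' = nats t1 ''r''" "reals t3 ''s'' = reals t2 ''s''"
            by (simp_all add: frame_nats[OF f1] frame_nats[OF f2] frame_nats[OF f3]
                frame_reals[OF f1] frame_reals[OF f2] frame_reals[OF f3])
          have eqs2: "nats t1 ''grp'' = nats t ''grp''" "reals t1 ''v'' = reals t ''v''"
            "nats t2 ''gone'' = nats t ''gone''" "nats t2 ''d'' = nats t ''d''"
            by (simp_all add: frame_nats[OF f1] frame_nats[OF f2] frame_reals[OF f1] frame_reals[OF f2])
          have sums3: "\<forall>i<n. reals t3 ''s'' i 0 = value_of_group t3 i (var ''r'' t3)"
            using sums unfolding eqs eqs2 .
          have r3: "var ''r'' t3 < n" "\<forall>i<n. \<not> (0 < d t3 i \<and> mt t3 i = var ''r'' t3)"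
            using r unfolding eqs .
          have "wp (Cond (NLess (NVar ''w'') (NVar ''n'')) bump cut)
             (\<lambda>t'. main_state t' \<and> potential (gone t') (d t') < potential (gone t3) (d t3)) t3"
          proof (cases "\<exists>i<n. i \<notin> gone t2 \<and> share i \<le> reals t2 ''s'' i 0")
            case True
            then have w: "var ''w'' t3 < n" "var ''w'' t3 \<notin> gone t2"
              "share (var ''w'' t3) \<le> reals t2 ''s'' (var ''w'' t3) 0"
              "\<forall>i<n. i \<notin> gone t2 \<longrightarrow> share i \<le> reals t2 ''s'' i 0 \<longrightarrow> d t2 (var ''w'' t3) \<le> d t2 i"
              using 1(2) by auto
            have "wp bump (\<lambda>t'. main_state t' \<and> potential (gone t') (d t') < potential (gone t3) (d t3)) t3"
            proof (rule wp_bump[OF m3 r3 w(1)])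
              show "var ''w'' t3 \<notin> gone t3" using w(2) unfolding eqs eqs2 .
              show "share (var ''w'' t3) \<le> value_of_group t3 (var ''w'' t3) (var ''r'' t3)"
                using w(1,3) sums3 unfolding eqs by simp
              show "\<forall>i<n. i \<notin> gone t3 \<longrightarrow> share i \<le> value_of_group t3 i (var ''r'' t3) \<longrightarrow> d t3 (var ''w'' t3) \<le> d t3 i"
                using w(4) sums3 unfolding eqs eqs2 by simp
            qed
            moreover have "bval (NLess (NVar ''w'') (NVar ''n'')) t3" using env[OF m3] w(1) by (simp add: env_def)
            ultimately show ?thesis by (simp only: wp.simps if_True)
          next
            case False
            have "wp cut (\<lambda>t'. main_state t' \<and> potential (gone t') (d t') < potential (gone t3) (d t3)) t3"
            proof (rule wp_cut[OF m3 _ _ r3 sums3])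
              show "var ''a'' t3 < n" "var ''a'' t3 \<notin> gone t3" using a unfolding eqs .
              show "\<forall>i<n. i \<notin> gone t3 \<longrightarrow> reals t3 ''s'' i 0 < share i"
                using False unfolding eqs eqs2 by (meson not_le)
            qed
            moreover have "var ''w'' t3 = n" using False 1(2) by (simp only: if_False)
            then have "\<not> bval (NLess (NVar ''w'') (NVar ''n'')) t3" using env[OF m3] by (simp add: env_def)
            ultimately show ?thesis by (simp only: wp.simps if_False)
          qed
          then show ?case
          proof (subst wp.simps(6), rule wp_mono)
            fix q assume q: "main_state q \<and> potential (gone q) (d q) < potential (gone t3) (d t3)"
            then have lt: "potential (gone q) (d q) < potential (gone t) (d t)" unfolding eqs by blast
            show "wp find_alive ?Goal q" using pick[OF conjunct1[OF q]]
            proof (rule wp_mono)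
              fix z assume z: "?I z \<and> potential (gone z) (d z) = potential (gone q) (d q)"
              show "?Goal z" by (rule conjI[OF conjunct1[OF z]]) (simp only: conjunct2[OF z] lt)
            qed
          qed
        qed
      qed
    qed
  next
    case (4 t)
    have "var ''n'' t = n" using env[of t] 4(1) by (simp add: env_def)
    then have nlt: "\<not> var ''a'' t < n" using 4(2) by simp
    have "\<not> (\<exists>i<n. i \<notin> gone t)"
    proof
      assume ex: "\<exists>i<n. i \<notin> gone t"
      from conjunct2[OF 4(1)] show False unfolding if_P[OF ex] using nlt by blast
    qed
    then have "gone t = {..<n}" by auto
    then show ?case using 4(1) by blast
  qed
  show "wp find_alive (wp (While (NLess (NVar ''a'') (NVar ''n''))
     (Seq find_group (Seq sum_group (Seq choose_buyer
       (Seq (Cond (NLess (NVar ''w'') (NVar ''n'')) bump cut) find_alive))))) ?Q) s"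
    using pick[OF ms] by (rule wp_mono) (rule loop, blast)
qed

text \<open>A group has exactly \<open>k - 1\<close> islands, so listing them never overwrites the last slot, where the cut is.\<close>

lemma wp_write_output:
  assumes ps: "plan_state s" and all: "gone s = {..<n}"
  shows "wp write_output (\<lambda>s'. \<forall>i<n. outcome k s' i =
      (\<Union>j\<in>{j. j < M \<and> grp s j = mt s i}. {reals s ''pos'' j 0<..<L j + 1}) \<union>
      {reals s ''lo'' i (k - 1)<..<reals s ''hi'' i (k - 1)}) s"
proof -
  let ?Q = "\<lambda>s'. \<forall>i<n. outcome k s' i =
      (\<Union>j\<in>{j. j < M \<and> grp s j = mt s i}. {reals s ''pos'' j 0<..<L j + 1}) \<union>
      {reals s ''lo'' i (k - 1)<..<reals s ''hi'' i (k - 1)}"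
  let ?J = "\<lambda>l i. {j. j < l \<and> grp s j = mt s i}"
  let ?piece = "\<lambda>j. {reals s ''pos'' j 0<..<L j + 1}"
  let ?slot = "\<lambda>t i c. {reals t ''lo'' i c<..<reals t ''hi'' i c}"
  let ?last = "\<lambda>t. \<forall>i. reals t ''lo'' i (k - 1) = reals s ''lo'' i (k - 1) \<and> reals t ''hi'' i (k - 1) = reals s ''hi'' i (k - 1)"
  let ?done = "\<lambda>i t. \<forall>i'<i. (\<Union>c<k - 1. ?slot t i' c) = (\<Union>j\<in>?J M i'. ?piece j)"
  have e: "env s" and p: "plan (grp s) (\<lambda>j. reals s ''pos'' j 0) (reals s ''v'') (gone s) (mt s)
       (\<lambda>i. reals s ''lo'' i (k - 1)) (\<lambda>i. reals s ''hi'' i (k - 1))"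
    using ps unfolding plan_state_def by blast+
  have cJ: "card (?J M i) = k - 1" if "i < n" for i
  proof -
    have "mt s i < n" using planD(3)[OF p] all that by auto
    then show ?thesis by (rule planD(4)[OF p])
  qed
  show ?thesis unfolding write_output_def
  proof (rule wp_For[where N = n and I = "\<lambda>i t. ?done i t \<and> ?last t"], goal_cases)
    case (7 i t)
    note f = frame_nats[OF 7(3)] frame_reals[OF 7(3)] and i = 7(1)
    let ?t = "t\<lparr>nats := put (nats t) ''c'' 0 0 0\<rparr>"
    have "wp (For ''j'' ''M'' (Cond (NEq (NArr ''grp'' (NVar ''j'')) (NArr ''mt'' (NVar ''i'')))
             (Seq (RAssign ''lo'' (NVar ''i'') (NVar ''c'') (RArr ''pos'' (NVar ''j'')))
             (Seq (RAssign ''hi'' (NVar ''i'') (NVar ''c'') (RAdd (RArr ''left'' (NVar ''j'')) (ROf (NLit 1))))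
                  (SetVar ''c'' (NAdd (NVar ''c'') (NLit 1)))))
             Skip)) (\<lambda>q. ?done (Suc i) (q\<lparr>nats := put (nats q) ''i'' 0 0 (Suc i)\<rparr>) \<and>
               ?last (q\<lparr>nats := put (nats q) ''i'' 0 0 (Suc i)\<rparr>)) ?t"
    proof (rule wp_For[where N = M and I = "\<lambda>j q. ?done i q \<and> ?last q \<and> var ''c'' q = card (?J j i) \<and>
         (\<Union>c<card (?J j i). ?slot q i c) = (\<Union>j\<in>?J j i. ?piece j)"], goal_cases)
      case (7 j q)
      note f' = frame_nats[OF 7(3)] frame_reals[OF 7(3)]
      have iq: "var ''i'' q = i" using \<open>var ''i'' t = i\<close> by (simp add: f' put_apply)
      have test: "bval (NEq (NArr ''grp'' (NVar ''j'')) (NArr ''mt'' (NVar ''i''))) q \<longleftrightarrow> grp s j = mt s i"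
        using iq 7(2) by (auto simp: f' f put_apply)
      show ?case
      proof (cases "grp s j = mt s i")
        case True
        then have J: "?J (Suc j) i = insert j (?J j i)" by (auto simp: less_Suc_eq)
        then have cJ': "card (?J (Suc j) i) = Suc (card (?J j i))" by simp
        have "card (?J (Suc j) i) \<le> card (?J M i)" using 7(1) by (intro card_mono) auto
        then have c: "card (?J j i) < k - 1" using cJ[OF i] cJ' by simp
        let ?c = "card (?J j i)"
        let ?q = "q\<lparr>nats := put (put (nats q) ''c'' 0 0 (Suc ?c)) ''j'' 0 0 (Suc j),
            reals := put (put (reals q) ''lo'' i ?c (reals s ''pos'' j 0)) ''hi'' i ?c (L j + 1)\<rparr>"
        have "?done i ?q" using 7(4) by (auto simp: put_apply)
        moreover have "?last ?q" using 7(4) c by (auto simp: put_apply)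
        moreover have "var ''c'' ?q = card (?J (Suc j) i)" unfolding cJ' by (simp add: put_apply)
        moreover have "(\<Union>c<card (?J (Suc j) i). ?slot ?q i c) = (\<Union>j\<in>?J (Suc j) i. ?piece j)"
        proof -
          have 1: "(\<Union>c<?c. ?slot ?q i c) = (\<Union>c<?c. ?slot q i c)" by (auto simp: put_apply)
          have 2: "?slot ?q i ?c = ?piece j" by (simp add: put_apply)
          have 3: "(\<Union>c<?c. ?slot q i c) = (\<Union>j\<in>?J j i. ?piece j)" using 7(4) by blast
          show ?thesis by (subst cJ', subst J) (simp only: lessThan_Suc UN_insert 1 2 3)
        qed
        moreover have "reals q ''pos'' j 0 = reals s ''pos'' j 0" "reals q ''left'' j 0 = L j" "var ''c'' q = ?c"
          using e 7(4) by (simp_all add: env_def f' f)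
        ultimately show ?thesis using test True iq 7(2) by (simp add: put_apply)
      next
        case False
        then have J: "?J (Suc j) i = ?J j i" by (auto simp: less_Suc_eq)
        show ?thesis unfolding J using test False 7(4) by (simp add: put_apply)
      qed
    next
      case (8 q)
      then show ?case using cJ[OF i] by (auto simp: less_Suc_eq put_apply)
    qed (use e 7(4) in \<open>simp_all add: env_def M_le_B f put_apply\<close>)
    then show ?case by (simp add: put_apply)
  next
    case (8 t)
    show ?case
    proof (intro allI impI)
      fix i assume i: "i < n"
      have "{..<k} = insert (k - 1) {..<k - 1}" using k_pos by (metis Suc_diff_1 lessThan_Suc less_eq_Suc_le One_nat_def)
      then have "outcome k t i = (\<Union>c<k - 1. ?slot t i c) \<union> ?slot t i (k - 1)"
        unfolding outcome_def by (simp add: Un_commute)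
      then show "outcome k t i = (\<Union>j\<in>?J M i. ?piece j) \<union> ?slot s i (k - 1)" using 8(2) i by simp
    qed
  qed (use e in \<open>simp_all add: env_def n_le_B put_apply\<close>)
qed

lemma wp_form_groups:
  assumes s: "var ''n'' s = n" "var ''k'' s = k"
    and exit: "\<And>s'. frame {''K'', ''M'', ''r'', ''c'', ''grp''} {} s s' \<Longrightarrow> var ''M'' s' = M \<Longrightarrow>
      (\<And>q. q < n \<Longrightarrow> card {j. j < M \<and> grp s' j = q} = k - 1) \<Longrightarrow> Q s'"
  shows "wp form_groups Q s"
proof -
  let ?I = "\<lambda>l t. var ''M'' t = l \<and> (\<forall>j<l. grp t j = j div (k - 1))"
  let ?s = "s\<lparr>nats := put (put (nats s) ''K'' 0 0 (k - 1)) ''M'' 0 0 0\<rparr>"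
  let ?last = "Seq (SetArr ''grp'' (NVar ''M'') (NVar ''n'')) (SetVar ''M'' (NAdd (NVar ''M'') (NLit 1)))"
  have "wp (For ''r'' ''n'' (For ''c'' ''K''
            (Seq (SetArr ''grp'' (NVar ''M'') (NVar ''r'')) (SetVar ''M'' (NAdd (NVar ''M'') (NLit 1))))))
         (wp ?last Q) ?s"
  proof (rule wp_For[where N = n and I = "\<lambda>r. ?I (r * (k - 1))"], goal_cases)
    case (7 r t)
    note f = frame_nats[OF 7(3)]
    show ?case
    proof (rule wp_For[where N = "k - 1" and I = "\<lambda>c. ?I (r * (k - 1) + c)"], goal_cases)
      case (7 c q)
      note f' = frame_nats[OF 7(3)]
      have "(r * (k - 1) + c) div (k - 1) = r" using 7(1) by simp
      moreover have "var ''r'' q = r" using \<open>var ''r'' t = r\<close> by (simp add: f')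
      ultimately show ?case using 7(4) by (auto simp: put_apply less_Suc_eq simp del: One_nat_def)
    next
      case (8 q)
      then show ?case by (auto simp: put_apply add.commute)
    qed (use 7(4) B(3) in \<open>auto simp: f put_apply\<close>)
  next
    case (8 t)
    note f = frame_nats[OF 8(1)]
    let ?l = "n * (k - 1)"
    let ?t = "t\<lparr>nats := put (put (nats t) ''grp'' ?l 0 n) ''M'' 0 0 (Suc ?l)\<rparr>"
    have fr: "frame {''K'', ''M'', ''r'', ''c'', ''grp''} {} s ?t"
      using 8(1) by (auto simp: frame_def put_apply)
    have g: "grp ?t j = (if j < ?l then j div (k - 1) else n)" if "j < M" for j
      using that 8(2) by (auto simp: put_apply M_def less_Suc_eq)
    have "card {j. j < M \<and> grp ?t j = q} = k - 1" if q: "q < n" for q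
    proof (cases "k - 1 = 0")
      case True
      then have "{j. j < M \<and> grp ?t j = q} = {}" using g q by (auto simp: M_def)
      then show ?thesis using True by simp
    next
      case False
      define K where "K = k - 1"
      have K: "0 < K" using False by (simp add: K_def)
      have le: "q * K + K \<le> n * K" using mult_le_mono1[of "Suc q" n K] q by simp
      have block: "j div K = q \<longleftrightarrow> q * K \<le> j \<and> j < q * K + K" for j
        using less_eq_div_iff_mult_less_eq[OF K, of q j] div_less_iff_less_mult[OF K, of j "Suc q"]
        by (auto simp: add.commute)
      have MK: "M = n * K + 1" by (simp add: M_def K_def)
      define G where "G = grp ?t"
      have G: "G j = (if j < n * K then j div K else n)" if "j < M" for j
        using g[OF that] unfolding G_def K_def .
      have "j < M \<and> G j = q \<longleftrightarrow> q * K \<le> j \<and> j < q * K + K" for j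
      proof (cases "j < n * K")
        case True
        then show ?thesis using G[of j] block[of j] by (simp add: MK)
      next
        case False
        then have "\<not> j < q * K + K" using le by linarith
        moreover have "G j \<noteq> q" if "j < M" using G[OF that] False q by simp
        ultimately show ?thesis by blast
      qed
      then have "{j. j < M \<and> G j = q} = {j. q * K \<le> j \<and> j < q * K + K}" by (rule Collect_cong)
      also have "\<dots> = {q * K..<q * K + K}" by (rule set_eqI) simp
      finally have "card {j. j < M \<and> G j = q} = K" by simp
      then show ?thesis unfolding G_def K_def .
    qed
    then have "Q ?t" by (intro exit[OF fr]) (auto simp: put_apply M_def)
    moreover have "var ''n'' t = n" using s by (simp add: f put_apply)
    ultimately show ?case using 8(2) by (simp add: put_apply)
  qed (use s in \<open>simp_all add: n_le_B put_apply\<close>)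
  then show ?thesis using s by (simp add: form_groups_def put_apply)
qed

lemma wp_read_islands:
  assumes s: "var ''m'' s = m" "var ''n'' s = n" "var ''k'' s = k" "var ''M'' s = M"
    "\<forall>j. reals s ''left'' j 0 = L j" "\<forall>i j. reals s ''v'' i j = 0"
    and exit: "\<And>s'. frame {''i'', ''j''} {''pos'', ''v'', ''W''} s s' \<Longrightarrow> env s' \<Longrightarrow>
      (\<And>j. j < M \<Longrightarrow> reals s' ''pos'' j 0 = (if j < m then L j else L j + 1)) \<Longrightarrow>
      (\<And>i j. i < n \<Longrightarrow> reals s' ''v'' i j = (if j < m then ev i j (L j) (L j + 1) else 0)) \<Longrightarrow> Q s'"
  shows "wp read_islands Q s"
  unfolding read_islands_def
proof (subst wp.simps(6), rule wp_For[where N = M and I = "\<lambda>l t. \<forall>j<l. reals t ''pos'' j 0 = (if j < m then L j else L j + 1)"],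
    goal_cases)
  case (7 j t)
  note f = frame_nats[OF 7(3)] frame_reals[OF 7(3)]
  show ?case using 7(1,2,4) s by (auto simp: f put_apply less_Suc_eq)
next
  case (8 t)
  note f = frame_nats[OF 8(1)] frame_reals[OF 8(1)]
  let ?J = "\<lambda>i t. \<forall>i'. reals t ''W'' i' 0 = (if i' < i then share i' else reals s ''W'' i' 0) \<and>
      (\<forall>j. reals t ''v'' i' j = (if i' < i \<and> j < m then ev i' j (L j) (L j + 1) else 0))"
  show ?case
  proof (rule wp_For[where N = n and I = ?J], goal_cases)
    case (7 i q)
    note f' = frame_nats[OF 7(3)] frame_reals[OF 7(3)] and iq = 7(2) and Jq = 7(4)
    let ?q = "q\<lparr>reals := put (reals q) ''W'' i 0 0\<rparr>"
    let ?tail = "RAssign ''W'' (NVar ''i'') (NLit 0) (RDiv (RArr ''W'' (NVar ''i'')) (ROf (NVar ''n'')))"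
    have "wp (For ''j'' ''m''
                    (Seq (EvalQuery ''v'' (NVar ''i'') (NVar ''j'') (NVar ''i'') (NVar ''j'')
                            (RArr ''left'' (NVar ''j'')) (RAdd (RArr ''left'' (NVar ''j'')) (ROf (NLit 1))))
                         (RAssign ''W'' (NVar ''i'') (NLit 0)
                            (RAdd (RArr ''W'' (NVar ''i'')) (RCell ''v'' (NVar ''i'') (NVar ''j''))))))
         (wp ?tail (\<lambda>t. ?J (Suc i) (t\<lparr>nats := put (nats t) ''i'' 0 0 (Suc i)\<rparr>))) ?q"
    proof (rule wp_For[where N = m and I = "\<lambda>l u. \<forall>i'. reals u ''W'' i' 0 =
          (if i' < i then share i' else if i' = i then \<Sum>j<l. ev i j (L j) (L j + 1) else reals s ''W'' i' 0) \<and>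
          (\<forall>j. reals u ''v'' i' j = (if i' < i \<and> j < m \<or> i' = i \<and> j < l then ev i' j (L j) (L j + 1) else 0))"],
        goal_cases)
      case (7 j u)
      note f'' = frame_nats[OF 7(3)] frame_reals[OF 7(3)]
      have "var ''i'' u = i" using iq by (simp add: f'')
      then show ?case using 7(1,2,4) s by (auto simp: f'' f' f put_apply less_Suc_eq)
    next
      case (8 u)
      note f'' = frame_nats[OF 8(1)] frame_reals[OF 8(1)]
      have "var ''i'' u = i" "var ''n'' u = n" using iq s by (simp_all add: f'' f' f)
      then show ?case using 8(2) by (auto simp: put_apply less_Suc_eq share_def)
    qed (use Jq s in \<open>auto simp: f' f put_apply m_le_B\<close>)
    then show ?case using iq by (simp add: put_apply)
  next
    case (8 q)
    note f' = frame_nats[OF 8(1)] frame_reals[OF 8(1)]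
    have fr: "frame {''i'', ''j''} {''pos'', ''v'', ''W''} s q"
      using frame_trans[OF \<open>frame _ _ s t\<close> 8(1)] by (rule frame_mono) auto
    have "env q" unfolding env_def using s 8(2) by (simp add: f' f)
    then show ?case
      by (rule exit[OF fr]) (use 8(2) \<open>\<forall>j<M. reals t ''pos'' j 0 = _\<close> in \<open>auto simp: f'\<close>)
  qed (use s in \<open>auto simp: f put_apply n_le_B\<close>)
qed (use s in \<open>simp_all add: put_apply M_le_B\<close>)

text \<open>When the program stops, everybody has left according to a plan, and the output consists of
the remainders of the islands in the agent's group and of the piece that the agent cut.\<close>

lemma wp_division_program:
  assumes s: "var ''m'' s = m" "var ''n'' s = n" "var ''k'' s = k"
    "\<forall>j. reals s ''left'' j 0 = L j" "\<forall>i j. reals s ''v'' i j = 0"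
    "\<forall>i j. reals s ''lo'' i j = 0" "\<forall>i j. reals s ''hi'' i j = 0"
    "\<forall>i. nats s ''gone'' i 0 = 0" "\<forall>g. nats s ''rg'' g 0 = 0" "\<forall>i. d s i = 0"
  shows "wp division_program (\<lambda>s'. \<exists>grp pos v mt lo hi. plan grp pos v {..<n} mt lo hi \<and>
     (\<forall>i<n. outcome k s' i = (\<Union>j\<in>{j. j < M \<and> grp j = mt i}. {pos j<..<L j + 1}) \<union> {lo i<..<hi i})) s"
    (is "wp _ ?Q s")
  unfolding division_program_def
proof (subst wp.simps(6), rule wp_form_groups[OF s(2,3)], goal_cases)
  case (1 s1)
  note f = frame_nats[OF 1(1)] frame_reals[OF 1(1)]
  have gs: "card {j. j < M \<and> grp s1 j = q} = k - 1" if "q < n" for q by (rule 1(3)[OF that])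
  show ?case
  proof (subst wp.simps(6), rule wp_read_islands, goal_cases)
    case (7 s2)
    note f' = frame_nats[OF 7(1)] frame_reals[OF 7(1)]
    have gone0: "gone s2 = {}" using s by (simp add: f' f)
    have "plan (grp s2) (\<lambda>j. reals s2 ''pos'' j 0) (reals s2 ''v'') {} (mt s2)
       (\<lambda>i. reals s2 ''lo'' i (k - 1)) (\<lambda>i. reals s2 ''hi'' i (k - 1))"
      by (rule plan_initial) (use s 7(3,4) gs in \<open>auto simp: f' f\<close>)
    moreover from this have "auction (grp s2) (reals s2 ''v'') {} (mt s2) (d s2)"
      by (rule auction_reset) (use s in \<open>auto simp: f' f\<close>)
    ultimately have "main_state s2"
      unfolding main_state_def plan_state_def gone0 using 7(2) s by (simp add: f' f)
    from wp_main_loop[OF this] show ?case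
    proof (subst wp.simps(6), rule wp_mono)
      fix t assume t: "main_state t \<and> gone t = {..<n}"
      then have ps: "plan_state t" by (simp add: main_state_def)
      then have p: "plan (grp t) (\<lambda>j. reals t ''pos'' j 0) (reals t ''v'') {..<n} (mt t)
       (\<lambda>i. reals t ''lo'' i (k - 1)) (\<lambda>i. reals t ''hi'' i (k - 1))"
        using t unfolding plan_state_def by simp
      show "wp write_output ?Q t"
        using wp_write_output[OF ps conjunct2[OF t]]
      proof (rule wp_mono)
        fix s' assume "\<forall>i<n. outcome k s' i = (\<Union>j\<in>{j. j < M \<and> grp t j = mt t i}. {reals t ''pos'' j 0<..<L j + 1}) \<union>
            {reals t ''lo'' i (k - 1)<..<reals t ''hi'' i (k - 1)}"
        with p show "?Q s'"
          by (intro exI[of _ "grp t"] exI[of _ "\<lambda>j. reals t ''pos'' j 0"] exI[of _ "reals t ''v''"] exI[of _ "mt t"]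
              exI[of _ "\<lambda>i. reals t ''lo'' i (k - 1)"] exI[of _ "\<lambda>i. reals t ''hi'' i (k - 1)"] conjI)
      qed
    qed
  qed (use s 1(2) in \<open>simp_all add: f\<close>)
qed

end

section \<open>Islands and value-measures\<close>

text \<open>End-points apart, an island is determined by its left end.\<close>

lemma unit_interval_shape:
  fixes S :: "real set"
  assumes int: "is_interval S" and len: "measure lborel S = 1"
  shows "{Inf S<..<Inf S + 1} \<subseteq> S" "S \<subseteq> {Inf S..Inf S + 1}"
proof -
  have ne: "S \<noteq> {}" using len by auto
  have meas: "S \<in> sets borel" using int by (simp add: is_interval_convex real_interval_borel_measurable)
  have fin: "emeasure lborel S < \<infinity>" using len unfolding measure_def by (fastforce simp: top.not_eq_extremum)
  have short: "y - x \<le> 1" if "x \<in> S" "y \<in> S" for x y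
  proof (cases "x \<le> y")
    case True
    have "{x..y} \<subseteq> S" using mem_is_interval_1_I[OF int that] by (simp add: subset_iff)
    then have "measure lborel {x..y} \<le> measure lborel S"
      using fin meas by (intro measure_mono_fmeasurable fmeasurableI) auto
    then show ?thesis using True len by simp
  qed simp
  obtain x0 where x0: "x0 \<in> S" using ne by auto
  have below: "bdd_below S" by (rule bdd_belowI[of _ "x0 - 1"]) (use short[OF _ x0] in force)
  have above: "bdd_above S" by (rule bdd_aboveI[of _ "x0 + 1"]) (use short[OF x0] in force)
  have inner: "{Inf S<..<Sup S} \<subseteq> S"
  proof
    fix z assume "z \<in> {Inf S<..<Sup S}"
    then obtain x y where "x \<in> S" "x < z" "y \<in> S" "z < y"
      using cInf_less_iff[OF ne below] less_cSup_iff[OF ne above] by auto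
    then show "z \<in> S" using mem_is_interval_1_I[OF int, of x y z] by simp
  qed
  have outer: "S \<subseteq> {Inf S..Sup S}" using below above by (auto intro: cInf_lower cSup_upper)
  have le: "Inf S \<le> Sup S" using outer x0 by fastforce
  have "measure lborel S \<le> measure lborel {Inf S..Sup S}"
    using outer meas by (intro measure_mono_fmeasurable fmeasurableI) (auto simp: emeasure_lborel_Icc_eq)
  moreover have "measure lborel {Inf S<..<Sup S} \<le> measure lborel S"
    using inner fin meas by (intro measure_mono_fmeasurable fmeasurableI) auto
  ultimately have "Sup S = Inf S + 1" using le len by simp
  then show "{Inf S<..<Inf S + 1} \<subseteq> S" "S \<subseteq> {Inf S..Inf S + 1}" using inner outer by simp_all
qed

lemma unit_interval_closure:
  fixes S :: "real set"
  assumes "is_interval S" "measure lborel S = 1"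
  shows "closure S = {Inf S..Inf S + 1}"
proof
  show "closure S \<subseteq> {Inf S..Inf S + 1}"
    using unit_interval_shape(2)[OF assms] by (intro closure_minimal) auto
  have "closure {Inf S<..<Inf S + 1} \<subseteq> closure S"
    by (intro closure_mono unit_interval_shape(1)[OF assms])
  then show "{Inf S..Inf S + 1} \<subseteq> closure S" by simp
qed

locale valued_cake =
  fixes C :: "real set" and V :: "real set \<Rightarrow> real"
  assumes V: "value_measure C V"
begin

lemma density:
  obtains v where "\<And>x. x \<in> C \<Longrightarrow> 0 \<le> v x" "set_integrable lebesgue C v"
    "\<And>Z. Z \<in> sets borel \<Longrightarrow> Z \<subseteq> C \<Longrightarrow> V Z = (LINT x:Z|lebesgue. v x)"
  using V unfolding value_measure_def by (metis sets_completionI_sets sets_lborel)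

lemma value_nonneg: "Z \<in> sets borel \<Longrightarrow> Z \<subseteq> C \<Longrightarrow> 0 \<le> V Z"
proof -
  assume Z: "Z \<in> sets borel" "Z \<subseteq> C"
  obtain v where "\<And>x. x \<in> C \<Longrightarrow> 0 \<le> v x" "V Z = (LINT x:Z|lebesgue. v x)"
    using density Z by metis
  then show ?thesis using Z
    by (auto simp: set_lebesgue_integral_def indicator_def intro!: Bochner_Integration.integral_nonneg)
qed

lemma value_UN:
  assumes "finite J" "disjoint_family_on A J" "\<And>j. j \<in> J \<Longrightarrow> A j \<in> sets borel" "\<And>j. j \<in> J \<Longrightarrow> A j \<subseteq> C"
  shows "V (\<Union>j\<in>J. A j) = (\<Sum>j\<in>J. V (A j))"
proof -
  obtain v where v: "set_integrable lebesgue C v"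
    "\<And>Z. Z \<in> sets borel \<Longrightarrow> Z \<subseteq> C \<Longrightarrow> V Z = (LINT x:Z|lebesgue. v x)"
    using density by metis
  have "set_integrable lebesgue (A j) v" if "j \<in> J" for j
    using set_integrable_subset[OF v(1)] assms(3,4)[OF that] by simp
  then have "(LINT x:(\<Union>j\<in>J. A j)|lebesgue. v x) = (\<Sum>j\<in>J. LINT x:A j|lebesgue. v x)"
    using assms by (intro set_integral_finite_Union) auto
  moreover have "(\<Union>j\<in>J. A j) \<in> sets borel" "(\<Union>j\<in>J. A j) \<subseteq> C" using assms by auto
  ultimately show ?thesis using v(2) assms by simp
qed

lemma value_Un:
  assumes "A \<in> sets borel" "B \<in> sets borel" "A \<inter> B = {}" "A \<subseteq> C" "B \<subseteq> C"
  shows "V (A \<union> B) = V A + V B"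
  using value_UN[of "UNIV :: bool set" "\<lambda>b. if b then A else B"] assms
  by (simp add: disjoint_family_on_def UNIV_bool Un_commute Int_commute add.commute)

lemma value_finite:
  assumes "finite F" "F \<subseteq> C"
  shows "V F = 0"
proof -
  obtain v where "\<And>Z. Z \<in> sets borel \<Longrightarrow> Z \<subseteq> C \<Longrightarrow> V Z = (LINT x:Z|lebesgue. v x)"
    using density by metis
  moreover have "F \<in> sets borel" using assms(1) by (simp add: finite_imp_closed borel_closed)
  moreover have "F \<in> null_sets lebesgue" using assms(1) by (simp add: negligible_finite flip: negligible_iff_null_sets)
  then have "(LINT x:F|lebesgue. u x) = 0" for u :: "real \<Rightarrow> real"
    unfolding set_lebesgue_integral_def
    by (intro integral_eq_zero_AE eventually_mono[OF AE_not_in]) auto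
  ultimately show ?thesis using assms(2) by simp
qed

text \<open>Finitely many points have no value. This makes up for the difference between the open intervals
in the output, the closed ones in queries, and islands that may or may not contain their ends.\<close>

lemma value_almost_eq:
  assumes "A \<subseteq> B" "finite (B - A)" "A \<in> sets borel" "B \<subseteq> C"
  shows "V A = V B"
proof -
  have "B - A \<in> sets borel" using assms(2) by (simp add: finite_imp_closed borel_closed)
  then have "V (A \<union> (B - A)) = V A + V (B - A)" using assms by (intro value_Un) auto
  moreover have "V (B - A) = 0" using assms by (intro value_finite) auto
  moreover have "A \<union> (B - A) = B" using assms(1) by auto
  ultimately show ?thesis by simp
qed

end

section \<open>From truthful answers to the allocation\<close>

text \<open>An instance of the problem together with truthful answers. It is a padded cake in the sense above,
where the dummy islands are placed at 0 because the input has 0 there.\<close>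

locale truthful_cake =
  fixes m n k :: nat and I :: "nat \<Rightarrow> real set" and V :: "nat \<Rightarrow> real set \<Rightarrow> real"
    and ev :: "nat \<Rightarrow> nat \<Rightarrow> real \<Rightarrow> real \<Rightarrow> real" and mk :: "nat \<Rightarrow> nat \<Rightarrow> real \<Rightarrow> real"
  assumes pos: "m \<ge> 1" "n \<ge> 1" "k \<ge> 1" and enough: "real k \<ge> 1 + (real m - 1) / real n"
    and isl: "islands m I" and val: "\<And>i. i < n \<Longrightarrow> value_measure (multicake m I) (V i)"
    and tr: "truthful m I n V ev mk"
begin

abbreviation L :: "nat \<Rightarrow> real" where "L j \<equiv> if j < m then Inf (I j) else 0"

lemma island_inner: "j < m \<Longrightarrow> {L j<..<L j + 1} \<subseteq> I j"
  and island_outer: "j < m \<Longrightarrow> I j \<subseteq> {L j..L j + 1}"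
  and island_closure: "j < m \<Longrightarrow> closure (I j) = {L j..L j + 1}"
  using isl unit_interval_shape[of "I j"] unit_interval_closure[of "I j"] by (auto simp: islands_def)

lemma island_borel: "j < m \<Longrightarrow> I j \<in> sets borel"
  using isl by (simp add: islands_def is_interval_convex real_interval_borel_measurable)

lemma island_sub: "j < m \<Longrightarrow> I j \<subseteq> multicake m I"
  by (auto simp: multicake_def)

lemma ev_eq: "i < n \<Longrightarrow> j < m \<Longrightarrow> L j \<le> a \<Longrightarrow> a \<le> b \<Longrightarrow> b \<le> L j + 1 \<Longrightarrow> ev i j a b = V i ({a..b} \<inter> I j)"
  using tr island_closure[of j] by (auto simp: truthful_def)

lemma ev_whole: "i < n \<Longrightarrow> j < m \<Longrightarrow> ev i j (L j) (L j + 1) = V i (I j)"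
  using ev_eq[of i j "L j" "L j + 1"] island_outer[of j] by (simp add: Int_absorb1)

lemma ev_open:
  assumes "i < n" "j < m" "L j \<le> a" "a \<le> b" "b \<le> L j + 1"
  shows "V i {a<..<b} = ev i j a b"
proof -
  interpret valued_cake "multicake m I" "V i" by unfold_locales (rule val[OF assms(1)])
  have sub: "{a<..<b} \<subseteq> {a..b} \<inter> I j" using island_inner[OF assms(2)] assms by fastforce
  have "({a..b} \<inter> I j) - {a<..<b} \<subseteq> {a, b}" by auto
  then have "finite (({a..b} \<inter> I j) - {a<..<b})" by (rule finite_subset) simp
  then show ?thesis unfolding ev_eq[OF assms]
    using sub island_sub[OF assms(2)] by (intro value_almost_eq) auto
qed

lemma islands_bound: "m \<le> n * (k - 1) + 1"
proof -
  have "real m - 1 \<le> (real k - 1) * real n" using enough pos by (simp add: field_simps)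
  also have "real k - 1 = real (k - 1)" using pos by simp
  finally have "real m \<le> real (n * (k - 1) + 1)" by (simp add: mult.commute)
  then show ?thesis by (simp only: of_nat_le_iff)
qed

sublocale padded_cake ev mk m n k L
proof
  show "n \<ge> 1" "k \<ge> 1" "m \<le> n * (k - 1) + 1" by (fact pos islands_bound)+
next
  fix i j a b assume *: "i < n" "j < m" "L j \<le> a" "a \<le> b" "b \<le> L j + 1"
  interpret valued_cake "multicake m I" "V i" by unfold_locales (rule val[OF *(1)])
  show "0 \<le> ev i j a b" unfolding ev_eq[OF *]
    using island_borel[OF *(2)] island_sub[OF *(2)] by (intro value_nonneg) auto
next
  fix i j a b c assume *: "i < n" "j < m" "L j \<le> a" "a \<le> b" "b \<le> c" "c \<le> L j + 1"
  interpret valued_cake "multicake m I" "V i" by unfold_locales (rule val[OF *(1)])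
  note bor = island_borel[OF *(2)] and sub = island_sub[OF *(2)]
  have "{a..c} \<inter> I j = ({a..b} \<inter> I j) \<union> ({b<..c} \<inter> I j)" using * by auto
  then have "V i ({a..c} \<inter> I j) = V i ({a..b} \<inter> I j) + V i ({b<..c} \<inter> I j)"
    using bor sub by (simp only:) (rule value_Un, auto)
  also have "V i ({b<..c} \<inter> I j) = V i ({b..c} \<inter> I j)"
  proof (rule value_almost_eq)
    show "finite ({b..c} \<inter> I j - {b<..c} \<inter> I j)" by (rule finite_subset[of _ "{b}"]) auto
  qed (use bor sub in auto)
  finally show "ev i j a c = ev i j a b + ev i j b c"
    using ev_eq[of i j a c] ev_eq[of i j a b] ev_eq[of i j b c] * by simp
next
  fix i j r assume *: "i < n" "j < m" "0 \<le> r" "r \<le> ev i j (L j) (L j + 1)"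
  then have "r \<le> V i (I j)" using ev_whole[OF *(1,2)] by (simp only:)
  then have t: "mk i j r \<in> closure (I j)" "V i ({..mk i j r} \<inter> I j) = r"
    using tr * by (auto simp: truthful_def)
  have b: "L j \<le> mk i j r" "mk i j r \<le> L j + 1" using t(1) island_closure[OF *(2)] by auto
  have "{L j..mk i j r} \<inter> I j = {..mk i j r} \<inter> I j" using island_outer[OF *(2)] by auto
  then show "L j \<le> mk i j r \<and> mk i j r \<le> L j + 1 \<and> ev i j (L j) (mk i j r) = r"
    using ev_eq[OF *(1,2) order_refl b] t(2) b by simp
next
  fix j j' assume *: "j < m" "j' < m" "j \<noteq> j'"
  have "I j \<inter> I j' = {}" using isl * by (auto simp: islands_def disjoint_family_on_def)
  then have disj: "{L j<..<L j + 1} \<inter> {L j'<..<L j' + 1} = {}"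
    using island_inner[OF *(1)] island_inner[OF *(2)] by blast
  \<comment> \<open>if the open islands overlapped, then they would contain the middle of the overlap\<close>
  have "(max (L j) (L j') + min (L j + 1) (L j' + 1)) / 2 \<notin> {L j<..<L j + 1} \<inter> {L j'<..<L j' + 1}"
    unfolding disj by simp
  then show "L j + 1 \<le> L j' \<or> L j' + 1 \<le> L j"
    by (auto simp: max_def min_def field_simps split: if_splits)
qed

lemma share_eq: "i < n \<Longrightarrow> share i = 1 / real n * V i (multicake m I)"
proof -
  assume i: "i < n"
  interpret valued_cake "multicake m I" "V i" by unfold_locales (rule val[OF i])
  have "V i (\<Union>j\<in>{..<m}. I j) = (\<Sum>j<m. V i (I j))"
    using isl island_borel island_sub by (intro value_UN) (auto simp: islands_def)
  then show ?thesis unfolding share_def using ev_whole[OF i] by (simp add: multicake_def)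
qed

text \<open>Once everybody has left, a plan describes disjoint pieces: remainders of different islands, and cuts,
which lie below the remainder of their island. A group has \<open>k - 1\<close> islands, so together with the cut there are
at most \<open>k\<close> intervals.\<close>

lemma plan_allocation:
  assumes p: "plan grp pos v {..<n} mt lo hi"
    and Z: "\<And>i. i < n \<Longrightarrow> Z i = (\<Union>j\<in>{j. j < M \<and> grp j = mt i}. {pos j<..<L j + 1}) \<union> {lo i<..<hi i}"
  shows "allocation (multicake m I) n Z \<and> feasible k m I n Z \<and> proportional (multicake m I) n V Z"
proof -
  let ?J = "\<lambda>i. {j. j < M \<and> grp j = mt i}"
  let ?P = "\<lambda>j. {pos j<..<L j + 1}"
  let ?D = "\<lambda>i. {lo i<..<hi i}"
  note P = planD[OF p]
  have mt: "mt i < n" if "i < n" for i using P(3) that by auto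
  have Pempty: "?P j = {}" if "j < M" "\<not> j < m" for j using P(7)[OF that(1)] that by auto
  have Psub: "?P j \<subseteq> I j" if "j < m" for j using island_inner[OF that] P(5)[OF that] by fastforce
  have D: "(\<exists>x<m. L x \<le> lo i \<and> lo i \<le> hi i \<and> hi i \<le> pos x \<and>
                  share i \<le> group_value grp v i (mt i) + ev i x (lo i) (hi i)) \<or>
             hi i \<le> lo i \<and> share i \<le> group_value grp v i (mt i)" if "i < n" for i
    using P(11) that by simp
  have Dsub: "\<exists>x<m. ?D i \<subseteq> I x" if i: "i < n" for i
    using D[OF i]
  proof (elim disjE exE conjE, goal_cases)
    case (1 x)
    then have "?D i \<subseteq> {L x<..<L x + 1}" using P(6)[of x] by auto
    then show ?case using island_inner[of x] 1(1) by blast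
  next
    case 2
    then show ?case using pos by (intro exI[of _ 0]) auto
  qed
  have PP: "?P j \<inter> ?P j' = {}" if "j < M" "j' < M" "j \<noteq> j'" for j j'
  proof (cases "j < m \<and> j' < m")
    case True
    then show ?thesis using apart[of j j'] that P(5)[of j] P(5)[of j'] by fastforce
  next
    case False
    then show ?thesis using Pempty[of j] Pempty[of j'] that by auto
  qed
  have PD: "?P j \<inter> ?D i = {}" if j: "j < M" and i: "i < n" for i j
  proof (cases "j < m")
    case True
    from D[OF i] show ?thesis
    proof (elim disjE exE conjE, goal_cases)
      case (1 x)
      show ?case
      proof (cases "x = j")
        case False
        then show ?thesis using apart[OF True 1(1)] 1 P(5)[OF True] P(6)[OF 1(1)] by fastforce
      qed (use 1 in auto)
    qed auto
  qed (use Pempty[OF j] in simp)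
  have Zsub: "Z i \<subseteq> multicake m I" if "i < n" for i
  proof -
    have "?P j \<subseteq> multicake m I" if "j < M" for j
      using Psub[of j] Pempty[OF that] island_sub[of j] by (cases "j < m") auto
    moreover have "?D i \<subseteq> multicake m I" using Dsub[OF \<open>i < n\<close>] island_sub by blast
    ultimately show ?thesis unfolding Z[OF that] by blast
  qed
  have "Z i \<inter> Z i' = {}" if i: "i < n" "i' < n" "i \<noteq> i'" for i i'
  proof -
    have ne: "mt i \<noteq> mt i'" using P(2) i by (auto simp: inj_on_def)
    have "?P j \<inter> Z i' = {}" if "j \<in> ?J i" for j
    proof -
      have "?P j \<inter> ?P j' = {}" if "j' \<in> ?J i'" for j' using \<open>j \<in> ?J i\<close> that ne by (intro PP) auto
      then show ?thesis unfolding Z[OF i(2)] using PD[of j i'] \<open>j \<in> ?J i\<close> i by blast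
    qed
    moreover have "?D i \<inter> Z i' = {}"
    proof -
      have "?P j \<inter> ?D i = {}" if "j \<in> ?J i'" for j using that i by (intro PD) auto
      then show ?thesis unfolding Z[OF i(2)] using P(12)[OF i] by blast
    qed
    ultimately show ?thesis unfolding Z[OF i(1)] by blast
  qed
  then have alloc: "allocation (multicake m I) n Z"
    using Zsub by (auto simp: allocation_def disjoint_family_on_def)
  have feas: "feasible k m I n Z"
    unfolding feasible_def
  proof (intro allI impI)
    fix i assume i: "i < n"
    let ?S = "insert (?D i) (?P ` ?J i)"
    have "card ?S \<le> Suc (card (?P ` ?J i))" by (rule card_insert_le_m1) simp_all
    also have "\<dots> \<le> Suc (card (?J i))" by (simp add: card_image_le)
    also have "\<dots> = k" using P(4)[OF mt[OF i]] pos by simp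
    finally have "card ?S \<le> k" .
    moreover have "\<exists>j<m. ?P j' \<subseteq> I j" if "j' < M" for j'
    proof (cases "j' < m")
      case True
      then show ?thesis using Psub[OF True] by blast
    next
      case False
      then show ?thesis using Pempty[OF that False] pos(1) by (intro exI[of _ 0]) simp
    qed
    then have "\<forall>X\<in>?S. is_interval X \<and> (\<exists>j<m. X \<subseteq> I j)" using Dsub[OF i] by (auto simp: is_interval_oo)
    moreover have "Z i = \<Union>?S" using Z[OF i] by (simp add: Un_commute)
    moreover have "finite ?S" by simp
    ultimately show "\<exists>S. finite S \<and> card S \<le> k \<and> (\<forall>J\<in>S. is_interval J \<and> (\<exists>j<m. J \<subseteq> I j)) \<and> Z i = \<Union> S"
      by blast
  qed
  have "1 / real n * V i (multicake m I) \<le> V i (Z i)" if i: "i < n" for i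
  proof -
    interpret valued_cake "multicake m I" "V i" by unfold_locales (rule val[OF i])
    have ZI: "(\<Union>j\<in>?J i. ?P j) \<subseteq> multicake m I" "?D i \<subseteq> multicake m I" using Zsub[OF i] Z[OF i] by auto
    have "V i (Z i) = V i (\<Union>j\<in>?J i. ?P j) + V i (?D i)"
      unfolding Z[OF i]
    proof (rule value_Un[OF _ _ _ ZI])
      show "(\<Union>j\<in>?J i. ?P j) \<inter> ?D i = {}" using PD i by blast
    qed auto
    also have "V i (\<Union>j\<in>?J i. ?P j) = (\<Sum>j\<in>?J i. V i (?P j))"
    proof (rule value_UN)
      show "disjoint_family_on ?P (?J i)" unfolding disjoint_family_on_def using PP by blast
      show "?P j \<subseteq> multicake m I" if "j \<in> ?J i" for j using ZI(1) that by blast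
    qed auto
    also have "\<dots> = group_value grp v i (mt i)" unfolding group_value_def
    proof (rule sum.cong[OF refl])
      fix j assume "j \<in> ?J i"
      then have j: "j < M" by simp
      show "V i (?P j) = v i j"
      proof (cases "j < m")
        case True
        then show ?thesis using P(8)[OF i j] ev_open[OF i True P(5,6)[OF True] order_refl] by simp
      next
        case False
        then show ?thesis using P(8)[OF i j] Pempty[OF j False] value_finite[of "{}"] by simp
      qed
    qed
    also have "share i \<le> group_value grp v i (mt i) + V i (?D i)"
      using D[OF i]
    proof (elim disjE exE conjE, goal_cases)
      case (1 x)
      then show ?case using ev_open[OF i 1(1,2,3)] P(6)[OF 1(1)] by simp
    next
      case 2
      then show ?case using value_finite[of "{}"] by simp
    qed
    finally show ?thesis using share_eq[OF i] by simp
  qed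
  then show ?thesis using alloc feas by (auto simp: proportional_def)
qed

lemma program_divides:
  "\<exists>t s. exec ev mk division_program (initial m n k I) t s \<and> t \<le> cost ((m + n + k) ^ 5) division_program \<and>
     allocation (multicake m I) n (outcome k s) \<and> feasible k m I n (outcome k s) \<and>
     proportional (multicake m I) n V (outcome k s)"
proof -
  define N where "N = m + n + k"
  have N3: "3 \<le> N" using pos by (simp add: N_def)
  have nN: "n \<le> N" "k \<le> N" "1 \<le> N" using N3 by (auto simp: N_def)
  have "n * (k - 1) + 1 \<le> n * k"
  proof -
    have "n * (k - 1) + 1 \<le> n * (k - 1) + n * 1" using pos by simp
    also have "\<dots> = n * k" using pos(3) by (cases k) simp_all
    finally show ?thesis .
  qed
  then have "M \<le> N * N" unfolding M_def using mult_le_mono[OF nN(1,2)] by simp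
  then have "M * M + 1 \<le> N ^ 4 + 1" using mult_le_mono[of M "N * N" M "N * N"] by (simp add: eval_nat_numeral mult.assoc)
  also have "\<dots> \<le> N ^ 4 * N" using N3 mult_le_mono2[of 2 N "N ^ 4"] nN(3) by (simp add: Suc_le_eq)
  finally have B2: "M * M + 1 \<le> N ^ 5" by (simp add: eval_nat_numeral mult_ac)
  have "n * (n * n + 1) \<le> N * (N * N + N * N)"
    using nN mult_le_mono[OF nN(1) nN(1)] by (intro mult_le_mono add_mono) auto
  also have "\<dots> = 2 * N ^ 3" by (simp add: eval_nat_numeral algebra_simps)
  also have "\<dots> \<le> N ^ 2 * N ^ 3" using N3 self_le_power[of N 2] by (intro mult_le_mono1) simp
  finally have B1: "n * (n * n + 1) \<le> N ^ 5" by (simp flip: power_add)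
  have "N ^ 1 \<le> N ^ 5" using nN(3) by (intro power_increasing) auto
  then have B3: "k \<le> N ^ 5" using nN(2) by simp
  interpret cake_program ev mk m n k L "N ^ 5" by unfold_locales (fact B1 B2 B3)+
  have "wp division_program (\<lambda>s'. \<exists>grp pos v mt lo hi. plan grp pos v {..<n} mt lo hi \<and>
     (\<forall>i<n. outcome k s' i = (\<Union>j\<in>{j. j < M \<and> grp j = mt i}. {pos j<..<L j + 1}) \<union> {lo i<..<hi i}))
     (initial m n k I)"
  proof (rule wp_division_program)
    show "nats (initial m n k I) ''m'' 0 0 = m" "nats (initial m n k I) ''n'' 0 0 = n"
      "nats (initial m n k I) ''k'' 0 0 = k" by (simp_all add: initial_def put_apply)
    show "\<forall>j. reals (initial m n k I) ''left'' j 0 = L j"  by (simp add: initial_def)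
  qed (simp_all add: initial_def put_apply)
  from wp_sound[OF this] show ?thesis
  proof (elim exE conjE, goal_cases)
    case (1 t s grp pos v mt lo hi)
    have "allocation (multicake m I) n (outcome k s) \<and> feasible k m I n (outcome k s) \<and>
        proportional (multicake m I) n V (outcome k s)"
      by (rule plan_allocation[OF 1(3)]) (use 1(4) in simp)
    then show ?case using 1(1,2) unfolding N_def by blast
  qed
qed

end

theorem corollary1:
  shows "(\<forall>m n k :: nat. m \<ge> 1 \<longrightarrow> n \<ge> 1 \<longrightarrow> k \<ge> 1 \<longrightarrow> real k \<ge> 1 + (real m - 1) / real n \<longrightarrow>
            (\<forall>I V. islands m I \<longrightarrow> (\<forall>i<n. value_measure (multicake m I) (V i)) \<longrightarrow>
               (\<exists>Z. allocation (multicake m I) n Z \<and> feasible k m I n Z \<and>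
                    proportional (multicake m I) n V Z))) \<and>
         (\<exists>(p :: com) (c :: nat) (d :: nat).
            \<forall>m n k :: nat. m \<ge> 1 \<longrightarrow> n \<ge> 1 \<longrightarrow> k \<ge> 1 \<longrightarrow> real k \<ge> 1 + (real m - 1) / real n \<longrightarrow>
            (\<forall>I V ev mk. islands m I \<longrightarrow> (\<forall>i<n. value_measure (multicake m I) (V i)) \<longrightarrow>
               truthful m I n V ev mk \<longrightarrow>
               (\<exists>t s. exec ev mk p (initial m n k I) t s \<and> t \<le> c * (m + n + k) ^ d \<and>
                    allocation (multicake m I) n (outcome k s) \<and> feasible k m I n (outcome k s) \<and>
                    proportional (multicake m I) n V (outcome k s))))"
proof -
  have main: "\<exists>t s. exec ev mk division_program (initial m n k I) t s \<and>
      t \<le> cost ((m + n + k) ^ 5) division_program \<and>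
      allocation (multicake m I) n (outcome k s) \<and> feasible k m I n (outcome k s) \<and>
      proportional (multicake m I) n V (outcome k s)"
    if "m \<ge> 1" "n \<ge> 1" "k \<ge> 1" "real k \<ge> 1 + (real m - 1) / real n" "islands m I"
      "\<forall>i<n. value_measure (multicake m I) (V i)" "truthful m I n V ev mk" for m n k I V ev mk
  proof -
    interpret truthful_cake m n k I V ev mk by unfold_locales (use that in auto)
    show ?thesis by (rule program_divides)
  qed
  obtain c d where cd: "\<And>B. B \<ge> 1 \<Longrightarrow> cost B division_program \<le> c * B ^ d"
    using cost_polynomial by blast
  have time: "t \<le> c * (m + n + k) ^ (5 * d)"
    if "m \<ge> 1" "t \<le> cost ((m + n + k) ^ 5) division_program" for t m n k :: nat
  proof -
    have "(m + n + k) ^ 5 \<ge> 1" using that(1) by simp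
    from cd[OF this] that(2) show ?thesis by (simp add: power_mult)
  qed
  show ?thesis
  proof (intro conjI allI impI)
    fix m n k I V
    assume *: "m \<ge> 1" "n \<ge> 1" "k \<ge> 1" "real k \<ge> 1 + (real m - 1) / real n" "islands m I"
      "\<forall>i<n. value_measure (multicake m I) (V i)"
    obtain ev mk where "truthful m I n V ev mk" using ex_truthful[OF *(5), of n V] *(6) by blast
    from main[OF * this] show "\<exists>Z. allocation (multicake m I) n Z \<and> feasible k m I n Z \<and>
        proportional (multicake m I) n V Z" by blast
  next
    show "\<exists>p c d. \<forall>m n k :: nat. m \<ge> 1 \<longrightarrow> n \<ge> 1 \<longrightarrow> k \<ge> 1 \<longrightarrow> real k \<ge> 1 + (real m - 1) / real n \<longrightarrow>
            (\<forall>I V ev mk. islands m I \<longrightarrow> (\<forall>i<n. value_measure (multicake m I) (V i)) \<longrightarrow>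
               truthful m I n V ev mk \<longrightarrow>
               (\<exists>t s. exec ev mk p (initial m n k I) t s \<and> t \<le> c * (m + n + k) ^ d \<and>
                    allocation (multicake m I) n (outcome k s) \<and> feasible k m I n (outcome k s) \<and>
                    proportional (multicake m I) n V (outcome k s)))"
      by (rule exI[of _ division_program], rule exI[of _ c], rule exI[of _ "5 * d"]) (use main time in meson)
  qed
qed

end
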